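(* Let $N>1$ be an integer, and let $\alpha,\beta\in\mathbb C$ be such that $q:=\alpha+\beta$ satisfies $\Re(q)>2$ and $k:=\alpha-\beta\in 2\mathbb Z$. Then for $z=x+iy\in\mathbb H$ the Fourier expansion of $g_N(z,\overline z,\alpha,\beta)$ in $x$ is $$g_N(z,\overline z,\alpha,\beta)=\phi_N(y,q,k)+2(-1)^{k/2}\zeta(q)\left(\frac{\sqrt2\,\pi}{\sqrt N}\right)^{q}\sum_{n\ne 0}\frac{|n|^{q-1}}{\Gamma\left(\frac q2+\mathrm{sgn}(n)\frac k2\right)}\,W\!\left(\frac{2\pi n y}{\sqrt N};\alpha,\beta\right)\left(N^{-q/2}\mathcal L(n,\mathbf 1_{N\bullet},q)+\frac{\mathcal L(n,\mathbf 1_{\bullet},q)}{\mathcal L_N(n,\mathbf 1_{\bullet},q)}\right)e^{2\pi i n x/\sqrt N},$$ where the sum is over nonzero integers $n$ and $$\phi_N(y,q,k)=2\zeta(q)+2(-1)^{k/2}N^{-q/2}\zeta(q)\left(\frac{2y}{\sqrt N}\right)^{1-q}\frac{2\pi\,\Gamma(q-1)}{\Gamma\left(\frac{q+k}2\right)\Gamma\left(\frac{q-k}2\right)}\left(N^{-q/2}\mathcal L(0,\mathbf 1_{N\bullet},q)+\frac{\mathcal L(0,\mathbf 1_{\bullet},q)}{\mathcal L_N(0,\mathbf 1_{\bullet},q)}\right).$$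
   Context: Let $(\mathbb Z\times\mathbb Z)_{N,L}=\bigsqcup_{t\ge1}\{(m,n)\in t\mathbb Z\times t\mathbb Z:\gcd(Nm,n)=t\}$ and $(\mathbb Z\times\mathbb Z)_{N,R}=\bigsqcup_{t\ge1}\{(m,n)\in t\mathbb Z\times t\mathbb Z:\gcd(m,Nn)=t\}$. For $\alpha,\beta\in\mathbb C$ with $\alpha-\beta\in2\mathbb Z$, $\Re(\alpha+\beta)>2$ define $$g_{N,L}(z,\overline z,\alpha,\beta)=\sum_{(m,n)\in(\mathbb Z\times\mathbb Z)_{N,L}}(\sqrt N mz+n)^{-\alpha}(\sqrt N m\overline z+n)^{-\beta},$$ $$g_{N,R}(z,\overline z,\alpha,\beta)=\sum_{(m,n)\in(\mathbb Z\times\mathbb Z)_{N,R}}(mz+\sqrt N n)^{-\alpha}(m\overline z+\sqrt N n)^{-\beta},$$ and $g_N=g_{N,L}+g_{N,R}$. Here $w^{-\alpha}\overline w^{-\beta}$ is understood as $w^{-(\alpha-\beta)}|w|^{-2\beta}$. Ramanujan sums: $G(b,\mathbf 1_n)=\sum_{a\in(\mathbb Z/n\mathbb Z)^\times}e^{2\pi i ab/n}$. Dirichlet series: $\mathcal L(b,\mathbf 1_\bullet,s)=\sum_{n\ge1}G(b,\mathbf 1_n)n^{-s}$, $\mathcal L_N(b,\mathbf 1_\bullet,s)=\prod_{p\mid N}\sum_{n\ge0}G(b,\mathbf 1_{p^n})p^{-ns}$ (product over primes $p\mid N$), $\mathcal L(b,\mathbf 1_{N\bullet},s)=\sum_{n\ge1}G(b,\mathbf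 1_{Nn})n^{-s}$. The modified Whittaker function is, for real $t\neq0$, $W(t;\alpha,\beta)=|t|^{-q/2}W_{\mathrm{sgn}(t)\frac k2,\frac{q-1}2}(2|t|)$ with $q=\alpha+\beta$, $k=\alpha-\beta$, where $W_{\kappa,\mu}$ is the standard Whittaker $W$-function. $\zeta$ is the Riemann zeta function. *)

theory Defs
  imports "HOL-Analysis.Analysis" "HOL-Number_Theory.Number_Theory"
begin

definition index_L :: "nat \<Rightarrow> (int \<times> int) set" where
  "index_L N = (\<Union>t\<in>{1..}. {(m, n). t dvd m \<and> t dvd n \<and> gcd (int N * m) n = t})"

definition index_R :: "nat \<Rightarrow> (int \<times> int) set" where
  "index_R N = (\<Union>t\<in>{1..}. {(m, n). t dvd m \<and> t dvd n \<and> gcd m (int N * n) = t})"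

(* The expression w^(-\<alpha>) * (cnj w)^(-\<beta>), understood as w^(-(\<alpha>-\<beta>)) * |w|^(-2\<beta>).  It is used only
   for w \<noteq> 0 and \<alpha> - \<beta> an even integer, so the first factor is an ordinary integer power and no
   choice of branch is involved. *)
definition mixed_power :: "complex \<Rightarrow> complex \<Rightarrow> complex \<Rightarrow> complex" where
  "mixed_power \<alpha> \<beta> w = w powr (- (\<alpha> - \<beta>)) * of_real (cmod w) powr (- 2 * \<beta>)"

(* The variable conjugate to z does not appear as a separate argument: for w = sqrt N m z + n
   with m, n integers, the paired factor is cnj w. *)
definition g_L :: "nat \<Rightarrow> complex \<Rightarrow> complex \<Rightarrow> complex \<Rightarrow> complex" where
  "g_L N z \<alpha> \<beta> = (\<Sum>\<^sub>\<infinity>(m, n)\<in>index_L N.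
     mixed_power \<alpha> \<beta> (of_real (sqrt (real N)) * of_int m * z + of_int n))"

definition g_R :: "nat \<Rightarrow> complex \<Rightarrow> complex \<Rightarrow> complex \<Rightarrow> complex" where
  "g_R N z \<alpha> \<beta> = (\<Sum>\<^sub>\<infinity>(m, n)\<in>index_R N.
     mixed_power \<alpha> \<beta> (of_int m * z + of_real (sqrt (real N)) * of_int n))"

definition g_total :: "nat \<Rightarrow> complex \<Rightarrow> complex \<Rightarrow> complex \<Rightarrow> complex" where
  "g_total N z \<alpha> \<beta> = g_L N z \<alpha> \<beta> + g_R N z \<alpha> \<beta>"

(* Ramanujan sum G(b, 1_n); totatives n is a system of representatives of the units mod n. *)
definition ramanujan_sum :: "int \<Rightarrow> nat \<Rightarrow> complex" where
  "ramanujan_sum b n =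
     (\<Sum>a\<in>totatives n. exp (2 * of_real pi * \<i> * of_nat a * of_int b / of_nat n))"

(* L(b, 1_{M\<bullet>}, s); the series L(b, 1_\<bullet>, s) is the case M = 1. *)
definition ramanujan_L :: "nat \<Rightarrow> int \<Rightarrow> complex \<Rightarrow> complex" where
  "ramanujan_L M b s = (\<Sum>\<^sub>\<infinity>n\<in>{1..}. ramanujan_sum b (M * n) * of_nat n powr (- s))"

definition ramanujan_L_local :: "nat \<Rightarrow> int \<Rightarrow> complex \<Rightarrow> complex" where
  "ramanujan_L_local N b s =
     (\<Prod>p\<in>prime_factors N. \<Sum>\<^sub>\<infinity>n. ramanujan_sum b (p ^ n) * of_nat p powr (- (of_nat n * s)))"

(* The Riemann zeta function on the half-plane Re s > 1, the only region where it is needed. *)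
definition zeta :: "complex \<Rightarrow> complex" where
  "zeta s = (\<Sum>\<^sub>\<infinity>n\<in>{1..}. of_nat n powr (- s) :: complex)"

(* The standard normalisation of the Whittaker W-function on the positive real axis: the solution of
   w'' + (-1/4 + \<kappa>/x + (1/4 - \<mu>^2)/x^2) w = 0 that is asymptotic to exp (-x/2) * x^\<kappa> as
   x tends to infinity.  All other solutions not proportional to it grow like exp (x/2) * x^(-\<kappa>),
   so it is unique, and it exists for all complex \<kappa> and \<mu> (unlike the usual integral
   representation, which requires Re (1/2 + \<mu> - \<kappa>) > 0). *)
definition is_whittaker_W :: "complex \<Rightarrow> complex \<Rightarrow> (real \<Rightarrow> complex) \<Rightarrow> bool" where
  "is_whittaker_W \<kappa> \<mu> w \<longleftrightarrow>
     (\<exists>w' w''. \<forall>x>0.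
        (w has_vector_derivative w' x) (at x) \<and>
        (w' has_vector_derivative w'' x) (at x) \<and>
        w'' x + (- 1 / 4 + \<kappa> / of_real x + (1 / 4 - \<mu>\<^sup>2) / (of_real x)\<^sup>2) * w x = 0) \<and>
     ((\<lambda>x. w x / (exp (- of_real x / 2) * of_real x powr \<kappa>)) \<longlongrightarrow> 1) at_top"

(* Only meaningful for x > 0, where it is the common value at x of all w as above. *)
definition whittaker_W :: "complex \<Rightarrow> complex \<Rightarrow> real \<Rightarrow> complex" where
  "whittaker_W \<kappa> \<mu> x = (THE v. \<exists>w. is_whittaker_W \<kappa> \<mu> w \<and> v = w x)"

definition modified_W :: "real \<Rightarrow> complex \<Rightarrow> complex \<Rightarrow> complex" where
  "modified_W t \<alpha> \<beta> =
     (let q = \<alpha> + \<beta>; k = \<alpha> - \<beta>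
      in of_real \<bar>t\<bar> powr (- q / 2) * whittaker_W (of_real (sgn t) * k / 2) ((q - 1) / 2) (2 * \<bar>t\<bar>))"

definition L_factor :: "nat \<Rightarrow> int \<Rightarrow> complex \<Rightarrow> complex" where
  "L_factor N n q =
     of_nat N powr (- q / 2) * ramanujan_L N n q + ramanujan_L 1 n q / ramanujan_L_local N n q"

(* In phi and fourier_term a quotient by Gamma at a pole is 0, in agreement with 1/Gamma being entire:
   Gamma is 0 at its poles here, and division by 0 gives 0. *)
definition phi :: "nat \<Rightarrow> real \<Rightarrow> complex \<Rightarrow> int \<Rightarrow> complex" where
  "phi N y q k =
     2 * zeta q +
     2 * (-1) powi (k div 2) * of_nat N powr (- q / 2) * zeta q
       * of_real (2 * y / sqrt (real N)) powr (1 - q)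
       * (2 * of_real pi * Gamma (q - 1) / (Gamma ((q + of_int k) / 2) * Gamma ((q - of_int k) / 2)))
       * L_factor N 0 q"

definition fourier_term :: "nat \<Rightarrow> complex \<Rightarrow> complex \<Rightarrow> complex \<Rightarrow> int \<Rightarrow> complex" where
  "fourier_term N z \<alpha> \<beta> n =
     (let q = \<alpha> + \<beta>; k = \<alpha> - \<beta>
      in of_int \<bar>n\<bar> powr (q - 1) / Gamma (q / 2 + of_int (sgn n) * k / 2)
           * modified_W (2 * pi * of_int n * Im z / sqrt (real N)) \<alpha> \<beta>
           * L_factor N n q
           * exp (2 * of_real pi * \<i> * of_int n * of_real (Re z) / of_real (sqrt (real N))))"

end

(*
Summing over the gcd of (m, n) contributes the factor zeta(q). The remaining primitive sums are
grouped by residue classes of n modulo m (respectively N m), which turns each row into a sum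
over a translate of the integers; Poisson summation expands the row in exponentials and the residue
classes recombine to Ramanujan sums. The coprimality condition gcd(m, N) = 1 on the R side removes the
Euler factors at p | N from the Dirichlet series.

For the Fourier transforms one writes w^(-a) cnj(w)^(-b) as i^(b-a) (y-ix)^(-a) (y+ix)^(-b) with
principal branches. The contiguous relations between the transforms kft a b for neighbouring (a, b)
give a first-order system and hence Whittaker's equation, for all complex a, b. The asymptotic constant
is computed for Re a >= 2, Re b > 0, where inserting the Gamma integral for (y+ix)^(-b) gives
a Laplace-type integral, and is then carried to all (a, b) by the contiguous relations. This avoids
the integral representation of W, which does not converge for all parameters that occur here. The
Whittaker function of the definitions is identified with the transform by a Wronskian argument.
*)
theory Submission
  imports Defs "HOL-Probability.Sinc_Integral"
begin

section \<open>The kernel and its Fourier transform\<close>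

text \<open>The Gamma-integral representation expresses \<open>kft a b\<close> through
  \<open>kft a 0\<close>, whose exponents no longer differ by an integer, so the branch-free
  \<open>mixed_power\<close> cannot carry the argument. The factors y - ix and y + ix stay in the
  right half-plane for y > 0; there principal powers are smooth for arbitrary complex exponents.
  Evenness of k enters only through the symmetry w -> -w and the sign i^(-k) = (-1)^(k/2). The
  obstacle is that a or b may be a nonpositive integer or have a very negative real part. The
  evaluations are therefore stated with \<open>rGamma\<close>, whose recursion rGamma a = a rGamma
  (a + 1) matches the factor a in the contiguous relations. If rGamma a = 0, the transform cannot be
  normalised to W, but then it vanishes identically at positive frequencies. The trivial bound m for
  the Ramanujan sum of modulus m is the only arithmetic estimate: with Re q > 2 it justifies the
  exchanges of sums and keeps the Euler factors away from zero.\<close>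

text \<open>Differentiation under the integral sign. The mean value inequality on the convex set
  \<open>S\<close> bounds the difference quotients by \<open>g\<close>, so the remainders are
  dominated by \<open>2 * g\<close>. The derivative is taken within \<open>S\<close> so that closed
  intervals and open half-lines are both covered.\<close>

lemma has_vector_derivative_integral:
  fixes f f' :: "real \<Rightarrow> 'a \<Rightarrow> complex"
  assumes S: "convex S" "t0 \<in> S"
    and int: "\<And>t. t \<in> S \<Longrightarrow> integrable M (f t)"
    and der: "\<And>t x. t \<in> S \<Longrightarrow> x \<in> space M \<Longrightarrow>
                ((\<lambda>t. f t x) has_vector_derivative f' t x) (at t within S)"
    and bnd: "\<And>t x. t \<in> S \<Longrightarrow> x \<in> space M \<Longrightarrow> norm (f' t x) \<le> g x"
    and g: "integrable M g" and meas: "f' t0 \<in> borel_measurable M"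
  shows "((\<lambda>t. \<integral>x. f t x \<partial>M) has_vector_derivative (\<integral>x. f' t0 x \<partial>M)) (at t0 within S)"
proof -
  have int': "integrable M (f' t0)"
    by (rule Bochner_Integration.integrable_bound[OF g meas])
       (use bnd S in \<open>fastforce intro: AE_I2 order_trans[OF _ abs_ge_self]\<close>)
  define s where "s = (\<lambda>t x. (f t x - f t0 x - (t - t0) *\<^sub>R f' t0 x) /\<^sub>R norm (t - t0))"
  have lip: "norm (f t x - f t0 x) \<le> g x * norm (t - t0)" if "t \<in> S" "x \<in> space M" for t x
  proof (rule differentiable_bound[OF S(1), of "\<lambda>t. f t x" "\<lambda>t h. h *\<^sub>R f' t x"])
    show "((\<lambda>t. f t x) has_derivative (\<lambda>h. h *\<^sub>R f' u x)) (at u within S)" if "u \<in> S" for u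
      using der[OF that \<open>x \<in> space M\<close>] by (simp add: has_vector_derivative_def)
    show "onorm (\<lambda>h. h *\<^sub>R f' u x) \<le> g x" if "u \<in> S" for u
    proof (rule onorm_bound)
      show "0 \<le> g x" using bnd[OF that \<open>x \<in> space M\<close>] norm_ge_zero order_trans by blast
      show "norm (h *\<^sub>R f' u x) \<le> g x * norm h" for h
        using mult_left_mono[OF bnd[OF that \<open>x \<in> space M\<close>], of "\<bar>h\<bar>"] by (simp add: mult.commute)
    qed
  qed (use that S in auto)
  have "((\<lambda>t. \<integral>x. s t x \<partial>M) \<longlongrightarrow> (\<integral>x. 0 \<partial>M)) (at t0 within S)"
    unfolding tendsto_at_iff_sequentially
  proof (intro allI impI)
    fix X :: "nat \<Rightarrow> real"
    assume XS: "\<forall>i. X i \<in> S - {t0}" and X: "X \<longlonglongrightarrow> t0"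
    show "((\<lambda>t. \<integral>x. s t x \<partial>M) \<circ> X) \<longlonglongrightarrow> (\<integral>x. 0 \<partial>M)"
      unfolding o_def
    proof (rule integral_dominated_convergence[where w = "\<lambda>x. 2 * g x"])
      show "s (X i) \<in> borel_measurable M" for i
        using XS int S int' unfolding s_def
        by (intro borel_measurable_scaleR borel_measurable_diff borel_measurable_const)
           (auto intro!: borel_measurable_integrable)
      show "AE x in M. (\<lambda>i. s (X i) x) \<longlonglongrightarrow> 0"
      proof (rule AE_I2)
        fix x assume x: "x \<in> space M"
        from der[OF S(2) x] have "((\<lambda>t. s t x) \<longlongrightarrow> 0) (at t0 within S)"
          unfolding s_def has_vector_derivative_def has_derivative_at_within by simp
        thus "(\<lambda>i. s (X i) x) \<longlonglongrightarrow> 0"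
          using XS X unfolding tendsto_at_iff_sequentially o_def by blast
      qed
      show "AE x in M. norm (s (X i) x) \<le> 2 * g x" for i
      proof (rule AE_I2)
        fix x assume x: "x \<in> space M"
        have Xi: "X i \<in> S" "X i \<noteq> t0" using XS by auto
        have "norm (f (X i) x - f t0 x - (X i - t0) *\<^sub>R f' t0 x) \<le>
                 g x * norm (X i - t0) + norm (X i - t0) * g x"
          using lip[OF Xi(1) x] bnd[OF S(2) x]
          by (intro order_trans[OF norm_triangle_ineq4[of "_ - _"]] add_mono) (auto intro: mult_left_mono)
        thus "norm (s (X i) x) \<le> 2 * g x"
          unfolding s_def norm_scaleR using Xi(2)
          by (simp add: divide_inverse_commute[symmetric] pos_divide_le_eq mult_ac)
      qed
    qed (use g in auto)
  qed
  moreover have "(\<integral>x. s t x \<partial>M) =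
      ((\<integral>x. f t x \<partial>M) - (\<integral>x. f t0 x \<partial>M) - (t - t0) *\<^sub>R (\<integral>x. f' t0 x \<partial>M)) /\<^sub>R norm (t - t0)"
    if "t \<in> S" for t
    using int int' S that by (simp add: s_def)
  ultimately have "((\<lambda>t. ((\<integral>x. f t x \<partial>M) - (\<integral>x. f t0 x \<partial>M) - (t - t0) *\<^sub>R (\<integral>x. f' t0 x \<partial>M)) /\<^sub>R norm (t - t0))
       \<longlongrightarrow> 0) (at t0 within S)"
    by (subst tendsto_cong[of _ "\<lambda>t. \<integral>x. s t x \<partial>M"]) (auto simp: eventually_at_filter)
  thus ?thesis
    unfolding has_vector_derivative_def has_derivative_at_within
    by (auto intro: bounded_linear_scaleR_left)
qed

section \<open>Pointwise bounds and derivatives of the kernel\<close>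

text \<open>This is (y - ix)^(-a) (y + ix)^(-b). Two separate principal powers are used because
  \<open>a\<close> and \<open>b\<close> are shifted independently and \<open>b = 0\<close> has to be
  allowed with \<open>a\<close> arbitrary.\<close>

definition kern :: "complex \<Rightarrow> complex \<Rightarrow> real \<Rightarrow> real \<Rightarrow> complex" where
  "kern a b y x = Complex y (-x) powr (-a) * Complex y x powr (-b)"

lemma norm_powr_le:
  "cmod (z powr c) \<le> exp (pi * \<bar>Im c\<bar>) * cmod z powr Re c"
proof -
  have "- Im c * Arg z \<le> \<bar>Im c\<bar> * \<bar>Arg z\<bar>"
    by (metis abs_ge_self abs_minus_cancel abs_mult)
  also have "\<dots> \<le> \<bar>Im c\<bar> * pi"
    using mpi_less_Arg[of z] Arg_le_pi[of z] by (intro mult_left_mono) auto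
  finally show ?thesis
    unfolding norm_powr_complex by (simp add: mult.commute mult_left_mono)
qed

text \<open>Principal arguments are bounded, which costs the exponential of the imaginary parts;
  what remains is |y + ix|^(-Re (a + b)). Uniformity in \<open>y \<ge> m\<close> serves the
  domination arguments, and \<open>m \<le> 1\<close> gives m^2 (1 + x^2) \<le> y^2 + x^2.\<close>

lemma norm_kern_le:
  assumes "0 < m" "m \<le> 1" "m \<le> y" "2 \<le> Re (a + b)"
  shows "norm (kern a b y x) \<le>
     exp (pi * (\<bar>Im a\<bar> + \<bar>Im b\<bar>)) * m powr (- Re (a + b)) / (1 + x\<^sup>2)"
proof -
  define R where "R = sqrt (y\<^sup>2 + x\<^sup>2)"
  have y: "y > 0" using assms by simp
  have 1: "m\<^sup>2 * (1 + x\<^sup>2) \<le> y\<^sup>2 + x\<^sup>2"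
  proof -
    have "m\<^sup>2 \<le> y\<^sup>2" using assms by (intro power_mono) auto
    moreover have "m\<^sup>2 * x\<^sup>2 \<le> 1 * x\<^sup>2" using assms by (intro mult_right_mono power_le_one) auto
    ultimately show ?thesis unfolding distrib_left mult_1_right mult_1_left by linarith
  qed
  have pos: "1 + x\<^sup>2 > 0" by (simp add: add_pos_nonneg)
  have R: "R \<ge> m * sqrt (1 + x\<^sup>2)"
    using real_sqrt_le_mono[OF 1] assms by (simp add: R_def real_sqrt_mult)
  have R0: "m * sqrt (1 + x\<^sup>2) > 0" using assms pos by simp
  have "norm (kern a b y x) \<le> (exp (pi * \<bar>Im a\<bar>) * R powr (- Re a)) * (exp (pi * \<bar>Im b\<bar>) * R powr (- Re b))"
    unfolding kern_def norm_mult
    using norm_powr_le[of "Complex y (-x)" "-a"] norm_powr_le[of "Complex y x" "-b"]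
    by (intro mult_mono) (auto simp: R_def cmod_def)
  also have "\<dots> = exp (pi * (\<bar>Im a\<bar> + \<bar>Im b\<bar>)) * R powr (- Re (a + b))"
    by (simp add: exp_add powr_add powr_minus powr_diff ring_distribs divide_simps)
  also have "R powr (- Re (a + b)) \<le> (m * sqrt (1 + x\<^sup>2)) powr (- Re (a + b))"
    using R R0 assms by (intro powr_mono2') auto
  also have "\<dots> = m powr (- Re (a + b)) * sqrt (1 + x\<^sup>2) powr (- Re (a + b))"
    using assms by (simp add: powr_mult)
  also have "sqrt (1 + x\<^sup>2) powr (- Re (a + b)) \<le> sqrt (1 + x\<^sup>2) powr (- 2)"
    using assms by (intro powr_mono) auto
  also have "\<dots> = 1 / (1 + x\<^sup>2)"
    using pos by (simp add: powr_minus powr_numeral divide_simps)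
  finally show ?thesis by (simp add: mult_left_mono mult.assoc)
qed

lemma kern_has_vector_derivative_snd:
  assumes "y > 0"
  shows "((\<lambda>x. kern a b y x) has_vector_derivative
           (\<i> * a * kern (a+1) b y x - \<i> * b * kern a (b+1) y x)) (at x)"
proof -
  have 1: "((\<lambda>x. Complex y (-x)) has_vector_derivative (-\<i>)) (at x)"
    "((\<lambda>x. Complex y x) has_vector_derivative \<i>) (at x)"
    unfolding Complex_eq by (auto intro!: derivative_eq_intros)
  have nz: "Complex y x \<notin> \<real>\<^sub>\<le>\<^sub>0" "Complex y (-x) \<notin> \<real>\<^sub>\<le>\<^sub>0"
    using assms by (auto simp: complex_nonpos_Reals_iff)
  have d: "((\<lambda>z. z powr c) has_field_derivative c * z powr (c - 1)) (at z)" if "z \<notin> \<real>\<^sub>\<le>\<^sub>0" for c z :: complex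
    using that by (auto intro!: derivative_eq_intros)
  note 2 = field_vector_diff_chain_at[OF 1(1) d[OF nz(2)], of "-a"]
     field_vector_diff_chain_at[OF 1(2) d[OF nz(1)], of "-b"]
  show ?thesis
    using has_vector_derivative_mult[OF 2]
    unfolding kern_def o_def add_uminus_conv_diff minus_add_distrib by (simp add: algebra_simps)
qed

lemma kern_has_vector_derivative_fst:
  assumes "y > 0"
  shows "((\<lambda>y. kern a b y x) has_vector_derivative
           (- a * kern (a+1) b y x - b * kern a (b+1) y x)) (at y)"
proof -
  have 1: "((\<lambda>y. Complex y x) has_vector_derivative 1) (at y)" for x
    unfolding Complex_eq by (auto intro!: derivative_eq_intros)
  have nz: "Complex y x \<notin> \<real>\<^sub>\<le>\<^sub>0" for x
    using assms by (auto simp: complex_nonpos_Reals_iff)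
  have d: "((\<lambda>z. z powr c) has_field_derivative c * z powr (c - 1)) (at z)" if "z \<notin> \<real>\<^sub>\<le>\<^sub>0" for c z :: complex
    using that by (auto intro!: derivative_eq_intros)
  note 2 = field_vector_diff_chain_at[OF 1[of "-x"] d[OF nz, of "-a"]]
     field_vector_diff_chain_at[OF 1[of x] d[OF nz, of "-b"]]
  show ?thesis
    using has_vector_derivative_mult[OF 2]
    unfolding kern_def o_def add_uminus_conv_diff minus_add_distrib by (simp add: algebra_simps)
qed

lemma continuous_kern:
  assumes "y > 0"
  shows "continuous_on UNIV (kern a b y)"
  using kern_has_vector_derivative_snd[OF assms] has_vector_derivative_continuous
  by (intro continuous_at_imp_continuous_on) blast

lemma measurable_kern: "y > 0 \<Longrightarrow> kern a b y \<in> borel_measurable borel"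
  by (intro borel_measurable_continuous_onI continuous_kern)

text \<open>Multiply \<open>kern a b\<close> by (y - ix) + (y + ix) = 2y.\<close>

lemma kern_contiguous:
  assumes "y > 0"
  shows "kern (a - 1) b y x + kern a (b - 1) y x = 2 * of_real y * kern a b y x"
proof -
  have nz: "Complex y (-x) \<noteq> 0" "Complex y x \<noteq> 0" using assms by (auto simp: complex_eq_iff)
  have "Complex y (-x) powr (- (a - 1)) = Complex y (-x) * Complex y (-x) powr (-a)"
       "Complex y x powr (- (b - 1)) = Complex y x * Complex y x powr (-b)"
    using nz by (auto simp: powr_add powr_diff powr_minus divide_simps)
  moreover have "2 * of_real y = Complex y (-x) + Complex y x" by (simp add: complex_eq_iff)
  ultimately show ?thesis by (simp add: kern_def algebra_simps)
qed

lemma kern_minus: "kern a b y (-x) = kern b a y x"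
  by (simp add: kern_def)

lemma kern_scale:
  assumes "y > 0"
  shows "kern a b y (y * x) = of_real y powr (- (a + b)) * kern a b 1 x"
proof -
  have "Complex y (y * x) = of_real y * Complex 1 x" for x by (simp add: complex_eq_iff)
  from this[of x] this[of "-x"] show ?thesis using assms
    by (simp add: kern_def powr_times_real_left powr_add powr_diff powr_minus divide_simps)
qed

lemma integrable_inv_1_plus_sq: "integrable lborel (\<lambda>x::real. C / (1 + x\<^sup>2) :: real)"
proof -
  have "integrable lborel (\<lambda>x::real. inverse (1 + x\<^sup>2))"
    using integrable_inverse_1_plus_square by (simp add: set_integrable_def einterval_eq)
  thus ?thesis by (simp add: divide_inverse)
qed

lemma integrable_kern_cis:
  assumes "y > 0" "2 \<le> Re (a + b)"
  shows "integrable lborel (\<lambda>x. kern a b y x * cis (- (\<xi> * x)))"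
proof (rule Bochner_Integration.integrable_bound[OF integrable_inv_1_plus_sq])
  show "AE x in lborel. norm (kern a b y x * cis (- (\<xi> * x))) \<le>
     norm (exp (pi * (\<bar>Im a\<bar> + \<bar>Im b\<bar>)) * (min 1 y) powr (- Re (a + b)) / (1 + x\<^sup>2))"
    using norm_kern_le[of "min 1 y" y a b] assms by (auto simp: norm_mult intro!: order_trans[OF _ abs_ge_self])
  show "(\<lambda>x. kern a b y x * cis (- (\<xi> * x))) \<in> borel_measurable lborel"
    using measurable_kern[OF assms(1), of a b] unfolding cis_conv_exp by measurable
qed

section \<open>Functional relations of the Fourier transform\<close>

definition kft :: "complex \<Rightarrow> complex \<Rightarrow> real \<Rightarrow> real \<Rightarrow> complex" where
  "kft a b y \<xi> = (LBINT x. kern a b y x * cis (- (\<xi> * x)))"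

lemma integral_derivative_eq_0:
  fixes F f :: "real \<Rightarrow> complex"
  assumes "\<And>x. (F has_vector_derivative f x) (at x)" "continuous_on UNIV f" "integrable lborel f"
    and "(F \<longlongrightarrow> 0) at_top" "(F \<longlongrightarrow> 0) at_bot"
  shows "(LBINT x. f x) = 0"
proof -
  have "(LBINT x=-\<infinity>..\<infinity>. f x) = 0 - 0"
  proof (rule interval_integral_FTC_integrable[where F = F])
    show "set_integrable lborel (einterval (-\<infinity>) \<infinity>) f"
      using assms(3) by (simp add: set_integrable_def)
  qed (use assms in \<open>auto simp: ereal_tendsto_simps continuous_on_eq_continuous_at\<close>)
  thus ?thesis by (simp add: interval_integral_to_infinity_eq interval_lebesgue_integral_def set_lebesgue_integral_def)
qed

lemma cis_has_vector_derivative: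
  "((\<lambda>x. cis (c * x)) has_vector_derivative (\<i> * of_real c * cis (c * x))) (at x within S)"
proof -
  have "((\<lambda>x::real. \<i> * of_real c * of_real x) has_vector_derivative \<i> * of_real c) (at x within S)"
    by (auto intro!: derivative_eq_intros)
  from field_vector_diff_chain_within[OF this DERIV_subset[OF DERIV_exp]]
  show ?thesis by (simp add: o_def cis_conv_exp mult_ac)
qed

lemma tendsto_inv_1_plus_sq:
  "((\<lambda>x::real. C / (1 + x\<^sup>2)) \<longlongrightarrow> 0) at_top" "((\<lambda>x::real. C / (1 + x\<^sup>2)) \<longlongrightarrow> 0) at_bot"
  by real_asymp+

lemma kft_bound:
  assumes "0 < m" "m \<le> 1" "2 \<le> Re (a + b)"
  obtains C where "\<And>y \<xi>. m \<le> y \<Longrightarrow> norm (kft a b y \<xi>) \<le> C"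
proof
  let ?C = "exp (pi * (\<bar>Im a\<bar> + \<bar>Im b\<bar>)) * m powr (- Re (a + b))"
  fix y \<xi> assume y: "m \<le> y"
  show "norm (kft a b y \<xi>) \<le> (LBINT x. ?C / (1 + x\<^sup>2))"
    unfolding kft_def
    using norm_kern_le[OF assms(1,2) y assms(3)] assms y
    by (intro order_trans[OF integral_norm_bound] integral_mono integrable_norm
              integrable_inv_1_plus_sq integrable_kern_cis) (auto simp: norm_mult)
qed

text \<open>The derivative of the kernel times the exponential integrates to zero, since the kernel
  decays at both ends. Combined with the y-derivative, this relation allows either of the two
  shifted transforms to be eliminated.\<close>

lemma kft_by_parts:
  assumes "y > 0" "2 \<le> Re (a + b)"
  shows "of_real \<xi> * kft a b y \<xi> = a * kft (a+1) b y \<xi> - b * kft a (b+1) y \<xi>"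
proof -
  define c where "c = (\<lambda>x. cis (- (\<xi> * x)))"
  define f where "f = (\<lambda>x. \<i> * (a * (kern (a+1) b y x * c x) - b * (kern a (b+1) y x * c x)
                          - of_real \<xi> * (kern a b y x * c x)))"
  have ints: "integrable lborel (\<lambda>x. kern (a+1) b y x * c x)" "integrable lborel (\<lambda>x. kern a (b+1) y x * c x)"
     "integrable lborel (\<lambda>x. kern a b y x * c x)"
    unfolding c_def using assms by (auto intro!: integrable_kern_cis)
  have c: "(c has_vector_derivative (- \<i> * \<xi> * c x)) (at x)" for x
    using cis_has_vector_derivative[of "-\<xi>" x UNIV] by (simp add: c_def)
  have contc: "continuous_on UNIV c"
    using c has_vector_derivative_continuous by (intro continuous_at_imp_continuous_on) blast
  have lim: "((\<lambda>x. kern a b y x * c x) \<longlongrightarrow> 0) F"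
    if "\<And>C. ((\<lambda>x::real. C / (1 + x\<^sup>2)) \<longlongrightarrow> (0::real)) F" for F
    by (rule Lim_null_comparison[OF _ that], rule always_eventually)
       (use norm_kern_le[of "min 1 y" y a b] assms in \<open>auto simp: norm_mult c_def\<close>)
  have "(LBINT x. f x) = 0"
  proof (rule integral_derivative_eq_0[where F = "\<lambda>x. kern a b y x * c x"])
    show "((\<lambda>x. kern a b y x * c x) has_vector_derivative f x) (at x)" for x
      by (rule has_vector_derivative_eq_rhs[OF has_vector_derivative_mult[OF kern_has_vector_derivative_snd[OF assms(1)] c]])
         (simp add: f_def algebra_simps)
    show "continuous_on UNIV f" unfolding f_def
      by (intro continuous_intros contc continuous_kern assms)
    show "integrable lborel f" unfolding f_def using ints by simp
  qed (intro lim tendsto_inv_1_plus_sq)+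
  moreover have "(LBINT x. f x) = \<i> * (a * kft (a+1) b y \<xi> - b * kft a (b+1) y \<xi> - of_real \<xi> * kft a b y \<xi>)"
    unfolding f_def kft_def using ints by (simp add: c_def)
  ultimately show ?thesis by simp
qed

lemma kft_has_vector_derivative:
  assumes "y > 0" "2 \<le> Re (a + b)"
  shows "((\<lambda>y. kft a b y \<xi>) has_vector_derivative
           (- a * kft (a+1) b y \<xi> - b * kft a (b+1) y \<xi>)) (at y)"
proof -
  define c where "c = (\<lambda>x. cis (- (\<xi> * x)))"
  \<comment> \<open>On the half-line above y/2 the kernel bounds are uniform, and y lies in its
    interior.\<close>
  define m where "m = min 1 (y/2)"
  define C1 where "C1 = norm a * (exp (pi * (\<bar>Im (a+1)\<bar> + \<bar>Im b\<bar>)) * m powr (- Re (a + 1 + b)))"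
  define C2 where "C2 = norm b * (exp (pi * (\<bar>Im a\<bar> + \<bar>Im (b+1)\<bar>)) * m powr (- Re (a + (b + 1))))"
  define f' where "f' = (\<lambda>y x. - a * (kern (a+1) b y x * c x) - b * (kern a (b+1) y x * c x))"
  have ints: "integrable lborel (\<lambda>x. kern (a+1) b y x * c x)" "integrable lborel (\<lambda>x. kern a (b+1) y x * c x)"
    unfolding c_def using assms by (auto intro!: integrable_kern_cis)
  have bnd: "norm (f' t x) \<le> (C1 + C2) / (1 + x\<^sup>2)" if "t \<in> {y/2<..}" for t x
  proof -
    have "norm (f' t x) \<le> norm a * norm (kern (a+1) b t x) + norm b * norm (kern a (b+1) t x)"
      unfolding f'_def by (rule order_trans[OF norm_triangle_ineq4]) (simp add: norm_mult c_def)
    also have "\<dots> \<le> norm a * ((exp (pi * (\<bar>Im (a+1)\<bar> + \<bar>Im b\<bar>)) * m powr (- Re (a + 1 + b))) / (1 + x\<^sup>2))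
        + norm b * ((exp (pi * (\<bar>Im a\<bar> + \<bar>Im (b+1)\<bar>)) * m powr (- Re (a + (b + 1)))) / (1 + x\<^sup>2))"
      using that assms by (intro add_mono mult_left_mono norm_kern_le) (auto simp: m_def)
    also have "\<dots> = (C1 + C2) / (1 + x\<^sup>2)" by (simp add: C1_def C2_def add_divide_distrib)
    finally show ?thesis .
  qed
  have "((\<lambda>y. LBINT x. kern a b y x * c x) has_vector_derivative (LBINT x. f' y x)) (at y within {y/2<..})"
  proof (rule has_vector_derivative_integral[where g = "\<lambda>x. (C1 + C2) / (1 + x\<^sup>2)"])
    fix t x assume t: "t \<in> {y/2<..}"
    hence t0: "t > 0" using assms by auto
    show "((\<lambda>t. kern a b t x * c x) has_vector_derivative f' t x) (at t within {y / 2<..})"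
      by (rule has_vector_derivative_eq_rhs[OF has_vector_derivative_mult_left[OF has_vector_derivative_at_within[OF
           kern_has_vector_derivative_fst[OF t0]]]]) (simp add: f'_def algebra_simps)
  next
    fix t assume t: "t \<in> {y/2<..}"
    show "integrable lborel (\<lambda>x. kern a b t x * c x)"
      unfolding c_def using assms t by (intro integrable_kern_cis) auto
  next
    show "f' y \<in> borel_measurable lborel"
      unfolding f'_def using borel_measurable_integrable[OF ints(1)] borel_measurable_integrable[OF ints(2)] by measurable
  qed (use assms bnd integrable_inv_1_plus_sq in auto)
  moreover have "at y within {y/2<..} = at y" using assms by (intro at_within_open) auto
  moreover have "(LBINT x. f' y x) = - a * kft (a+1) b y \<xi> - b * kft a (b+1) y \<xi>"
    unfolding f'_def kft_def using ints by (simp add: c_def)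
  ultimately show ?thesis by (simp add: kft_def c_def)
qed

lemma kft_contiguous:
  assumes "y > 0" "1 \<le> Re (a + b)"
  shows "kft a (b + 1) y \<xi> + kft (a + 1) b y \<xi> = 2 * of_real y * kft (a + 1) (b + 1) y \<xi>"
proof -
  have i: "integrable lborel (\<lambda>x. kern a (b+1) y x * cis (- (\<xi> * x)))"
     "integrable lborel (\<lambda>x. kern (a+1) b y x * cis (- (\<xi> * x)))"
    using assms by (auto intro!: integrable_kern_cis)
  have "kft a (b + 1) y \<xi> + kft (a + 1) b y \<xi> =
      (LBINT x. 2 * of_real y * (kern (a + 1) (b + 1) y x * cis (- (\<xi> * x))))"
    unfolding kft_def Bochner_Integration.integral_add[OF i, symmetric]
    using kern_contiguous[OF assms(1), of "a+1" "b+1"] by (simp add: ring_distribs[symmetric] mult.assoc[symmetric])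
  thus ?thesis by (simp add: kft_def)
qed

lemma kft_scale:
  assumes "y > 0"
  shows "kft a b y \<xi> = of_real y powr (1 - (a + b)) * kft a b 1 (\<xi> * y)"
proof -
  have "kft a b y \<xi> = of_real y * (LBINT x. kern a b y (y * x) * cis (- (\<xi> * (y * x))))"
    unfolding kft_def using assms
    by (subst lborel_integral_real_affine[of y _ 0]) (auto simp: scaleR_conv_of_real)
  also have "\<dots> = of_real y * (of_real y powr (-(a + b)) * kft a b 1 (\<xi> * y))"
    unfolding kern_scale[OF assms] by (simp add: kft_def mult.assoc)
  finally show ?thesis using assms by (simp add: powr_diff powr_minus divide_simps powr_add)
qed

text \<open>Homogeneity moves every positive frequency to frequency one, so that only a function of
  one variable has to be studied.\<close>

lemma kft_scale':
  assumes "y > 0" "\<xi> > 0"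
  shows "kft a b y \<xi> = of_real \<xi> powr (a + b - 1) * kft a b (\<xi> * y) 1"
proof -
  have "of_real \<xi> powr (a + b - 1) * kft a b (\<xi> * y) 1 =
     of_real \<xi> powr (a + b - 1) * of_real (\<xi> * y) powr (1 - (a + b)) * kft a b 1 (\<xi> * y)"
    using assms by (subst kft_scale) auto
  also have "of_real \<xi> powr (a + b - 1) * of_real (\<xi> * y) powr (1 - (a + b)) = of_real y powr (1 - (a + b))"
    using assms by (simp add: powr_times_real_left powr_diff powr_add divide_simps)
  finally show ?thesis using kft_scale[OF assms(1), of a b \<xi>] by simp
qed

text \<open>The reflection x -> -x exchanges the two factors of the kernel; negative Fourier modes
  thus come from positive ones with the exponents swapped.\<close>

lemma kft_minus: "kft a b y (- \<xi>) = kft b a y \<xi>"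
proof -
  have "kft a b y (- \<xi>) = (LBINT x. kern a b y (- x) * cis (\<xi> * (- x)))"
    unfolding kft_def
    by (subst lborel_integral_real_affine[of "-1" _ 0]) auto
  thus ?thesis by (simp add: kern_minus kft_def)
qed

text \<open>Two integrations by parts. Quadratic decay in the frequency makes the Fourier
  coefficients in the Poisson formula summable.\<close>

lemma kft_square_decay:
  assumes "y > 0" "2 \<le> Re (a + b)"
  obtains C where "\<And>\<xi>. norm (of_real \<xi> ^ 2 * kft a b y \<xi>) \<le> C"
proof -
  have y: "0 < min 1 y" "min 1 y \<le> 1" "min 1 y \<le> y" using assms by auto
  have "2 \<le> Re ((a+2) + b)" "min 1 y \<le> y" using assms by auto
  then obtain C1 where C1: "\<And>\<xi>. norm (kft (a+2) b y \<xi>) \<le> C1"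
    using kft_bound[OF y(1,2), of "a+2" b] by metis
  have "2 \<le> Re ((a+1) + (b+1))" "min 1 y \<le> y" using assms by auto
  then obtain C2 where C2: "\<And>\<xi>. norm (kft (a+1) (b+1) y \<xi>) \<le> C2"
    using kft_bound[OF y(1,2), of "a+1" "b+1"] by metis
  have "2 \<le> Re (a + (b+2))" "min 1 y \<le> y" using assms by auto
  then obtain C3 where C3: "\<And>\<xi>. norm (kft a (b+2) y \<xi>) \<le> C3"
    using kft_bound[OF y(1,2), of "a" "b+2"] by metis
  show ?thesis
  proof (rule that)
    fix \<xi>
    have "of_real \<xi> * (of_real \<xi> * kft a b y \<xi>) =
            a * (of_real \<xi> * kft (a+1) b y \<xi>) - b * (of_real \<xi> * kft a (b+1) y \<xi>)"
      by (subst kft_by_parts) (use assms in \<open>auto simp: algebra_simps\<close>)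
    also have "\<dots> = a * (a + 1) * kft (a+2) b y \<xi> - 2 * a * b * kft (a+1) (b+1) y \<xi> + b * (b+1) * kft a (b+2) y \<xi>"
      by (subst (1 2) kft_by_parts) (use assms in \<open>auto simp: algebra_simps\<close>)
    finally have *: "of_real \<xi> ^ 2 * kft a b y \<xi> = \<dots>" by (simp add: power2_eq_square mult.assoc)
    show "norm (of_real \<xi> ^ 2 * kft a b y \<xi>) \<le> norm (a * (a+1)) * C1 + norm (2 * a * b) * C2 + norm (b * (b+1)) * C3"
      unfolding * using C1[of \<xi>] C2[of \<xi>] C3[of \<xi>]
      by (intro order_trans[OF norm_triangle_ineq] order_trans[OF norm_triangle_ineq4] add_mono)
         (auto simp del: norm_mult simp: norm_mult[of "_ * _" "kft _ _ _ _"] intro!: mult_left_mono)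
  qed
qed

section \<open>The complex Gamma integral and the base case\<close>

text \<open>The integrand of Euler's integral for Gamma(b) w^(-b), cut off by an indicator so that
  it lives on the whole line, as the product-measure arguments need.\<close>

definition gk :: "complex \<Rightarrow> complex \<Rightarrow> real \<Rightarrow> complex" where
  "gk b w s = indicator {0<..} s *\<^sub>R (of_real s powr (b - 1) * exp (- (w * of_real s)))"

lemma measurable_gk [measurable]: "gk b w \<in> borel_measurable borel"
proof -
  have "continuous_on {0<..} (\<lambda>s::real. of_real s powr (b - 1) * exp (- (w * of_real s)))"
    by (intro continuous_intros) (auto simp: complex_nonpos_Reals_iff)
  from borel_measurable_continuous_on_indicator[OF _ this] show ?thesis
    by (simp add: gk_def[abs_def])
qed

lemma norm_gk_mono: "m \<le> Re w \<Longrightarrow> norm (gk b w s) \<le> norm (gk b (of_real m) s)"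
  by (auto simp: gk_def norm_mult indicator_def intro!: mult_left_mono mult_right_mono)

lemma integrable_gk:
  assumes "Re b > 0" "Re w > 0"
  shows "integrable lborel (gk b w)"
proof -
  have "set_integrable lebesgue {0<..} (\<lambda>t. complex_of_real t powr (b - 1) / of_real (exp (Re w * t)))"
    by (rule absolutely_integrable_Gamma_integral[OF assms])
  also have "(\<lambda>t. indicator {0<..} t *\<^sub>R (complex_of_real t powr (b - 1) / of_real (exp (Re w * t)))) = gk b (of_real (Re w))"
    by (auto simp: fun_eq_iff gk_def exp_minus exp_of_real field_simps simp flip: of_real_mult)
  ultimately have "integrable lborel (gk b (of_real (Re w)))"
    unfolding set_integrable_def by (simp add: integrable_completion)
  thus ?thesis
    by (rule Bochner_Integration.integrable_bound) (auto intro!: norm_gk_mono)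
qed

text \<open>Integrate the derivative of s^b exp (-w s) over the half-line; the boundary values
  vanish because Re b and Re w are positive.\<close>

lemma gk_shift:
  assumes "Re b > 0" "Re w > 0"
  shows "w * (LBINT s. gk (b + 1) w s) = b * (LBINT s. gk b w s)"
proof -
  define f where "f = (\<lambda>s::real. b * (of_real s powr (b - 1) * exp (- (w * of_real s))) -
                       w * (of_real s powr b * exp (- (w * of_real s))))"
  have i: "integrable lborel (gk b w)" "integrable lborel (gk (b+1) w)"
    using assms by (auto intro!: integrable_gk)
  have ind: "indicator {0<..} s *\<^sub>R f s = b * gk b w s - w * gk (b + 1) w s" for s
    by (auto simp: gk_def f_def scaleR_diff_right)
  have n: "norm (of_real s powr b * exp (- (w * of_real s))) = s powr Re b * exp (- Re w * s)" if "s > 0" for s :: real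
    using that by (simp add: norm_mult norm_powr_real_powr)
  have "(LBINT s=0..\<infinity>. f s) = 0 - 0"
  proof (rule interval_integral_FTC_integrable[where F = "\<lambda>s. of_real s powr b * exp (- (w * of_real s))"])
    fix x assume "0 < ereal x" hence x: "x > 0" by simp
    have "((\<lambda>s. s powr b * exp (- (w * s))) has_field_derivative f x) (at (of_real x))"
      unfolding f_def using x by (auto intro!: derivative_eq_intros simp: complex_nonpos_Reals_iff algebra_simps)
    thus "((\<lambda>s. of_real s powr b * exp (- (w * of_real s))) has_vector_derivative f x) (at x)"
      by (rule has_vector_derivative_real_field)
    show "isCont f x" unfolding f_def using x
      by (intro continuous_intros) (auto simp: complex_nonpos_Reals_iff)
  next
    show "set_integrable lborel (einterval 0 \<infinity>) f"
      unfolding set_integrable_def einterval_eq zero_ereal_def ind using i by auto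
  next
    have "((\<lambda>s. s powr Re b * exp (- Re w * s)) \<longlongrightarrow> 0) (at_right 0)"
      using assms by real_asymp
    hence "((\<lambda>s. of_real s powr b * exp (- (w * of_real s))) \<longlongrightarrow> 0) (at_right (0::real))"
      by (rule Lim_null_comparison[rotated]) (auto simp: eventually_at_right_less n intro!: eventually_at_rightI[of 0 1])
    thus "(((\<lambda>s. of_real s powr b * exp (- (w * of_real s))) \<circ> real_of_ereal) \<longlongrightarrow> 0) (at_right 0)"
      unfolding zero_ereal_def by (simp add: ereal_tendsto_simps)
    have "((\<lambda>s. s powr Re b * exp (- Re w * s)) \<longlongrightarrow> 0) at_top"
      using assms by real_asymp
    hence "((\<lambda>s. of_real s powr b * exp (- (w * of_real s))) \<longlongrightarrow> 0) (at_top::real filter)"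
      by (rule Lim_null_comparison[rotated]) (use eventually_gt_at_top[of "0::real"] in eventually_elim, simp add: n)
    thus "(((\<lambda>s. of_real s powr b * exp (- (w * of_real s))) \<circ> real_of_ereal) \<longlongrightarrow> 0) (at_left \<infinity>)"
      by (simp add: ereal_tendsto_simps)
  qed auto
  also have "(LBINT s=0..\<infinity>. f s) = (LBINT s. b * gk b w s - w * gk (b + 1) w s)"
    unfolding zero_ereal_def interval_integral_to_infinity_eq set_lebesgue_integral_def ind ..
  also have "\<dots> = b * (LBINT s. gk b w s) - w * (LBINT s. gk (b + 1) w s)"
    using i by simp
  finally show ?thesis by simp
qed

text \<open>The case w = 1 is Euler's integral. Along the segment from 1 to \<open>w\<close>, which
  stays in the right half-plane, the b-th power of the parameter times the integral has derivative
  zero by \<open>gk_shift\<close>, so no contour has to be rotated.\<close>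

lemma integral_gk:
  assumes "Re b > 0" "Re w > 0"
  shows "(LBINT s. gk b w s) = Gamma b * w powr (- b)"
proof -
  define v where "v = (\<lambda>t::real. 1 + of_real t * (w - 1))"
  \<comment> \<open>A common lower bound for the real part along the segment; it yields a dominating
    function independent of \<open>t\<close>.\<close>
  define m where "m = min 1 (Re w)"
  have m: "m > 0" "m \<le> 1" "m \<le> Re w" using assms by (auto simp: m_def)
  have v: "m \<le> Re (v t)" if "t \<in> {0..1}" for t
  proof -
    have "Re (v t) = (1 - t) * 1 + t * Re w" by (simp add: v_def algebra_simps)
    also have "\<dots> \<ge> (1 - t) * m + t * m" using that m by (intro add_mono mult_left_mono) auto
    finally show ?thesis by (simp add: algebra_simps)
  qed
  have v0: "Re (v t) > 0" if "t \<in> {0..1}" for t using v[OF that] m by linarith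
  have dv: "(v has_vector_derivative (w - 1)) (at t within S)" for t S
    unfolding v_def by (auto intro!: derivative_eq_intros)
  have dI: "((\<lambda>t. LBINT s. gk b (v t) s) has_vector_derivative (LBINT s. - (w - 1) * gk (b + 1) (v t) s)) (at t within {0..1})"
    if t: "t \<in> {0..1}" for t
  proof (rule has_vector_derivative_integral[where g = "\<lambda>s. norm (w - 1) * norm (gk (b + 1) (of_real m) s)"])
    fix t s assume t: "t \<in> {0..1::real}"
    have "((\<lambda>v. exp (- (v * of_real s))) has_field_derivative - of_real s * exp (- (v t * of_real s))) (at (v t))"
      by (auto intro!: derivative_eq_intros)
    from field_vector_diff_chain_within[OF dv this[THEN DERIV_subset], of "{0..1}"]
    have 1: "((\<lambda>t. exp (- (v t * of_real s))) has_vector_derivative (w - 1) * (- of_real s * exp (- (v t * of_real s)))) (at t within {0..1})"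
      by (simp add: o_def)
    show "((\<lambda>t. gk b (v t) s) has_vector_derivative - (w - 1) * gk (b + 1) (v t) s) (at t within {0..1})"
    proof (cases "s > 0")
      case True
      have "of_real s powr b = of_real s * of_real s powr (b - 1)" using True by (simp add: powr_diff)
      with has_vector_derivative_mult_right[OF 1, of "of_real s powr (b - 1)"] True show ?thesis
        by (simp add: gk_def algebra_simps)
    qed (simp add: gk_def)
    show "norm (- (w - 1) * gk (b + 1) (v t) s) \<le> norm (w - 1) * norm (gk (b + 1) (of_real m) s)"
      unfolding norm_mult norm_minus_cancel by (intro mult_left_mono norm_gk_mono v t) auto
  qed (use t assms v0 m in \<open>auto intro!: integrable_gk integrable_norm\<close>)
  define H where "H = (\<lambda>t. v t powr b * (LBINT s. gk b (v t) s))"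
  have "\<exists>c. \<forall>t\<in>{0..1}. H t = c"
  proof (rule has_vector_derivative_zero_constant)
    fix t :: real assume t: "t \<in> {0..1}"
    have nz: "v t \<notin> \<real>\<^sub>\<le>\<^sub>0" using v0[OF t] by (auto simp: complex_nonpos_Reals_iff)
    hence "((\<lambda>z. z powr b) has_field_derivative b * v t powr (b - 1)) (at (v t))"
      by (auto intro!: derivative_eq_intros)
    from field_vector_diff_chain_within[OF dv this[THEN DERIV_subset], of "{0..1}"]
    have 1: "((\<lambda>t. v t powr b) has_vector_derivative (w - 1) * (b * v t powr (b - 1))) (at t within {0..1})"
      by (simp add: o_def)
    have i: "integrable lborel (gk (b+1) (v t))"
      using assms v0[OF t] by (auto intro!: integrable_gk)
    have "v t powr b = v t * v t powr (b - 1)" using nz by (auto simp: powr_diff)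
    hence e: "v t powr b * (LBINT s. gk (b + 1) (v t) s) = v t powr (b - 1) * (b * (LBINT s. gk b (v t) s))"
      unfolding gk_shift[OF assms(1) v0[OF t], symmetric] by simp
    have "(w - 1) * (b * v t powr (b - 1)) * (LBINT s. gk b (v t) s) + v t powr b * (LBINT s. - (w - 1) * gk (b + 1) (v t) s)
       = (w - 1) * (v t powr (b - 1) * (b * (LBINT s. gk b (v t) s)) - v t powr b * (LBINT s. gk (b + 1) (v t) s))"
      using i by (simp add: algebra_simps)
    also have "\<dots> = 0" unfolding e by simp
    finally show "(H has_vector_derivative 0) (at t within {0..1})"
      unfolding H_def using has_vector_derivative_mult[OF 1 dI[OF t]] by (simp add: add.commute)
  qed auto
  hence "H 0 = H 1" by auto
  moreover have "H 1 = w powr b * (LBINT s. gk b w s)" by (simp add: H_def v_def)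
  moreover have "H 0 = Gamma b"
  proof -
    have "integral\<^sup>L lborel (gk b 1) = Gamma b"
    proof (rule has_integral_unique)
      show "(gk b 1 has_integral integral\<^sup>L lborel (gk b 1)) UNIV"
        using integrable_gk[OF assms(1), of 1] by (intro has_integral_integral_lborel) auto
      have "gk b 1 = (\<lambda>t. if t \<in> {0<..} then of_real t powr (b - 1) / of_real (exp t) else 0)"
        by (auto simp: gk_def fun_eq_iff exp_minus exp_of_real field_simps)
      thus "(gk b 1 has_integral Gamma b) UNIV"
        using Gamma_integral_complex'[OF assms(1)] by (simp only: has_integral_restrict_UNIV)
    qed
    thus ?thesis by (simp add: H_def v_def)
  qed
  moreover have "w \<noteq> 0" using assms by auto
  ultimately show ?thesis by (simp add: powr_minus divide_simps mult.commute)
qed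

section \<open>Laplace representation and the case of second exponent zero\<close>

lemma measurable_cis [measurable]:
  assumes [measurable]: "f \<in> borel_measurable M"
  shows "(\<lambda>x. cis (f x)) \<in> borel_measurable M"
  unfolding cis_conv_exp by measurable

lemma integrable_kern:
  assumes "y > 0" "2 \<le> Re (a + b)"
  shows "integrable lborel (kern a b y)"
  using integrable_kern_cis[OF assms, of 0] by simp

lemma gk_Complex: "gk b (Complex y x) s = gk b (of_real y) s * cis (- (x * s))"
proof -
  have "- (Complex y x * of_real s) = - (of_real y * of_real s) + \<i> * of_real (- (x * s))"
    by (simp add: complex_eq_iff)
  hence "exp (- (Complex y x * of_real s)) = exp (- (of_real y * of_real s)) * cis (- (x * s))"
    by (simp only: exp_add cis_conv_exp)
  thus ?thesis by (simp add: gk_def)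
qed

text \<open>Replace (y + ix)^(-b) by its Gamma integral: the factor exp (-ixs) shifts the frequency
  by \<open>s\<close>. The condition on Re a makes \<open>kern a 0\<close> integrable on its own, as
  Fubini requires.\<close>

lemma kft_eq_gk_integral:
  assumes "2 \<le> Re a" "Re b > 0" "y > 0"
  shows "Gamma b * kft a b y \<xi> = (LBINT s. gk b (of_real y) s * kft a 0 y (\<xi> + s))"
proof -
  define F where "F = (\<lambda>x s. kern a 0 y x * gk b (of_real y) s * cis (- ((\<xi> + s) * x)))"
  have ik: "integrable lborel (kern a 0 y)" using assms by (intro integrable_kern) auto
  have ig: "integrable lborel (gk b (of_real y))" using assms by (intro integrable_gk) auto
  have [measurable]: "kern a 0 y \<in> borel_measurable borel" using assms by (intro measurable_kern) auto
  have nF: "norm (F x s) = norm (kern a 0 y x) * norm (gk b (of_real y) s)" for x s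
    by (simp add: F_def norm_mult)
  have iF: "integrable (lborel \<Otimes>\<^sub>M lborel) (case_prod F)"
  proof (rule lborel_pair.Fubini_integrable)
    show "case_prod F \<in> borel_measurable (lborel \<Otimes>\<^sub>M lborel)"
      unfolding F_def by measurable
    show "integrable lborel (\<lambda>x. LBINT s. norm (case_prod F (x, s)))"
      using ik by (simp add: nF)
    show "AE x in lborel. integrable lborel (\<lambda>s. case_prod F (x, s))"
    proof (rule AE_I2)
      fix x
      show "integrable lborel (\<lambda>s. case_prod F (x, s))"
      proof (rule Bochner_Integration.integrable_bound)
        show "integrable lborel (\<lambda>s. norm (kern a 0 y x) * norm (gk b (of_real y) s))"
          using ig by simp
        show "(\<lambda>s. case_prod F (x, s)) \<in> borel_measurable lborel"
          unfolding F_def by simp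
      qed (simp add: nF)
    qed
  qed
  have "Gamma b * kft a b y \<xi> = (LBINT x. Gamma b * (kern a b y x * cis (- (\<xi> * x))))"
    using integrable_kern_cis[OF assms(3), of a b \<xi>] assms by (simp add: kft_def)
  also have "\<dots> = (LBINT x. LBINT s. F x s)"
  proof (rule Bochner_Integration.integral_cong)
    fix x
    have "Complex y (-x) \<noteq> 0" "Complex y x \<noteq> 0" using assms by (auto simp: complex_eq_iff)
    hence "Gamma b * (kern a b y x * cis (- (\<xi> * x))) = kern a 0 y x * cis (- (\<xi> * x)) * (Gamma b * Complex y x powr (-b))"
      by (simp add: kern_def)
    also have "\<dots> = kern a 0 y x * cis (- (\<xi> * x)) * (LBINT s. gk b (Complex y x) s)"
      using assms by (subst integral_gk) auto
    also have "\<dots> = (LBINT s. kern a 0 y x * cis (- (\<xi> * x)) * gk b (Complex y x) s)"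
      using integrable_gk[of b "Complex y x"] assms by simp
    also have "\<dots> = (LBINT s. F x s)"
    proof -
      have "cis (- ((\<xi> + s) * x)) = cis (- (\<xi> * x)) * cis (- (x * s))" for s
        by (simp add: cis_mult algebra_simps)
      thus ?thesis unfolding F_def gk_Complex by (simp add: mult_ac)
    qed
    finally show "Gamma b * (kern a b y x * cis (- (\<xi> * x))) = (LBINT s. F x s)" .
  qed auto
  also have "\<dots> = (LBINT s. LBINT x. F x s)"
    by (rule lborel_pair.Fubini_integral[OF iF, symmetric])
  also have "\<dots> = (LBINT s. gk b (of_real y) s * kft a 0 y (\<xi> + s))"
  proof (rule Bochner_Integration.integral_cong)
    fix s
    have "F x s = gk b (of_real y) s * (kern a 0 y x * cis (- ((\<xi> + s) * x)))" for x
      by (simp add: F_def)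
    thus "(LBINT x. F x s) = gk b (of_real y) s * kft a 0 y (\<xi> + s)"
      using integrable_kern_cis[OF assms(3), of a 0] assms by (simp add: kft_def)
  qed auto
  finally show ?thesis .
qed

text \<open>For b = 0 the y-derivative and the integration by parts involve the same shifted
  transform, so at frequency one the function satisfies f' = -f.\<close>

lemma kft_snd_zero_exp:
  assumes "2 \<le> Re a" "y > 0"
  shows "kft a 0 y 1 = exp (1 - of_real y) * kft a 0 1 1"
proof -
  define H where "H = (\<lambda>y::real. exp (of_real y) * kft a 0 y 1)"
  have "\<exists>c. \<forall>y\<in>{0<..}. H y = c"
  proof (rule has_vector_derivative_zero_constant)
    fix y :: real assume y: "y \<in> {0<..}"
    have 1: "((\<lambda>y. exp (of_real y)) has_vector_derivative exp (of_real y :: complex)) (at y)"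
      by (rule has_vector_derivative_real_field) (auto intro!: derivative_eq_intros)
    have "(H has_vector_derivative 0) (at y)"
      unfolding H_def
      using has_vector_derivative_mult[OF 1 kft_has_vector_derivative[of y a 0 1]] assms y
          kft_by_parts[of y a 0 1]
      by (simp add: algebra_simps)
    thus "(H has_vector_derivative 0) (at y within {0<..})"
      by (rule has_vector_derivative_at_within)
  qed auto
  hence "H y = H 1" using assms by auto
  thus ?thesis by (simp add: H_def exp_diff field_simps)
qed

text \<open>The constant of integration of that equation, undetermined at this stage; it turns out
  to be 2 pi / Gamma(a).\<close>

definition kconst :: "complex \<Rightarrow> complex" where
  "kconst a = exp 1 * kft a 0 1 1"

lemma kft_snd_zero:
  assumes "2 \<le> Re a" "y > 0" "\<xi> > 0"
  shows "kft a 0 y \<xi> = kconst a * of_real \<xi> powr (a - 1) * exp (- of_real (\<xi> * y))"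
  using kft_scale'[OF assms(2,3), of a 0] kft_snd_zero_exp[OF assms(1), of "\<xi> * y"] assms
  by (simp add: kconst_def exp_diff exp_minus field_simps)

text \<open>At frequency zero the two exponentials exp (-ys) combine to exp (-2ys) and the powers to
  s^(a + b - 2), so the Laplace representation is itself an Euler integral.\<close>

lemma kft_zero_kconst:
  assumes "2 \<le> Re a" "Re b > 0" "y > 0"
  shows "Gamma b * kft a b y 0 = kconst a * Gamma (a + b - 1) * of_real (2 * y) powr (1 - (a + b))"
proof -
  have "Gamma b * kft a b y 0 = (LBINT s. kconst a * gk (a + b - 1) (of_real (2 * y)) s)"
    unfolding kft_eq_gk_integral[OF assms]
  proof (rule Bochner_Integration.integral_cong)
    fix s :: real
    show "gk b (of_real y) s * kft a 0 y (0 + s) = kconst a * gk (a + b - 1) (of_real (2 * y)) s"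
    proof (cases "s > 0")
      case True
      have "exp (- (of_real (2 * y) * of_real s)) = exp (- (of_real y * of_real s :: complex)) * exp (- of_real (s * y))"
        by (simp add: exp_add[symmetric] algebra_simps)
      moreover have "(of_real s :: complex) powr (a + b - 1 - 1) = of_real s powr (b - 1) * of_real s powr (a - 1)"
        by (simp add: powr_add[symmetric] algebra_simps)
      ultimately show ?thesis using True assms by (simp add: gk_def kft_snd_zero)
    qed (simp add: gk_def)
  qed auto
  also have "\<dots> = kconst a * (LBINT s. gk (a + b - 1) (of_real (2 * y)) s)"
    using integrable_gk[of "a + b - 1" "of_real (2 * y)"] assms by simp
  also have "(LBINT s. gk (a + b - 1) (of_real (2 * y)) s) = Gamma (a + b - 1) * of_real (2 * y) powr (1 - (a + b))"
    using assms by (subst integral_gk) (auto simp: algebra_simps)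
  finally show ?thesis by simp
qed

section \<open>Determination of the constant\<close>

lemma gaussian_integral:
  assumes "s > 0"
  shows "integrable lborel (\<lambda>x::real. exp (- (s * x\<^sup>2)))"
    and "(LBINT x. exp (- (s * x\<^sup>2))) = sqrt (pi / s)"
proof -
  have "has_bochner_integral lborel (\<lambda>x::real. exp (- x\<^sup>2)) (2 *\<^sub>R (sqrt pi / 2))"
    by (rule has_bochner_integral_even_function[OF gaussian_moment_0]) simp
  hence 1: "integrable lborel (\<lambda>x::real. exp (- x\<^sup>2))" "(LBINT x. exp (- x\<^sup>2)) = sqrt pi"
    by (auto simp: has_bochner_integral_iff)
  have e: "(sqrt s * x)\<^sup>2 = s * x\<^sup>2" for x using assms by (simp add: power_mult_distrib)
  show "integrable lborel (\<lambda>x::real. exp (- (s * x\<^sup>2)))"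
    using lborel_integrable_real_affine[OF 1(1), of "sqrt s" 0] assms by (simp add: e)
  show "(LBINT x. exp (- (s * x\<^sup>2))) = sqrt (pi / s)"
    using lborel_integral_real_affine[of "sqrt s" "\<lambda>x. exp (- x\<^sup>2)" 0] assms 1(2)
    by (simp add: e real_sqrt_divide field_simps)
qed

text \<open>For a = b and y = 1 the kernel is (1 + x^2)^(-a), a Gamma integral with w = 1 + x^2.
  Integrating over x first leaves a Gaussian, whose factor sqrt (pi / s) lowers the Gamma argument
  by one half.\<close>

lemma kft_diag_zero:
  assumes "2 \<le> Re a"
  shows "Gamma a * kft a a 1 0 = of_real (sqrt pi) * Gamma (a - 1/2)"
proof -
  define F where "F = (\<lambda>x s. gk a 1 s * of_real (exp (- (s * x\<^sup>2))))"
  have ig: "integrable lborel (gk a 1)" using assms by (intro integrable_gk) auto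
  have gF: "F x s = gk a (1 + of_real (x\<^sup>2)) s" for x s
    by (auto simp: F_def gk_def exp_of_real[symmetric] exp_add[symmetric] algebra_simps)
  have F0: "F x s = 0" if "s \<le> 0" for x s using that by (simp add: F_def gk_def)
  have re: "1 + x\<^sup>2 > 0" for x :: real by (simp add: add_pos_nonneg)
  have Gam: "(LBINT s. gk c (1 + of_real (x\<^sup>2)) s) = Gamma c * (1 + of_real (x\<^sup>2)) powr (- c)" if "Re c > 0" for x c
    using that re by (intro integral_gk) auto
  have iF: "integrable (lborel \<Otimes>\<^sub>M lborel) (case_prod F)"
  proof (rule lborel_pair.Fubini_integrable)
    show "case_prod F \<in> borel_measurable (lborel \<Otimes>\<^sub>M lborel)"
      unfolding F_def by measurable
    \<comment> \<open>The norm of the integrand is the same integrand with \<open>a\<close> replaced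
      by its real part, so its s-integral is again a Gamma integral.\<close>
    have "(LBINT s. norm (F x s)) = Re (Gamma (of_real (Re a)) * (1 + of_real (x\<^sup>2)) powr (- of_real (Re a)))" for x
    proof -
      have "complex_of_real (norm (F x s)) = gk (of_real (Re a)) (1 + of_real (x\<^sup>2)) s" for s
        by (cases "s > 0") (auto simp: gF gk_def norm_mult norm_powr_real_powr powr_of_real[symmetric] exp_of_real[symmetric])
      hence "complex_of_real (LBINT s. norm (F x s)) = (LBINT s. gk (of_real (Re a)) (1 + of_real (x\<^sup>2)) s)"
        by (simp flip: integral_complex_of_real)
      thus ?thesis using Gam[of "of_real (Re a)" x] assms
        by (metis Re_complex_of_real complex_of_real_def less_le_trans zero_less_numeral)
    qed
    moreover have "integrable lborel (\<lambda>x. Re (Gamma (of_real (Re a)) * (1 + of_real (x\<^sup>2)) powr (- of_real (Re a))))"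
    proof (rule Bochner_Integration.integrable_bound[OF integrable_inv_1_plus_sq[of "norm (Gamma (of_real (Re a) :: complex))"]])
      show "AE x in lborel. norm (Re (Gamma (of_real (Re a)) * (1 + of_real (x\<^sup>2)) powr (- of_real (Re a))))
           \<le> norm (norm (Gamma (of_real (Re a) :: complex)) / (1 + x\<^sup>2))"
      proof (rule AE_I2)
        fix x :: real
        have "norm (Re (Gamma (of_real (Re a)) * (1 + of_real (x\<^sup>2)) powr (- of_real (Re a)))) \<le>
            norm (Gamma (of_real (Re a) :: complex)) * norm ((1 + of_real (x\<^sup>2)) powr (- of_real (Re a)) :: complex)"
          using abs_Re_le_cmod[of "Gamma (of_real (Re a)) * (1 + of_real (x\<^sup>2)) powr (- of_real (Re a))"] by (simp add: norm_mult)
        also have "norm ((1 + of_real (x\<^sup>2)) powr (- of_real (Re a)) :: complex) = (1 + x\<^sup>2) powr (- Re a)"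
          using re[of x] norm_powr_real_powr[of "1 + of_real (x\<^sup>2)" "- of_real (Re a)"] by simp
        also have "\<dots> \<le> (1 + x\<^sup>2) powr (- 1)" using assms by (intro powr_mono) auto
        also have "\<dots> = 1 / (1 + x\<^sup>2)" using re[of x] by (simp add: powr_minus divide_simps)
        finally show "norm (Re (Gamma (of_real (Re a)) * (1 + of_real (x\<^sup>2)) powr (- of_real (Re a))))
           \<le> norm (norm (Gamma (of_real (Re a) :: complex)) / (1 + x\<^sup>2))"
          using re[of x] by (simp add: mult_left_mono)
      qed
      have "continuous_on UNIV (\<lambda>x::real. (1 + of_real (x\<^sup>2) :: complex) powr (- of_real (Re a)))"
      proof -
        have "1 + complex_of_real (x\<^sup>2) \<noteq> 0" for x
          using re[of x] by (metis of_real_1 of_real_add of_real_eq_0_iff less_irrefl)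
        thus ?thesis
          using re by (intro continuous_intros) (auto simp: complex_nonpos_Reals_iff not_le simp flip: of_real_power)
      qed
      from borel_measurable_continuous_onI[OF this]
      show "(\<lambda>x. Re (Gamma (of_real (Re a)) * (1 + of_real (x\<^sup>2)) powr (- of_real (Re a)))) \<in> borel_measurable lborel"
        by simp
    qed
    ultimately show "integrable lborel (\<lambda>x. LBINT s. norm (case_prod F (x, s)))" by simp
    show "AE x in lborel. integrable lborel (\<lambda>s. case_prod F (x, s))"
      using assms re by (intro AE_I2) (auto simp: gF intro!: integrable_gk)
  qed
  have "Gamma a * kft a a 1 0 = (LBINT x. Gamma a * kern a a 1 x)"
    using integrable_kern[of 1 a a] assms by (simp add: kft_def)
  also have "\<dots> = (LBINT x. LBINT s. F x s)"
  proof (rule Bochner_Integration.integral_cong)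
    fix x
    have "kern a a 1 x = (1 + of_real (x\<^sup>2)) powr (- a)"
    proof -
      \<comment> \<open>The two bases are conjugate, so the imaginary parts of their logarithms
        cancel and the product of the principal powers is the principal power of 1 + x^2.\<close>
      have *: "Ln (Complex 1 (-x)) + Ln (Complex 1 x) = Ln (1 + of_real (x\<^sup>2))"
      proof -
        have "Complex 1 (-x) = cnj (Complex 1 x)" by (simp add: complex_eq_iff)
        hence "Ln (Complex 1 (-x)) = cnj (Ln (Complex 1 x))"
          by (simp only: ) (rule cnj_Ln[symmetric], auto simp: complex_nonpos_Reals_iff)
        hence "Ln (Complex 1 (-x)) + Ln (Complex 1 x) = of_real (2 * ln (norm (Complex 1 x)))"
          by (simp add: complex_add_cnj add.commute Re_Ln complex_eq_iff)
        also have "2 * ln (norm (Complex 1 x)) = ln (1 + x\<^sup>2)"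
          using re[of x] by (simp add: cmod_def ln_sqrt)
        also have "of_real (ln (1 + x\<^sup>2)) = Ln (1 + of_real (x\<^sup>2))"
          using Ln_of_real[OF re[of x]] by simp
        finally show ?thesis .
      qed
      have "Complex 1 (-x) \<noteq> 0" "Complex 1 x \<noteq> 0" "1 + of_real (x\<^sup>2) \<noteq> (0::complex)"
        using re[of x] by (auto simp: complex_eq_iff simp flip: of_real_power)
      thus ?thesis by (simp add: kern_def powr_def exp_add[symmetric] *[symmetric] algebra_simps del: of_real_power)
    qed
    thus "Gamma a * kern a a 1 x = (LBINT s. F x s)"
      unfolding gF using Gam[of a x] assms by simp
  qed auto
  also have "\<dots> = (LBINT s. LBINT x. F x s)"
    by (rule lborel_pair.Fubini_integral[OF iF, symmetric])
  also have "\<dots> = (LBINT s. of_real (sqrt pi) * gk (a - 1/2) 1 s)"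
  proof (rule Bochner_Integration.integral_cong)
    fix s :: real
    show "(LBINT x. F x s) = of_real (sqrt pi) * gk (a - 1/2) 1 s"
    proof (cases "s > 0")
      case True
      have "(LBINT x. F x s) = gk a 1 s * of_real (sqrt pi / sqrt s)"
        unfolding F_def using gaussian_integral[OF True] integrable_of_real[OF gaussian_integral(1)[OF True], where 'a=complex]
        by (simp add: integral_complex_of_real real_sqrt_divide)
      also have "complex_of_real (sqrt s) = of_real s powr (1/2)"
        using True powr_of_real[of s "1/2"] by (simp add: powr_half_sqrt)
      then have "gk a 1 s * of_real (sqrt pi / sqrt s) = of_real (sqrt pi) * gk (a - 1/2) 1 s"
      proof -
        assume sq: "complex_of_real (sqrt s) = of_real s powr (1/2)"
        have "1 / 2 + (a - 1 / 2 - 1) = a - 1" by simp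
        hence "of_real s powr (a - 1) = complex_of_real s powr (1/2) * of_real s powr (a - 1/2 - 1)"
          by (metis powr_add)
        hence "of_real s powr (a - 1) = complex_of_real (sqrt s) * of_real s powr (a - 1/2 - 1)"
          by (simp only: sq)
        thus ?thesis using True by (simp add: gk_def)
      qed
      finally show ?thesis .
    qed (simp add: F0 gk_def)
  qed auto
  also have "\<dots> = of_real (sqrt pi) * Gamma (a - 1/2)"
    using assms integrable_gk[of "a - 1/2" 1] by (simp add: integral_gk)
  finally show ?thesis .
qed

lemma not_nonpos_Ints_if_Re_pos: "Re z > 0 \<Longrightarrow> z \<notin> \<int>\<^sub>\<le>\<^sub>0"
  by (auto elim!: nonpos_Ints_cases)

text \<open>The constant is read off from the case \<open>a = b\<close>, \<open>\<xi> = 0\<close>, where the transform is also a Gaussian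
  integral; the two values are compared by the duplication formula.\<close>
lemma kconst_eq:
  fixes a :: complex
  assumes "2 \<le> Re a"
  shows "kconst a = 2 * of_real pi * rGamma a"
proof -
  have nz: "Gamma a \<noteq> 0" "Gamma (2*a - 1) \<noteq> 0"
    using assms by (simp_all add: Gamma_eq_zero_iff not_nonpos_Ints_if_Re_pos)
  have *: "kconst a * Gamma (2 * a - 1) * 2 powr (1 - 2 * a) = of_real (sqrt pi) * Gamma (a - 1/2)"
    using kft_zero_kconst[of a a 1] kft_diag_zero[of a] assms by simp
  have "Gamma (a - 1/2) * Gamma a = 2 powr (2 - 2 * a) * of_real (sqrt pi) * Gamma (2 * a - 1)"
    using Gamma_legendre_duplication[of "a - 1/2"] assms
      Ln_of_real[of 2]
    by (simp add: not_nonpos_Ints_if_Re_pos powr_def algebra_simps)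
  also have "2 powr (2 - 2 * a) = 2 * (2 powr (1 - 2 * a) :: complex)"
    by (simp add: powr_diff)
  finally have **: "Gamma (a - 1/2) * Gamma a = 2 * 2 powr (1 - 2 * a) * of_real (sqrt pi) * Gamma (2 * a - 1)" .
  have "(kconst a * Gamma a) * (Gamma (2 * a - 1) * 2 powr (1 - 2 * a)) =
          (kconst a * Gamma (2 * a - 1) * 2 powr (1 - 2 * a)) * Gamma a" by (simp only: mult_ac)
  also have "\<dots> = of_real (sqrt pi) * (Gamma (a - 1/2) * Gamma a)" unfolding * by (simp only: mult_ac)
  also have "\<dots> = (2 * (of_real (sqrt pi) * of_real (sqrt pi))) * (Gamma (2 * a - 1) * 2 powr (1 - 2 * a))"
    unfolding ** by (simp only: mult_ac)
  finally have "(kconst a * Gamma a) * (Gamma (2 * a - 1) * 2 powr (1 - 2 * a)) = \<dots>" .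
  hence "kconst a * Gamma a = 2 * of_real pi"
    using nz by (simp flip: of_real_mult)
  thus ?thesis using nz by (simp add: rGamma_inverse_Gamma field_simps)
qed

section \<open>Recursion in the first exponent and the transform at frequency zero\<close>

text \<open>The integration by parts eliminates the transform with \<open>b\<close> raised, leaving
  a first-order relation in which only \<open>a\<close> moves.\<close>

lemma kft_deriv_raise_fst:
  assumes "y > 0" "2 \<le> Re (a + b)"
  shows "((\<lambda>y. kft a b y \<xi>) has_vector_derivative
           (of_real \<xi> * kft a b y \<xi> - 2 * a * kft (a+1) b y \<xi>)) (at y)"
proof -
  have "of_real \<xi> * kft a b y \<xi> - 2 * a * kft (a+1) b y \<xi> = - a * kft (a+1) b y \<xi> - b * kft a (b+1) y \<xi>"
    unfolding kft_by_parts[OF assms] by simp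
  thus ?thesis using kft_has_vector_derivative[OF assms, of \<xi>] by (simp only:)
qed

text \<open>Descent by unit steps from the half-plane Re z \<ge> c. \<open>Q\<close> carries a
  convergence condition; in the step the claim at z + 1 is available as soon as the condition holds
  there.\<close>

lemma complex_shift_induct [consumes 1, case_names base step]:
  assumes "Q z"
    and base: "\<And>z. Q z \<Longrightarrow> Re z \<ge> c \<Longrightarrow> P z"
    and step: "\<And>z. Q z \<Longrightarrow> Re z < c \<Longrightarrow> (Q (z + 1) \<Longrightarrow> P (z + 1)) \<Longrightarrow> P z"
  shows "P z"
proof -
  define n where "n = nat \<lceil>c - Re z\<rceil>"
  have "Re z + n \<ge> c" unfolding n_def by linarith
  thus ?thesis using assms(1)
  proof (induction n arbitrary: z)
    case 0 thus ?case using base by simp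
  next
    case (Suc n)
    show ?case
    proof (cases "Re z \<ge> c")
      case False
      show ?thesis by (rule step) (use False Suc in auto)
    qed (use base Suc in auto)
  qed
qed

lemma rGamma_step: "rGamma z = z * rGamma (z + 1)" for z :: complex
  by (rule rGamma_plus1[symmetric])

text \<open>The y-derivative is computed twice: from homogeneity, where frequency zero leaves a pure
  power of y with exponent 1 - (a + b), and from \<open>kft_deriv_raise_fst\<close>.\<close>

lemma kft_zero_deriv:
  assumes "y > 0" "2 < Re (a + b)"
  shows "(a + b - 1) * kft a b y 0 = 2 * a * of_real y * kft (a+1) b y 0"
proof -
  have "((\<lambda>y. of_real y powr (1 - (a + b)) * kft a b 1 0) has_vector_derivative
     (1 - (a + b)) * of_real y powr (- (a + b)) * kft a b 1 0) (at y)"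
  proof (rule has_vector_derivative_mult_left)
    have "((\<lambda>y. y powr (1 - (a + b))) has_field_derivative (1 - (a + b)) * of_real y powr (- (a + b))) (at (of_real y))"
      using assms by (auto intro!: derivative_eq_intros simp: complex_nonpos_Reals_iff)
    thus "((\<lambda>y. of_real y powr (1 - (a + b))) has_vector_derivative (1 - (a + b)) * of_real y powr (- (a + b))) (at y)"
      by (rule has_vector_derivative_real_field)
  qed
  hence "((\<lambda>y. kft a b y 0) has_vector_derivative
     (1 - (a + b)) * of_real y powr (- (a + b)) * kft a b 1 0) (at y)"
  proof (rule has_vector_derivative_transform_within_open[where S = "{0<..}"])
    fix t :: real assume "t \<in> {0<..}"
    thus "of_real t powr (1 - (a + b)) * kft a b 1 0 = kft a b t 0"
      by (subst (2) kft_scale) auto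
  qed (use assms in auto)
  moreover have "((\<lambda>y. kft a b y 0) has_vector_derivative - 2 * a * kft (a+1) b y 0) (at y)"
    using kft_deriv_raise_fst[of y a b 0] assms by simp
  ultimately have "- 2 * a * kft (a+1) b y 0 = (1 - (a + b)) * of_real y powr (- (a + b)) * kft a b 1 0"
    using vector_derivative_unique_at by blast
  moreover have "of_real y * (of_real y powr (- (a + b)) * kft a b 1 0) = kft a b y 0"
    using kft_scale[of y a b 0] assms by (simp add: powr_diff powr_minus powr_add divide_simps)
  moreover have "of_real y * ((1 - (a + b)) * of_real y powr (- (a + b)) * kft a b 1 0) =
      (1 - (a + b)) * (of_real y * (of_real y powr (- (a + b)) * kft a b 1 0))" by (simp only: mult_ac)
  ultimately have "of_real y * (- 2 * a * kft (a+1) b y 0) = (1 - (a + b)) * kft a b y 0"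
    by (simp only:)
  thus ?thesis by (simp add: algebra_simps)
qed

text \<open>Descent in \<open>a\<close> from Re a \<ge> 2, where the constant is known. The
  recursions of Gamma(q - 1) and of \<open>rGamma a\<close> absorb exactly the factors q - 1 and a
  of \<open>kft_zero_deriv\<close>.\<close>

lemma kft_zero_if_Re_snd_pos:
  assumes "2 < Re (a + b)" "Re b > 0" "y > 0"
  shows "kft a b y 0 = 2 * of_real pi * of_real (2 * y) powr (1 - (a + b)) * Gamma (a + b - 1) * rGamma a * rGamma b"
proof -
  have "2 < Re (a + b)" using assms by simp
  thus ?thesis
  proof (induction a rule: complex_shift_induct[where c = 2])
    case (base a)
    have "Gamma b \<noteq> 0" using assms by (simp add: Gamma_eq_zero_iff not_nonpos_Ints_if_Re_pos)
    thus ?case using kft_zero_kconst[of a b y] base assms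
      by (simp add: kconst_eq rGamma_inverse_Gamma[of b] field_simps)
  next
    case (step a)
    define q where "q = a + b"
    have q: "q - 1 \<noteq> 0" "q \<noteq> 0" using step(1) by (auto simp: q_def complex_eq_iff)
    have IH: "kft (a+1) b y 0 = 2 * of_real pi * of_real (2 * y) powr (- q) * Gamma q * rGamma (a + 1) * rGamma b"
      using step by (simp add: q_def algebra_simps)
    have G: "Gamma q = (q - 1) * Gamma (q - 1)"
      using Gamma_plus1[of "q - 1"] step(1) by (simp add: not_nonpos_Ints_if_Re_pos q_def)
    have P: "of_real (2 * y) powr (1 - q) = of_real (2 * y) * of_real (2 * y) powr (- q)"
      using assms by (simp add: powr_diff powr_minus divide_simps)
    have "(q - 1) * kft a b y 0 = 2 * a * of_real y * kft (a+1) b y 0"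
      using kft_zero_deriv[of y a b] assms step by (simp add: q_def)
    also have "\<dots> = (q - 1) * (2 * of_real pi * of_real (2 * y) powr (1 - q) * Gamma (q - 1) * rGamma a * rGamma b)"
      unfolding IH G P rGamma_step[of a] by simp
    finally show ?case using q by (simp add: q_def)
  qed
qed

text \<open>If Re b \<le> 0 then Re a > 2, and at frequency zero the reflection swaps the exponents
  without changing the frequency.\<close>

lemma kft_zero:
  assumes "2 < Re (a + b)" "y > 0"
  shows "kft a b y 0 = 2 * of_real pi * of_real (2 * y) powr (1 - (a + b)) * Gamma (a + b - 1) * rGamma a * rGamma b"
proof (cases "Re b > 0")
  case False
  have "kft a b y 0 = kft b a y 0" using kft_minus[of a b y 0] by simp
  also have "\<dots> = 2 * of_real pi * of_real (2 * y) powr (1 - (b + a)) * Gamma (b + a - 1) * rGamma b * rGamma a"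
    using assms False by (intro kft_zero_if_Re_snd_pos) (auto simp: add.commute)
  finally show ?thesis by (simp add: add_ac mult_ac)
qed (use assms kft_zero_if_Re_snd_pos in auto)

section \<open>Asymptotics in the range of the Laplace representation\<close>

lemma power_le_fact_exp:
  fixes x :: real
  assumes "x \<ge> 0"
  shows "x ^ n \<le> fact n * exp x"
proof -
  have "x ^ n /\<^sub>R fact n \<le> exp x"
    unfolding exp_def using assms
    by (intro sum_le_suminf[OF summable_exp_generic, of "{n}", simplified]) auto
  thus ?thesis by (simp add: field_simps)
qed

lemma powr_of_real_inverse:
  assumes "y > 0"
  shows "complex_of_real (1 / y) powr c = of_real y powr (- c)"
proof -
  have "Ln (complex_of_real (1 / y)) = - Ln (of_real y)"
    using assms Ln_of_real[of "1 / y"] Ln_of_real[of y] by (simp add: ln_div)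
  thus ?thesis using assms by (simp add: powr_def)
qed

text \<open>Scale the Laplace variable as s = u / y. One factor exp (-u) comes from the Gamma
  integrand and another from \<open>kft a 0\<close> at frequency 1 + u / y, so the limit integral is
  Gamma(b) 2^(-b); the remaining factor (1 + u / y)^(a - 1) tends to 1.\<close>

lemma kft_asymp_base:
  assumes "2 \<le> Re a" "Re b > 0"
  shows "((\<lambda>y. of_real y powr b * exp (of_real y) * kft a b y 1) \<longlongrightarrow> 2 * of_real pi * 2 powr (- b) * rGamma a) at_top"
proof -
  have nz: "Gamma b \<noteq> 0" using assms by (simp add: Gamma_eq_zero_iff not_nonpos_Ints_if_Re_pos)
  obtain n :: nat where n: "Re a - 1 \<le> n" using real_arch_simple by blast
  \<comment> \<open>The maximum and the absolute value keep the base at least 1 for all real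
    arguments, which makes F measurable on the whole line; for positive u and y they change
    nothing.\<close>
  define F where "F = (\<lambda>(y::real) (u::real). gk b 2 u * of_real (1 + max 0 u / \<bar>y\<bar>) powr (a - 1))"
  have eq: "of_real y powr b * exp (of_real y) * kft a b y 1 = kconst a / Gamma b * (LBINT u. F y u)" if y: "y > 0" for y
  proof -
    have "Gamma b * kft a b y 1 = (LBINT s. gk b (of_real y) s * kft a 0 y (1 + s))"
      by (rule kft_eq_gk_integral[OF assms y])
    also have "\<dots> = of_real (1/y) * (LBINT u. gk b (of_real y) (1/y * u) * kft a 0 y (1 + 1/y * u))"
      using y by (subst lborel_integral_real_affine[of "1/y" _ 0]) (auto simp: scaleR_conv_of_real)
    also have "(LBINT u. gk b (of_real y) (1/y * u) * kft a 0 y (1 + 1/y * u)) =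
        (LBINT u. kconst a * of_real y powr (1 - b) * exp (- of_real y) * F y u)"
    proof (rule Bochner_Integration.integral_cong)
      fix u :: real
      show "gk b (of_real y) (1/y * u) * kft a 0 y (1 + 1/y * u) =
          kconst a * of_real y powr (1 - b) * exp (- of_real y) * F y u"
      proof (cases "u > 0")
        case True
        have 1: "kft a 0 y (1 + 1/y * u) = kconst a * of_real (1 + u / y) powr (a - 1) * exp (- of_real (y + u))"
        proof -
          have "(1 + 1/y * u) * y = y + u" "1 + 1/y * u > 0" using y True by (auto simp: field_simps add_pos_pos)
          thus ?thesis using kft_snd_zero[OF assms(1) y, of "1 + 1/y * u"] by simp
        qed
        have "of_real (u / y) = of_real (1 / y) * complex_of_real u" by simp
        hence "of_real (u / y) powr (b - 1) = of_real (1 / y) powr (b - 1) * complex_of_real u powr (b - 1)"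
          using y by (simp only:) (rule powr_times_real_left, auto)
        hence 2: "of_real (u / y) powr (b - 1) = of_real y powr (1 - b) * complex_of_real u powr (b - 1)"
          unfolding powr_of_real_inverse[OF y] by simp
        have 3: "exp (- of_real (y + u)) * exp (- (of_real u :: complex)) = exp (- of_real y) * exp (- (2 * of_real u))"
          unfolding exp_add[symmetric] by (rule arg_cong[where f = exp]) simp
        have "gk b (of_real y) (1/y * u) * kft a 0 y (1 + 1/y * u) =
           of_real (u / y) powr (b - 1) * kconst a * of_real (1 + u / y) powr (a - 1) * (exp (- of_real (y + u)) * exp (- of_real u))"
          unfolding 1 using True y by (simp add: gk_def)
        also have "\<dots> = kconst a * of_real y powr (1 - b) * exp (- of_real y) * F y u"
          unfolding 2 3 F_def gk_def using True y by simp
        finally show ?thesis .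
      qed (use y in \<open>auto simp: gk_def F_def zero_less_mult_iff zero_less_divide_iff\<close>)
    qed auto
    also have "\<dots> = kconst a * of_real y powr (1 - b) * exp (- of_real y) * (LBINT u. F y u)"
      by simp
    finally have G: "Gamma b * kft a b y 1 = of_real (1 / y) * (kconst a * of_real y powr (1 - b) * exp (- of_real y) * (LBINT u. F y u))" .
    have "of_real y powr b * of_real y powr (1 - b) = of_real y"
      using y by (simp add: powr_add[symmetric])
    have "exp (of_real y) * exp (- of_real y) = (1 :: complex)"
      by (simp add: exp_minus)
    have "Gamma b * (of_real y powr b * exp (of_real y) * kft a b y 1) =
       of_real y powr b * exp (of_real y) * (Gamma b * kft a b y 1)"
      by (simp only: mult_ac)
    also have "\<dots> = (of_real y powr b * of_real y powr (1 - b)) * (exp (of_real y) * exp (- of_real y)) * of_real (1 / y) * (kconst a * (LBINT u. F y u))"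
      unfolding G by (simp only: mult_ac)
    also have "\<dots> = kconst a * (LBINT u. F y u)"
      unfolding \<open>of_real y powr b * of_real y powr (1 - b) = of_real y\<close> \<open>exp (of_real y) * exp (- of_real y) = (1 :: complex)\<close>
      using y by simp
    finally show ?thesis using nz by (simp add: field_simps)
  qed
  \<comment> \<open>Of the two factors exp (-u), one pays for the growth (1 + u)^n and the other
    keeps the majorant integrable.\<close>
  have bound: "norm (F y u) \<le> fact n * exp 1 * norm (gk b 1 u)" if "y \<ge> 1" for y u
  proof (cases "u > 0")
    case True
    have "norm (of_real (1 + max 0 u / \<bar>y\<bar>) powr (a - 1)) = (1 + u / y) powr (Re a - 1)"
      using True that by (subst norm_powr_real_powr) auto
    also have "\<dots> \<le> (1 + u) powr (Re a - 1)"
      using True that assms frac_le[of u u 1 y] by (intro powr_mono2) auto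
    also have "\<dots> \<le> (1 + u) powr n" using True n by (intro powr_mono) auto
    also have "\<dots> = (1 + u) ^ n" using True by (simp add: powr_realpow)
    also have "\<dots> \<le> fact n * exp (1 + u)" using True by (intro power_le_fact_exp) auto
    finally have "norm (F y u) \<le> norm (gk b 2 u) * (fact n * exp (1 + u))"
      unfolding F_def norm_mult by (intro mult_left_mono) auto
    moreover have "norm (gk b 2 u) * exp (1 + u) = exp 1 * norm (gk b 1 u)"
    proof -
      have "exp (- (2 * u)) * exp (1 + u) = exp 1 * exp (- u)" by (simp add: exp_add[symmetric])
      thus ?thesis using True by (simp add: gk_def norm_mult)
    qed
    hence "norm (gk b 2 u) * (fact n * exp (1 + u)) = fact n * exp 1 * norm (gk b 1 u)"
      by (simp only: mult_ac)
    ultimately show ?thesis by linarith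
  qed (simp add: F_def gk_def)
  have "((\<lambda>y. LBINT u. F y u) \<longlongrightarrow> (LBINT u. gk b 2 u)) at_top"
  proof (rule integral_dominated_convergence_at_top[where w = "\<lambda>u. fact n * exp 1 * norm (gk b 1 u)"])
    show "\<forall>\<^sub>F y in at_top. AE u in lborel. norm (F y u) \<le> fact n * exp 1 * norm (gk b 1 u)"
      using eventually_ge_at_top[of "1::real"] by eventually_elim (use bound in auto)
    show "AE u in lborel. ((\<lambda>y. F y u) \<longlongrightarrow> gk b 2 u) at_top"
    proof (rule AE_I2)
      fix u :: real
      have "((\<lambda>y. 1 + max 0 u / \<bar>y\<bar>) \<longlongrightarrow> 1 + 0) at_top"
        by (intro tendsto_intros tendsto_divide_0[OF tendsto_const] filterlim_at_top_imp_at_infinity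
              filterlim_compose[OF filterlim_abs_real] filterlim_ident)
      hence "((\<lambda>y. complex_of_real (1 + max 0 u / \<bar>y\<bar>)) \<longlongrightarrow> of_real 1) at_top"
        by (intro tendsto_of_real) simp
      hence "((\<lambda>y. complex_of_real (1 + max 0 u / \<bar>y\<bar>) powr (a - 1)) \<longlongrightarrow> of_real 1 powr (a - 1)) at_top"
        by (intro tendsto_powr_complex tendsto_const) auto
      hence "((\<lambda>y. gk b 2 u * complex_of_real (1 + max 0 u / \<bar>y\<bar>) powr (a - 1)) \<longlongrightarrow> gk b 2 u * (of_real 1 powr (a - 1))) at_top"
        by (rule tendsto_mult[OF tendsto_const])
      thus "((\<lambda>y. F y u) \<longlongrightarrow> gk b 2 u) at_top" by (simp add: F_def)
    qed
    show "(\<lambda>u. F y u) \<in> borel_measurable lborel" for y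
    proof -
      have [measurable]: "(\<lambda>t::real. of_real (1 + max 0 t / \<bar>y\<bar>) powr (a - 1) :: complex) \<in> borel_measurable borel"
      proof -
        have pos: "1 + max 0 t * inverse \<bar>y\<bar> > 0" for t :: real by (intro add_pos_nonneg) auto
        have "continuous_on UNIV (\<lambda>t::real. of_real (1 + max 0 t * inverse \<bar>y\<bar>) powr (a - 1) :: complex)"
          by (intro continuous_intros subsetI CollectI disjI1)
             (metis Re_complex_of_real less_imp_le of_real_eq_0_iff less_irrefl pos)+
        from borel_measurable_continuous_onI[OF this] show ?thesis by (simp add: divide_inverse)
      qed
      show ?thesis unfolding F_def by measurable
    qed
  qed (use assms integrable_gk[of b 1] in auto)
  hence "((\<lambda>y. kconst a / Gamma b * (LBINT u. F y u)) \<longlongrightarrow> kconst a / Gamma b * (LBINT u. gk b 2 u)) at_top"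
    by (intro tendsto_intros)
  also have "kconst a / Gamma b * (LBINT u. gk b 2 u) = 2 * of_real pi * 2 powr (- b) * rGamma a"
    using assms nz by (simp add: integral_gk kconst_eq)
  finally show ?thesis
    by (rule Lim_transform_eventually) (use eventually_gt_at_top[of "0::real"] in eventually_elim, simp add: eq)
qed

section \<open>Asymptotics at infinity\<close>

text \<open>Compare with h(s) = \<epsilon> exp (-2s) s^(-r). Since -h' = h (2 + r / s) \<ge> h, no
  later value of f is farther than h(y) from f(y), and f tends to zero.\<close>

lemma norm_le_of_derivative_bound:
  fixes f f' :: "real \<Rightarrow> complex"
  assumes der: "\<And>s. s \<ge> Y \<Longrightarrow> (f has_vector_derivative f' s) (at s)"
    and bnd: "\<And>s. s \<ge> Y \<Longrightarrow> norm (f' s) \<le> \<epsilon> * (exp (- 2 * s) * s powr (- r))"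
    and lim: "(f \<longlongrightarrow> 0) at_top" and "r > 0" "Y > 0" "\<epsilon> > 0" "y \<ge> Y"
  shows "norm (f y) \<le> \<epsilon> * (exp (- 2 * y) * y powr (- r))"
proof -
  define h where "h = (\<lambda>s. \<epsilon> * (exp (- 2 * s) * s powr (- r)))"
  have h0: "h s \<ge> 0" for s using assms by (simp add: h_def)
  have "norm (f z - f y) \<le> h y" if z: "z > y" for z
  proof -
    have "norm (f z - f y) \<le> (- h z) - (- h y)"
    proof (rule differentiable_bound_general[where \<phi>' = "\<lambda>s. h s * (2 + r / s)" and f' = f'])
      show "continuous_on {y..z} f"
      proof (intro continuous_at_imp_continuous_on ballI)
        fix x assume "x \<in> {y..z}"
        hence "x \<ge> Y" using \<open>y \<ge> Y\<close> by simp
        from has_vector_derivative_continuous[OF der[OF this]] show "isCont f x" .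
      qed
      show "continuous_on {y..z} (\<lambda>s. - h s)" unfolding h_def using assms
        by (intro continuous_intros) auto
    next
      fix s assume s: "y < s" "s < z"
      hence s0: "s > 0" "s \<ge> Y" using assms by auto
      show "((\<lambda>s. - h s) has_vector_derivative h s * (2 + r / s)) (at s)"
        unfolding has_real_derivative_iff_has_vector_derivative[symmetric] h_def using s0
        by (auto intro!: derivative_eq_intros simp: field_simps powr_mult_base)
      show "(f has_vector_derivative f' s) (at s)" using der s0 by auto
      have "norm (f' s) \<le> h s * 1" using bnd[OF s0(2)] by (simp add: h_def)
      also have "\<dots> \<le> h s * (2 + r / s)" using s0 assms h0 by (intro mult_left_mono) auto
      finally show "norm (f' s) \<le> h s * (2 + r / s)" .
    qed (use z in auto)
    also have "\<dots> \<le> h y" using h0[of z] by simp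
    finally show ?thesis .
  qed
  hence 1: "eventually (\<lambda>z. norm (f z - f y) \<le> h y) at_top"
    by (rule eventually_mono[OF eventually_gt_at_top[of y]])
  have 2: "((\<lambda>z. norm (f z - f y)) \<longlongrightarrow> norm (0 - f y)) at_top"
    by (intro tendsto_intros lim)
  have "norm (0 - f y) \<le> h y"
    by (rule tendsto_upperbound[OF 2 1]) auto
  thus ?thesis by (simp add: h_def)
qed

lemma divide_of_real_tendsto_0: "((\<lambda>s. c / complex_of_real s) \<longlongrightarrow> 0) at_top"
proof (rule Lim_null_comparison)
  show "\<forall>\<^sub>F s in at_top. norm (c / complex_of_real s) \<le> norm c / s"
    using eventually_gt_at_top[of "0::real"] by eventually_elim (simp add: norm_divide)
qed real_asymp

text \<open>The transform behaves like a multiple of exp (-y) y^(-b). It is stated as a limit of a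
  product because the constant is zero when \<open>a\<close> is a nonpositive integer.\<close>

definition kasymp :: "complex \<Rightarrow> complex \<Rightarrow> bool" where
  "kasymp a b \<longleftrightarrow> ((\<lambda>y. of_real y powr b * exp (of_real y) * kft a b y 1) \<longlongrightarrow>
      2 * of_real pi * 2 powr (- b) * rGamma a) at_top"

text \<open>The integrating factor exp (-y) removes the undifferentiated term of
  \<open>kft_deriv_raise_fst\<close> at frequency one.\<close>

definition kdecay :: "complex \<Rightarrow> complex \<Rightarrow> real \<Rightarrow> complex" where
  "kdecay a b y = exp (- of_real y) * kft a b y 1"

lemma kdecay_deriv:
  assumes "y > 0" "2 < Re (a + b)"
  shows "(kdecay a b has_vector_derivative (- 2 * a * kdecay (a + 1) b y)) (at y)"
proof -
  have 1: "((\<lambda>y. exp (- of_real y)) has_vector_derivative - exp (- of_real y :: complex)) (at y)"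
    by (rule has_vector_derivative_real_field) (auto intro!: derivative_eq_intros)
  have "2 \<le> Re (a + b)" using assms by simp
  from has_vector_derivative_mult[OF 1 kft_deriv_raise_fst[OF assms(1) this, of 1]]
  show ?thesis unfolding kdecay_def[abs_def] by (simp add: algebra_simps)
qed

lemma kdecay_tendsto:
  assumes "2 < Re (a + b)"
  shows "(kdecay a b \<longlongrightarrow> 0) at_top"
proof -
  obtain C where C: "\<And>y \<xi>. 1 \<le> y \<Longrightarrow> norm (kft a b y \<xi>) \<le> C"
    using kft_bound[of 1 a b] assms by (metis less_eq_real_def zero_less_one)
  have "((\<lambda>y. exp (- y) * C) \<longlongrightarrow> 0) at_top" by real_asymp
  thus ?thesis
    by (rule Lim_null_comparison[rotated])
       (use eventually_ge_at_top[of "1::real"] in \<open>eventually_elim, use C in \<open>auto simp: kdecay_def norm_mult intro!: mult_left_mono\<close>\<close>)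
qed

text \<open>The derivative of \<open>kdecay\<close> carries the factor a. It is zero for a = 0, and
  for a = -(n + 1) it is a multiple of the case a = -n; so \<open>kdecay\<close> is constant, and it
  tends to zero. This settles the poles of Gamma(a), where the transform cannot be normalised to
  W.\<close>

lemma kft_vanish:
  assumes "y > 0" "2 < Re (- of_nat n + b)"
  shows "kft (- of_nat n) b y 1 = 0"
  using assms
proof (induction n arbitrary: y)
  case (Suc n)
  have "\<exists>c. \<forall>y\<in>{0<..}. kdecay (- of_nat (Suc n)) b y = c"
  proof (rule has_vector_derivative_zero_constant)
    fix y :: real assume y: "y \<in> {0<..}"
    have "kdecay (- of_nat (Suc n) + 1) b y = 0"
      using Suc.IH[of y] Suc.prems y by (simp add: kdecay_def)
    thus "(kdecay (- of_nat (Suc n)) b has_vector_derivative 0) (at y within {0<..})"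
      using kdecay_deriv[of y "- of_nat (Suc n)" b] Suc.prems y by (simp add: has_vector_derivative_at_within)
  qed auto
  then obtain c where c: "\<And>y. y > 0 \<Longrightarrow> kdecay (- of_nat (Suc n)) b y = c" by auto
  have "((\<lambda>y. c) \<longlongrightarrow> 0) (at_top :: real filter)"
    by (rule Lim_transform_eventually[OF kdecay_tendsto[OF Suc.prems(2)]])
       (use eventually_gt_at_top[of "0::real"] in eventually_elim, use c in auto)
  hence "c = 0" by (simp add: tendsto_const_iff)
  thus ?case using c[OF Suc.prems(1)] by (simp add: kdecay_def)
next
  case 0
  have "\<exists>c. \<forall>y\<in>{0<..}. kdecay 0 b y = c"
  proof (rule has_vector_derivative_zero_constant)
    fix y :: real assume "y \<in> {0<..}"
    thus "(kdecay 0 b has_vector_derivative 0) (at y within {0<..})"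
      using kdecay_deriv[of y 0 b] 0 by (simp add: has_vector_derivative_at_within)
  qed auto
  then obtain c where c: "\<And>y. y > 0 \<Longrightarrow> kdecay 0 b y = c" by auto
  have "((\<lambda>y. c) \<longlongrightarrow> 0) (at_top :: real filter)"
    by (rule Lim_transform_eventually[OF kdecay_tendsto[of 0 b]])
       (use 0 in simp, use eventually_gt_at_top[of "0::real"] in eventually_elim, use c in auto)
  hence "c = 0" by (simp add: tendsto_const_iff)
  thus ?case using c[OF 0(1)] by (simp add: kdecay_def)
qed

text \<open>Here \<open>T\<close> is the expected main term of \<open>kdecay a b\<close>; the derivative of the difference is \<open>o(p)\<close>, and
  both sides vanish at infinity.\<close>
lemma kasymp_lower_fst:
  assumes ab: "2 < Re (a + b)" "Re b > 0" and IH: "kasymp (a + 1) b"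
  shows "kasymp a b"
proof -
  define K where "K = 2 * of_real pi * 2 powr (- b) * rGamma (a + 1)"
  define p where "p = (\<lambda>s::real. exp (- 2 * of_real s) * of_real s powr (- b))"
  define T where "T = (\<lambda>s. a * K * p s)"
  \<comment> \<open>The error of the derivative relative to p: the error in the hypothesis for a +
    1, and a term of order 1 / s from differentiating s^(-b).\<close>
  define e where "e = (\<lambda>s. - 2 * a * (of_real s powr b * exp (of_real s) * kft (a + 1) b s 1 - K) + a * K * b / of_real s)"
  have np: "norm (p s) = exp (- 2 * s) * s powr (- Re b)" if "s > 0" for s
    using that by (simp add: p_def norm_mult norm_powr_real_powr)
  have p_nz: "p s \<noteq> 0" if "s > 0" for s using that by (simp add: p_def)
  have dp: "(p has_vector_derivative (- 2 * p s - b / of_real s * p s)) (at s)" if "s > 0" for s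
  proof -
    have "((\<lambda>s. exp (- 2 * s) * s powr (- b)) has_field_derivative
       (- 2 * (exp (- 2 * of_real s) * of_real s powr (- b)) - b / of_real s * (exp (- 2 * of_real s) * of_real s powr (- b)))) (at (of_real s))"
      using that by (auto intro!: derivative_eq_intros simp: complex_nonpos_Reals_iff powr_diff algebra_simps)
    thus ?thesis unfolding p_def by (rule has_vector_derivative_real_field)
  qed
  have kd: "kdecay (a + 1) b s = of_real s powr b * exp (of_real s) * kft (a + 1) b s 1 * p s" if "s > 0" for s
  proof -
    have "of_real s powr b * (of_real s :: complex) powr (- b) = 1" using that by (simp add: powr_minus)
    moreover have "exp (of_real s) * exp (- 2 * of_real s) = (exp (- of_real s) :: complex)" by (simp add: exp_add[symmetric])
    moreover have "of_real s powr b * exp (of_real s) * kft (a + 1) b s 1 * p s =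
       (of_real s powr b * of_real s powr (- b)) * (exp (of_real s) * exp (- 2 * of_real s)) * kft (a + 1) b s 1"
      by (simp add: p_def)
    ultimately show ?thesis by (simp only: kdecay_def mult_1_left)
  qed
  have D: "((\<lambda>s. kdecay a b s - T s) has_vector_derivative e s * p s) (at s)" if "s > 0" for s
  proof (rule has_vector_derivative_eq_rhs)
    show "((\<lambda>s. kdecay a b s - T s) has_vector_derivative
        (- 2 * a * kdecay (a + 1) b s - a * K * (- 2 * p s - b / of_real s * p s))) (at s)"
      unfolding T_def by (intro has_vector_derivative_diff kdecay_deriv has_vector_derivative_mult_right dp that ab)
    show "- 2 * a * kdecay (a + 1) b s - a * K * (- 2 * p s - b / of_real s * p s) = e s * p s"
      unfolding kd[OF that] e_def by (simp add: algebra_simps)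
  qed
  have "((\<lambda>s::real. a * K * b / of_real s) \<longlongrightarrow> 0) at_top"
    by (rule divide_of_real_tendsto_0)
  hence e0: "(e \<longlongrightarrow> - 2 * a * (K - K) + 0) at_top"
    unfolding e_def using IH[unfolded kasymp_def]
    by (intro tendsto_add tendsto_mult tendsto_diff tendsto_const) (simp_all add: K_def)
  have pt: "(p \<longlongrightarrow> 0) at_top"
  proof -
    have "((\<lambda>s. exp (- 2 * s) * s powr (- Re b)) \<longlongrightarrow> 0) at_top" by real_asymp
    thus ?thesis
      by (rule Lim_null_comparison[rotated]) (use eventually_gt_at_top[of "0::real"] in eventually_elim, simp add: np)
  qed
  have lim0: "((\<lambda>s. kdecay a b s - T s) \<longlongrightarrow> 0 - a * K * 0) at_top"
    unfolding T_def by (intro tendsto_intros kdecay_tendsto ab pt)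
  have "((\<lambda>s. (kdecay a b s - T s) / p s) \<longlongrightarrow> 0) at_top"
  proof (rule tendstoI)
    fix \<epsilon> :: real assume \<epsilon>: "\<epsilon> > 0"
    have "\<forall>\<^sub>F s in at_top. norm (e s) < \<epsilon> / 2"
      using tendstoD[OF e0, of "\<epsilon>/2"] \<epsilon> by simp
    hence "\<forall>\<^sub>F s in at_top. s > 0 \<and> norm (e s) < \<epsilon> / 2"
      using eventually_gt_at_top[of "0::real"] by eventually_elim auto
    then obtain Y where Y: "\<And>s. s \<ge> Y \<Longrightarrow> s > 0 \<and> norm (e s) < \<epsilon> / 2"
      unfolding eventually_at_top_linorder by blast
    have "norm (kdecay a b y - T y) \<le> \<epsilon> / 2 * (exp (- 2 * y) * y powr (- Re b))" if y: "y \<ge> Y" for y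
    proof (rule norm_le_of_derivative_bound[where f' = "\<lambda>s. e s * p s"])
      show "norm (e s * p s) \<le> \<epsilon> / 2 * (exp (- 2 * s) * s powr (- Re b))" if "s \<ge> Y" for s
      proof -
        have s: "s > 0" "norm (e s) \<le> \<epsilon> / 2" using Y[OF that] by auto
        show ?thesis unfolding norm_mult np[OF s(1)] by (rule mult_right_mono[OF s(2)]) simp
      qed
      show "((\<lambda>y. kdecay a b y - T y) has_vector_derivative e s * p s) (at s)" if "s \<ge> Y" for s
        using D Y[OF that] by blast
      show "((\<lambda>y. kdecay a b y - T y) \<longlongrightarrow> 0) at_top" using lim0 by simp
      show "Y > 0" using Y[of Y] by simp
    qed (use \<epsilon> ab y in simp_all)
    note bd = this
    have "norm ((kdecay a b y - T y) / p y) < \<epsilon>" if y: "y \<ge> Y" for y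
    proof -
      have y0: "y > 0" using Y[OF y] by simp
      have "norm (kdecay a b y - T y) \<le> \<epsilon> / 2 * norm (p y)"
        unfolding np[OF y0] by (rule bd[OF y])
      also have "\<dots> < \<epsilon> * norm (p y)"
        by (rule mult_strict_right_mono) (use \<epsilon> p_nz[OF y0] in auto)
      finally show ?thesis
        unfolding norm_divide by (subst pos_divide_less_eq) (use p_nz[OF y0] in auto)
    qed
    thus "\<forall>\<^sub>F s in at_top. dist ((kdecay a b s - T s) / p s) 0 < \<epsilon>"
      unfolding eventually_at_top_linorder by auto
  qed
  hence 1: "((\<lambda>s. (kdecay a b s - T s) / p s + a * K) \<longlongrightarrow> 0 + a * K) at_top"
    by (intro tendsto_add tendsto_const)
  have 2: "\<forall>\<^sub>F s in at_top. (kdecay a b s - T s) / p s + a * K = of_real s powr b * exp (of_real s) * kft a b s 1"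
    using eventually_gt_at_top[of "0::real"]
  proof eventually_elim
    case (elim s)
    have "(kdecay a b s - T s) / p s + a * K = kdecay a b s / p s"
      using p_nz[OF elim] by (simp add: T_def diff_divide_distrib)
    also have "\<dots> = of_real s powr b * (exp (- of_real s) / exp (- 2 * of_real s)) * kft a b s 1"
      using elim by (simp add: kdecay_def p_def powr_minus divide_inverse mult_ac)
    also have "exp (- of_real s) / exp (- 2 * of_real s) = (exp (of_real s) :: complex)"
      by (simp add: exp_diff[symmetric])
    finally show ?case .
  qed
  have 3: "0 + a * K = 2 * of_real pi * 2 powr (- b) * rGamma a"
    unfolding K_def rGamma_step[of a] by simp
  show ?thesis
    unfolding kasymp_def using Lim_transform_eventually[OF 1 2] unfolding 3 .
qed

lemma kasymp_if_Re_snd_pos: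
  assumes "2 < Re (a + b)" "Re b > 0"
  shows "kasymp a b"
proof -
  have "2 < Re (a + b)" using assms by simp
  thus ?thesis
  proof (induction a rule: complex_shift_induct[where c = 2])
    case (base a)
    thus ?case using kft_asymp_base[of a b] assms by (simp add: kasymp_def)
  next
    case (step a)
    show ?case by (rule kasymp_lower_fst) (use step assms in auto)
  qed
qed

text \<open>Descent in \<open>b\<close> by kft a b = 2y kft a (b + 1) - kft (a - 1) (b + 1), whose
  second term is of lower order by a factor y. The claim is quantified over \<open>a\<close> because
  the step uses it at a and at a - 1.\<close>

lemma kasymp:
  assumes "2 < Re (a + b)"
  shows "kasymp a b"
proof -
  have "\<forall>a. 2 < Re (a + b) \<longrightarrow> kasymp a b"
  proof (rule complex_shift_induct[where Q = "\<lambda>_. True" and c = 1 and z = b and P = "\<lambda>b. \<forall>a. 2 < Re (a + b) \<longrightarrow> kasymp a b"])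
    fix b assume "(True \<Longrightarrow> \<forall>a. 2 < Re (a + (b + 1)) \<longrightarrow> kasymp a (b + 1))"
    hence step: "2 < Re (a + (b + 1)) \<Longrightarrow> kasymp a (b + 1)" for a by blast
    show "\<forall>a. 2 < Re (a + b) \<longrightarrow> kasymp a b"
    proof (intro allI impI)
      fix a assume ab: "2 < Re (a + b)"
      define L where "L = 2 * of_real pi * 2 powr (- (b + 1)) * rGamma (a - 1)"
      have 1: "((\<lambda>y. 2 * (of_real y powr (b + 1) * exp (of_real y) * kft a (b + 1) y 1) -
           inverse (of_real y) * (of_real y powr (b + 1) * exp (of_real y) * kft (a - 1) (b + 1) y 1)) \<longlongrightarrow>
           2 * (2 * of_real pi * 2 powr (- (b + 1)) * rGamma a) - 0 * L) at_top"
      proof (rule tendsto_diff[OF tendsto_mult[OF tendsto_const] tendsto_mult])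
        show "((\<lambda>y. of_real y powr (b + 1) * exp (of_real y) * kft a (b + 1) y 1) \<longlongrightarrow> (2 * of_real pi * 2 powr (- (b + 1)) * rGamma a)) at_top"
          using step[of a] ab by (simp add: kasymp_def)
        show "((\<lambda>y. of_real y powr (b + 1) * exp (of_real y) * kft (a - 1) (b + 1) y 1) \<longlongrightarrow> L) at_top"
          using step[of "a - 1"] ab by (simp add: kasymp_def L_def)
        show "((\<lambda>y. inverse (complex_of_real y)) \<longlongrightarrow> 0) at_top"
          using divide_of_real_tendsto_0[of 1] by (simp add: divide_inverse)
      qed
      have 2: "2 * (of_real y powr (b + 1) * exp (of_real y) * kft a (b + 1) y 1) -
           inverse (of_real y) * (of_real y powr (b + 1) * exp (of_real y) * kft (a - 1) (b + 1) y 1) =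
           of_real y powr b * exp (of_real y) * kft a b y 1" if y: "y > 0" for y
      proof -
        have k: "kft a b y 1 = 2 * of_real y * kft a (b + 1) y 1 - kft (a - 1) (b + 1) y 1"
          using kft_contiguous[OF y, of "a - 1" b 1] ab by (simp add: algebra_simps)
        have p: "of_real y powr (b + 1) = of_real y * of_real y powr b"
          using y by (simp add: powr_add)
        have i: "inverse (of_real y) * (of_real y * u * v * w) = u * v * w" for u v w :: complex using y by simp
        show ?thesis unfolding p k i by (simp add: algebra_simps)
      qed
      have "2 * 2 powr (- (b + 1)) = (2 powr (- b) :: complex)"
        by (simp add: powr_diff)
      hence 3: "2 * (2 * of_real pi * 2 powr (- (b + 1)) * rGamma a) - 0 * L = 2 * of_real pi * 2 powr (- b) * rGamma a"
        by (simp add: algebra_simps)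
      have 4: "\<forall>\<^sub>F y in at_top. 2 * (of_real y powr (b + 1) * exp (of_real y) * kft a (b + 1) y 1) -
           inverse (of_real y) * (of_real y powr (b + 1) * exp (of_real y) * kft (a - 1) (b + 1) y 1) =
           of_real y powr b * exp (of_real y) * kft a b y 1"
        using eventually_gt_at_top[of "0::real"] by eventually_elim (rule 2)
      show "kasymp a b" unfolding kasymp_def
        using Lim_transform_eventually[OF 1 4] unfolding 3 .
    qed
  qed (use kasymp_if_Re_snd_pos in auto)
  thus ?thesis using assms by blast
qed

section \<open>Whittaker functions\<close>

text \<open>The opposite elimination to \<open>kft_deriv_raise_fst\<close>; applied to
  \<open>kft (a + 1) b\<close> it provides the second equation of the system.\<close>

lemma kft_deriv_raise_snd:
  assumes "y > 0" "2 \<le> Re (a + b)"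
  shows "((\<lambda>y. kft a b y \<xi>) has_vector_derivative
           (- of_real \<xi> * kft a b y \<xi> - 2 * b * kft a (b+1) y \<xi>)) (at y)"
proof -
  have "- of_real \<xi> * kft a b y \<xi> - 2 * b * kft a (b+1) y \<xi> = - a * kft (a+1) b y \<xi> - b * kft a (b+1) y \<xi>"
    using kft_by_parts[OF assms, of \<xi>] by simp
  thus ?thesis using kft_has_vector_derivative[OF assms, of \<xi>] by (simp only:)
qed

text \<open>The differentiated expression is itself the y-derivative of \<open>kft a b\<close> at
  frequency one. Raising \<open>b\<close> in its second term produces kft (a + 1) (b + 1), which the
  contiguous relation and the integration by parts express through the original pair.\<close>

lemma kft_ode:
  assumes "y > 0" "2 < Re (a + b)"
  shows "((\<lambda>y. kft a b y 1 - 2 * a * kft (a + 1) b y 1) has_vector_derivative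
     (- (a + b) / of_real y * (kft a b y 1 - 2 * a * kft (a + 1) b y 1) + (1 - (a - b) / of_real y) * kft a b y 1)) (at y)"
proof (rule has_vector_derivative_eq_rhs)
  have q: "2 \<le> Re (a + b)" "2 \<le> Re (a + 1 + b)" "1 \<le> Re (a + b)" using assms by auto
  define F where "F = kft a b y 1"
  define A where "A = kft (a + 1) b y 1"
  define B where "B = kft a (b + 1) y 1"
  define D where "D = kft (a + 1) (b + 1) y 1"
  show "((\<lambda>y. kft a b y 1 - 2 * a * kft (a + 1) b y 1) has_vector_derivative
     (F - 2 * a * A) - 2 * a * (- A - 2 * b * D)) (at y)"
    using has_vector_derivative_diff[OF kft_deriv_raise_fst[OF assms(1) q(1), of 1]
      has_vector_derivative_mult_right[OF kft_deriv_raise_snd[OF assms(1) q(2), of 1], of "2 * a"]]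
    by (simp add: F_def A_def D_def)
  have 1: "F = a * A - b * B" using kft_by_parts[OF assms(1) q(1), of 1] by (simp add: F_def A_def B_def)
  have 2: "B + A = 2 * of_real y * D" using kft_contiguous[OF assms(1) q(3), of 1] by (simp add: A_def B_def D_def)
  have y: "of_real y \<noteq> (0::complex)" using assms by simp
  have "of_real y * ((F - 2 * a * A) - 2 * a * (- A - 2 * b * D)) = of_real y * F + 2 * a * b * (2 * of_real y * D)"
    by (simp add: algebra_simps)
  also have "\<dots> = of_real y * F + 2 * a * b * (B + A)" by (simp only: 2)
  also have "\<dots> = - (a + b) * (F - 2 * a * A) + (of_real y - (a - b)) * F"
    unfolding 1 by (simp add: algebra_simps)
  also have "\<dots> = of_real y * (- (a + b) / of_real y * (F - 2 * a * A) + (1 - (a - b) / of_real y) * F)"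
    using y by (simp add: field_simps)
  finally show "(F - 2 * a * A) - 2 * a * (- A - 2 * b * D) = - (a + b) / of_real y * (kft a b y 1 - 2 * a * kft (a + 1) b y 1) + (1 - (a - b) / of_real y) * kft a b y 1"
    unfolding F_def[symmetric] A_def[symmetric] using y by simp
qed

text \<open>With x = 2y, the factor x^((a + b)/2) removes the first-order term of
  \<open>kft_ode\<close> and leaves Whittaker's equation. Gamma(a) / (2 pi) cancels the constant of
  \<open>kasymp\<close>, whence the condition on \<open>rGamma a\<close>; its remaining factor
  2^(-b) is absorbed by the substitution.\<close>

lemma is_whittaker_W_kft:
  assumes q: "2 < Re (a + b)" and a: "rGamma a \<noteq> 0"
  shows "is_whittaker_W ((a - b) / 2) ((a + b - 1) / 2)
           (\<lambda>x. Gamma a / (2 * of_real pi) * (of_real x powr ((a + b) / 2) * kft a b (x / 2) 1))"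
proof -
  define c where "c = (a + b) / 2"
  define C where "C = Gamma a / (2 * of_real pi)"
  define p where "p = (\<lambda>x::real. of_real x powr c :: complex)"
  define F where "F = (\<lambda>x. kft a b (x / 2) 1)"
  define G where "G = (\<lambda>x. kft a b (x / 2) 1 - 2 * a * kft (a + 1) b (x / 2) 1)"
  have dp: "(p has_vector_derivative c / of_real x * p x) (at x)" if "x > 0" for x
  proof -
    have "((\<lambda>s. s powr c) has_field_derivative c / of_real x * of_real x powr c) (at (of_real x))"
      using that by (auto intro!: derivative_eq_intros simp: complex_nonpos_Reals_iff powr_diff)
    thus ?thesis unfolding p_def by (rule has_vector_derivative_real_field)
  qed
  have dinv: "((\<lambda>x. c / of_real x) has_vector_derivative - c / (of_real x)\<^sup>2) (at x)" if "x > 0" for x :: real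
  proof -
    have "((\<lambda>s. c / s) has_field_derivative - c / (of_real x)\<^sup>2) (at (of_real x))"
      using that by (auto intro!: derivative_eq_intros simp: power2_eq_square)
    thus ?thesis by (rule has_vector_derivative_real_field)
  qed
  have half: "((\<lambda>x. x / 2) has_vector_derivative (1/2)) (at x)" for x :: real
    unfolding has_real_derivative_iff_has_vector_derivative[symmetric] by (auto intro!: derivative_eq_intros)
  have dF: "(F has_vector_derivative G x / 2) (at x)" if "x > 0" for x
    using vector_diff_chain_at[OF half kft_deriv_raise_fst[of "x/2" a b 1]] that q
    unfolding o_def F_def G_def by (simp add: scaleR_conv_of_real)
  have dG: "(G has_vector_derivative (- (a + b) / of_real (x / 2) * G x + (1 - (a - b) / of_real (x / 2)) * F x) / 2) (at x)"
    if "x > 0" for x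
    using vector_diff_chain_at[OF half kft_ode[of "x/2" a b]] that q
    unfolding o_def F_def G_def by (simp add: scaleR_conv_of_real)
  define w' where "w' = (\<lambda>x. C * (p x * (G x / 2) + (c / of_real x * p x) * F x))"
  define w'' where "w'' = (\<lambda>x. C * (
      (p x * ((- (a + b) / of_real (x / 2) * G x + (1 - (a - b) / of_real (x / 2)) * F x) / 2 / 2) + (c / of_real x * p x) * (G x / 2))
    + ((c / of_real x * p x) * (G x / 2) + (c / of_real x * (c / of_real x * p x) + (- c / (of_real x)\<^sup>2) * p x) * F x)))"
  have 1: "((\<lambda>x. C * (p x * F x)) has_vector_derivative w' x) (at x)" if "x > 0" for x
    unfolding w'_def by (intro has_vector_derivative_mult_right has_vector_derivative_mult dp dF that)
  have 2: "(w' has_vector_derivative w'' x) (at x)" if "x > 0" for x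
    unfolding w'_def w''_def
    by (intro has_vector_derivative_mult_right has_vector_derivative_mult has_vector_derivative_add
       dp dF dG dinv has_vector_derivative_divide that)
  have 3: "w'' x + (- 1 / 4 + ((a - b) / 2) / of_real x + (1 / 4 - ((a + b - 1) / 2)\<^sup>2) / (of_real x)\<^sup>2) * (C * (p x * F x)) = 0" if "x > 0" for x
  proof -
    define X where "X = complex_of_real x"
    have X: "X \<noteq> 0" using that by (simp add: X_def)
    have "2 * c = a + b" by (simp add: c_def)
    hence ab: "a = 2 * c - b" by (simp add: eq_diff_eq)
    show ?thesis
      unfolding w''_def X_def[symmetric] of_real_divide of_real_numeral unfolding ab using X
      by (simp add: field_simps power2_eq_square)
  qed
  have 4: "((\<lambda>x. C * (p x * F x) / (exp (- of_real x / 2) * of_real x powr ((a - b) / 2))) \<longlongrightarrow> 1) at_top"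
  proof -
    have "((\<lambda>y. of_real y powr b * exp (of_real y) * kft a b y 1) \<longlongrightarrow> 2 * of_real pi * 2 powr (- b) * rGamma a) at_top"
      using kasymp[OF q] by (simp add: kasymp_def)
    moreover have "filterlim (\<lambda>x::real. x / 2) at_top at_top" by real_asymp
    ultimately have "((\<lambda>x. of_real (x / 2) powr b * exp (of_real (x / 2)) * kft a b (x / 2) 1) \<longlongrightarrow> 2 * of_real pi * 2 powr (- b) * rGamma a) at_top"
      by (rule filterlim_compose)
    hence lim: "((\<lambda>x. C * 2 powr b * (of_real (x / 2) powr b * exp (of_real (x / 2)) * kft a b (x / 2) 1)) \<longlongrightarrow>
            C * 2 powr b * (2 * of_real pi * 2 powr (- b) * rGamma a)) at_top"
      by (rule tendsto_mult[OF tendsto_const])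
    have c1: "C * 2 powr b * (2 * of_real pi * 2 powr (- b) * rGamma a) = 1"
    proof -
      have 1: "2 powr b * 2 powr (- b) = (1 :: complex)" by (simp add: powr_minus)
      have 2: "Gamma a * rGamma a = 1" using a by (simp add: rGamma_inverse_Gamma)
      have "C * 2 powr b * (2 * of_real pi * 2 powr (- b) * rGamma a) =
         (2 powr b * 2 powr (- b)) * (Gamma a * rGamma a)" by (simp add: C_def)
      thus ?thesis unfolding 1 2 by simp
    qed
    have ev: "\<forall>\<^sub>F x in at_top. C * 2 powr b * (of_real (x / 2) powr b * exp (of_real (x / 2)) * kft a b (x / 2) 1) =
       C * (p x * F x) / (exp (- of_real x / 2) * of_real x powr ((a - b) / 2))"
      using eventually_gt_at_top[of "0::real"]
    proof eventually_elim
      case (elim x)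
      have "of_real x = 2 * complex_of_real (x / 2)" by simp
      hence e1: "of_real x powr b = 2 powr b * of_real (x / 2) powr b"
        by (metis Re_complex_of_real Reals_numeral complex_Re_numeral powr_times_real_left zero_le_numeral)
      have "c = b + (a - b) / 2" by (simp add: c_def field_simps)
      hence e2: "p x = of_real x powr b * of_real x powr ((a - b) / 2)"
        unfolding p_def by (simp only: powr_add)
      have e3: "exp (- of_real x / 2) * exp (of_real (x / 2)) = (1 :: complex)" by (simp add: exp_add[symmetric])
      have nz: "of_real x powr ((a - b) / 2) \<noteq> 0" using elim by simp
      have "C * (p x * F x) = (exp (- of_real x / 2) * exp (of_real (x / 2))) * C * (2 powr b * of_real (x / 2) powr b) * F x * of_real x powr ((a - b) / 2)"
        unfolding e3 e2 e1 by (simp only: mult_1_left mult_ac)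
      also have "\<dots> = (C * 2 powr b * (of_real (x / 2) powr b * exp (of_real (x / 2)) * kft a b (x / 2) 1)) *
          (exp (- of_real x / 2) * of_real x powr ((a - b) / 2))"
        unfolding F_def by (simp only: mult_ac)
      finally have fin: "C * (p x * F x) = \<dots>" .
      have "exp (- of_real x / 2) * of_real x powr ((a - b) / 2) \<noteq> (0 :: complex)" using nz by simp
      from nonzero_eq_divide_eq[OF this] show ?case unfolding fin by blast
    qed
    show ?thesis using Lim_transform_eventually[OF lim ev] unfolding c1 .
  qed
  show ?thesis
    unfolding is_whittaker_W_def
    using 1 2 3 4 unfolding C_def F_def p_def c_def by blast
qed

section \<open>Uniqueness of the decaying solution\<close>

text \<open>A Gronwall argument run backwards from \<open>b\<close>: the energy |d|^2 + |d'|^2 times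
  exp ((1 + M) x) is nondecreasing, and it vanishes at \<open>b\<close>.\<close>

lemma linear_ode_zero:
  fixes d d' c :: "real \<Rightarrow> complex"
  assumes d: "\<And>x. x \<ge> a \<Longrightarrow> (d has_vector_derivative d' x) (at x)"
    and d': "\<And>x. x \<ge> a \<Longrightarrow> (d' has_vector_derivative - c x * d x) (at x)"
    and c: "\<And>x. x \<ge> a \<Longrightarrow> norm (c x) \<le> M"
    and "a \<le> b" "d b = 0" "d' b = 0"
  shows "d a = 0"
proof -
  define e where "e = (\<lambda>x. (Re (d x))\<^sup>2 + (Im (d x))\<^sup>2 + (Re (d' x))\<^sup>2 + (Im (d' x))\<^sup>2)"
  define e' where "e' = (\<lambda>x. 2 * (d x \<bullet> d' x) + 2 * (d' x \<bullet> (- c x * d x)))"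
  have e_eq: "e x = (norm (d x))\<^sup>2 + (norm (d' x))\<^sup>2" for x
    by (simp add: e_def cmod_power2)
  have de: "(e has_real_derivative e' x) (at x)" if "x \<ge> a" for x
  proof -
    have sq: "((\<lambda>x. (f x)\<^sup>2) has_real_derivative 2 * f x * f') (at x)"
      if "(f has_vector_derivative f') (at x)" for f f'
      using DERIV_power[OF that[folded has_real_derivative_iff_has_vector_derivative], of 2]
      by (simp add: mult_ac)
    note 1 = sq[OF bounded_linear.has_vector_derivative[OF bounded_linear_Re d[OF that]]]
      sq[OF bounded_linear.has_vector_derivative[OF bounded_linear_Im d[OF that]]]
      sq[OF bounded_linear.has_vector_derivative[OF bounded_linear_Re d'[OF that]]]
      sq[OF bounded_linear.has_vector_derivative[OF bounded_linear_Im d'[OF that]]]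
    show ?thesis unfolding e_def
      by (rule DERIV_cong[OF DERIV_add[OF DERIV_add[OF DERIV_add[OF 1(1) 1(2)] 1(3)] 1(4)]])
         (simp only: e'_def inner_complex_def distrib_left mult.assoc add.assoc)
  qed
  have bnd: "e' x \<ge> - (1 + M) * e x" if "x \<ge> a" for x
  proof -
    have M: "M \<ge> 0" using c[OF that] norm_ge_zero order_trans by blast
    have "\<bar>d x \<bullet> d' x\<bar> \<le> norm (d x) * norm (d' x)" by (rule Cauchy_Schwarz_ineq2)
    moreover have "\<bar>d' x \<bullet> (- c x * d x)\<bar> \<le> norm (d' x) * (M * norm (d x))"
      by (rule order_trans[OF Cauchy_Schwarz_ineq2])
         (auto simp: norm_mult intro!: mult_left_mono mult_right_mono c that)
    ultimately have "- e' x \<le> (1 + M) * (2 * norm (d x) * norm (d' x))"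
      by (simp add: e'_def algebra_simps abs_le_iff)
    also have "\<dots> \<le> (1 + M) * e x"
      unfolding e_eq using M sum_squares_bound[of "norm (d x)" "norm (d' x)"] by (intro mult_left_mono) auto
    finally show ?thesis by (simp add: algebra_simps)
  qed
  have "e a * exp ((1 + M) * a) \<le> e b * exp ((1 + M) * b)"
  proof (rule DERIV_nonneg_imp_nondecreasing[OF assms(4)])
    fix x assume "a \<le> x" "x \<le> b"
    have "((\<lambda>x. e x * exp ((1 + M) * x)) has_real_derivative (e' x + (1 + M) * e x) * exp ((1 + M) * x)) (at x)"
      using de[OF \<open>a \<le> x\<close>] by (auto intro!: derivative_eq_intros simp: algebra_simps)
    moreover have "(e' x + (1 + M) * e x) * exp ((1 + M) * x) \<ge> 0"
      using bnd[OF \<open>a \<le> x\<close>] by (intro mult_nonneg_nonneg) (auto simp: algebra_simps)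
    ultimately show "\<exists>y. ((\<lambda>x. e x * exp ((1 + M) * x)) has_real_derivative y) (at x) \<and> 0 \<le> y" by blast
  qed
  also have "e b = 0" using assms by (simp add: e_eq)
  finally have "e a \<le> 0" by (simp add: mult_le_0_iff)
  thus ?thesis by (simp add: e_eq sum_power2_le_zero_iff)
qed

text \<open>For real \<open>r\<close> the comparison function E is positive, and v / E -> 1 keeps v
  away from zero far out. There the quotient d / v of the difference d = v - w has derivative C /
  v^2 with the constant Wronskian C. Once C = 0, d vanishes far out and
  \<open>linear_ode_zero\<close> carries this back to \<open>x0\<close>.\<close>

lemma whittaker_unique:
  assumes "is_whittaker_W (of_real r) \<mu> v" "is_whittaker_W (of_real r) \<mu> w" "x0 > 0"
  shows "v x0 = w x0"
proof -
  define c where "c = (\<lambda>x::real. - 1 / 4 + of_real r / of_real x + (1 / 4 - \<mu>\<^sup>2) / (of_real x)\<^sup>2 :: complex)"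
  have c_eq: "c x = - 1 / 4 + of_real r / of_real x + (1 / 4 - \<mu>\<^sup>2) / (of_real x)\<^sup>2" for x
    by (simp add: c_def)
  obtain v' v'' where v_all: "\<forall>x>0. (v has_vector_derivative v' x) (at x) \<and>
        (v' has_vector_derivative v'' x) (at x) \<and> v'' x + c x * v x = 0"
    using assms(1) unfolding is_whittaker_W_def c_eq[symmetric] by (elim conjE exE) (rule that)
  have v: "(v has_vector_derivative v' x) (at x)" "(v' has_vector_derivative v'' x) (at x)"
     "v'' x + c x * v x = 0" if "x > 0" for x
    using v_all that by simp_all
  obtain w' w'' where w_all: "\<forall>x>0. (w has_vector_derivative w' x) (at x) \<and>
        (w' has_vector_derivative w'' x) (at x) \<and> w'' x + c x * w x = 0"
    using assms(2) unfolding is_whittaker_W_def c_eq[symmetric] by (elim conjE exE) (rule that)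
  have w: "(w has_vector_derivative w' x) (at x)" "(w' has_vector_derivative w'' x) (at x)"
     "w'' x + c x * w x = 0" if "x > 0" for x
    using w_all that by simp_all
  define d d' where "d = (\<lambda>x. v x - w x)" and "d' = (\<lambda>x. v' x - w' x)"
  have vv: "v'' x = - c x * v x" if "x > 0" for x using v(3)[OF that] by (simp add: eq_neg_iff_add_eq_0)
  have ww: "w'' x = - c x * w x" if "x > 0" for x using w(3)[OF that] by (simp add: eq_neg_iff_add_eq_0)
  have dd: "(d has_vector_derivative d' x) (at x)" if "x > 0" for x
    unfolding d_def d'_def using that v w by (intro has_vector_derivative_diff) auto
  have dd': "(d' has_vector_derivative - c x * d x) (at x)" if "x > 0" for x
  proof (rule has_vector_derivative_eq_rhs)
    show "(d' has_vector_derivative v'' x - w'' x) (at x)"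
      unfolding d'_def using that v w by (intro has_vector_derivative_diff) auto
  qed (simp add: vv[OF that] ww[OF that] d_def algebra_simps)
  have "\<exists>C. \<forall>x\<in>{0<..}. v x * d' x - v' x * d x = C"
  proof (rule has_vector_derivative_zero_constant)
    fix x :: real assume "x \<in> {0<..}"
    hence x: "x > 0" by simp
    have "((\<lambda>x. v x * d' x - v' x * d x) has_vector_derivative
        (v x * (- c x * d x) + v' x * d' x) - (v' x * d' x + v'' x * d x)) (at x)"
      by (intro has_vector_derivative_diff has_vector_derivative_mult v dd dd' x)
    moreover have "(v x * (- c x * d x) + v' x * d' x) - (v' x * d' x + v'' x * d x) = 0"
      unfolding vv[OF x] by (simp add: algebra_simps)
    ultimately show "((\<lambda>x. v x * d' x - v' x * d x) has_vector_derivative 0) (at x within {0<..})"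
      using has_vector_derivative_at_within by metis
  qed (simp, blast)
  then obtain C where C: "\<And>x. x > 0 \<Longrightarrow> v x * d' x - v' x * d x = C"
    unfolding Ball_def greaterThan_iff by blast
  define E where "E = (\<lambda>x::real. exp (- x / 2) * x powr r)"
  have E: "exp (- of_real x / 2) * of_real x powr of_real r = complex_of_real (E x)" if "x > 0" for x
  proof -
    have "exp (- of_real x / 2) = complex_of_real (exp (- x / 2))"
      unfolding exp_of_real[symmetric] by simp
    thus ?thesis using that by (simp add: E_def powr_of_real)
  qed
  have limv: "((\<lambda>x. v x / of_real (E x)) \<longlongrightarrow> 1) at_top"
    by (rule Lim_transform_eventually[OF assms(1)[unfolded is_whittaker_W_def, THEN conjunct2]])
       (use eventually_gt_at_top[of "0::real"] in eventually_elim, simp only: E)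
  have limw: "((\<lambda>x. w x / of_real (E x)) \<longlongrightarrow> 1) at_top"
    by (rule Lim_transform_eventually[OF assms(2)[unfolded is_whittaker_W_def, THEN conjunct2]])
       (use eventually_gt_at_top[of "0::real"] in eventually_elim, simp only: E)
  have E0: "E x > 0" if "x > 0" for x using that by (simp add: E_def)
  have limh: "((\<lambda>x. d x / v x) \<longlongrightarrow> 0) at_top"
  proof -
    have 1: "((\<lambda>x. (v x / of_real (E x) - w x / of_real (E x)) / (v x / of_real (E x))) \<longlongrightarrow> (1 - 1) / 1) at_top"
      by (intro tendsto_divide tendsto_diff limv limw) simp
    have 2: "\<forall>\<^sub>F x in at_top. (v x / of_real (E x) - w x / of_real (E x)) / (v x / of_real (E x)) = d x / v x"
      using eventually_gt_at_top[of "0::real"]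
    proof eventually_elim
      case (elim x)
      show ?case using E0[OF elim]
        unfolding d_def diff_divide_distrib[symmetric] by (subst divide_divide_eq_left) simp
    qed
    show ?thesis using Lim_transform_eventually[OF 1 2] by simp
  qed
  have limi: "((\<lambda>x. Re (inverse ((v x / of_real (E x))\<^sup>2))) \<longlongrightarrow> Re (inverse (1\<^sup>2))) at_top"
    by (intro tendsto_intros limv) simp
  \<comment> \<open>Far out 1 / E^2 exceeds 2 and E^2 / v^2 has real part above 1/2, so the real
    part of 1 / v^2 is at least 1.\<close>
  have ev: "\<forall>\<^sub>F x in at_top. x > 0 \<and> Re (inverse ((v x / of_real (E x))\<^sup>2)) > 1/2 \<and> inverse ((E x)\<^sup>2) > 2"
  proof (intro eventually_conj eventually_gt_at_top)
    show "\<forall>\<^sub>F x in at_top. Re (inverse ((v x / of_real (E x))\<^sup>2)) > 1/2"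
      by (rule order_tendstoD(1)[OF limi]) simp
    have "filterlim (\<lambda>x. inverse ((E x)\<^sup>2)) at_top at_top" unfolding E_def by real_asymp
    thus "\<forall>\<^sub>F x in at_top. inverse ((E x)\<^sup>2) > 2" by (simp add: filterlim_at_top_dense)
  qed
  then obtain X where X: "\<And>x. x \<ge> X \<Longrightarrow> x > 0 \<and> Re (inverse ((v x / of_real (E x))\<^sup>2)) > 1/2 \<and> inverse ((E x)\<^sup>2) > 2"
    unfolding eventually_at_top_linorder by blast
  have X0: "X > 0" using X[of X] by simp
  have vnz: "v x \<noteq> 0" if "x \<ge> X" for x using X[OF that] by auto
  have dh: "((\<lambda>x. d x / v x) has_vector_derivative C / (v x)\<^sup>2) (at x)" if "x \<ge> X" for x
  proof -
    have x: "x > 0" using that X0 by simp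
    have "((\<lambda>z. inverse z) has_field_derivative - inverse ((v x)\<^sup>2)) (at (v x))"
      using vnz[OF that] by (auto intro!: derivative_eq_intros simp: power2_eq_square)
    from field_vector_diff_chain_at[OF v(1)[OF x] this]
    have "((\<lambda>x. inverse (v x)) has_vector_derivative v' x * - inverse ((v x)\<^sup>2)) (at x)" by (simp add: o_def)
    from has_vector_derivative_mult[OF dd[OF x] this]
    have "((\<lambda>x. d x / v x) has_vector_derivative d x * (v' x * - inverse ((v x)\<^sup>2)) + d' x * inverse (v x)) (at x)"
      by (simp add: divide_inverse)
    moreover have "d x * (v' x * - inverse ((v x)\<^sup>2)) + d' x * inverse (v x) = C / (v x)\<^sup>2"
      unfolding C[OF x, symmetric] using vnz[OF that] by (simp add: field_simps power2_eq_square)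
    ultimately show ?thesis by simp
  qed
  (* Otherwise the derivative C / v^2 of d / v grows like exp x, contradicting d / v \<rightarrow> 0. *)
  have C0: "C = 0"
  proof (rule ccontr)
    assume "C \<noteq> 0"
    define g where "g = (\<lambda>x. Re (d x / v x / C))"
    have dg: "(g has_real_derivative Re (inverse ((v x)\<^sup>2))) (at x)" if "x \<ge> X" for x
    proof -
      have "((\<lambda>x. d x / v x / C) has_vector_derivative C / (v x)\<^sup>2 / C) (at x)"
        by (intro has_vector_derivative_divide dh that)
      moreover have "C / (v x)\<^sup>2 / C = inverse ((v x)\<^sup>2)" using \<open>C \<noteq> 0\<close> by (simp add: divide_inverse)
      ultimately have "((\<lambda>x. d x / v x / C) has_vector_derivative inverse ((v x)\<^sup>2)) (at x)" by (simp only:)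
      from bounded_linear.has_vector_derivative[OF bounded_linear_Re this] show ?thesis
        unfolding has_real_derivative_iff_has_vector_derivative g_def .
    qed
    have ge1: "Re (inverse ((v x)\<^sup>2)) \<ge> 1" if "x \<ge> X" for x
    proof -
      have Ex: "E x > 0" using X[OF that] E0 by auto
      hence "inverse ((v x)\<^sup>2) = of_real (inverse ((E x)\<^sup>2)) * inverse ((v x / of_real (E x))\<^sup>2)"
        by (simp add: field_simps)
      hence "Re (inverse ((v x)\<^sup>2)) = inverse ((E x)\<^sup>2) * Re (inverse ((v x / of_real (E x))\<^sup>2))"
        by (simp only: Re_complex_of_real Im_complex_of_real times_complex.simps mult_zero_left diff_zero)
      also have "\<dots> \<ge> 2 * (1/2)" using X[OF that] by (intro mult_mono) auto
      finally show ?thesis by simp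
    qed
    have lin: "g X - X \<le> g x - x" if "x \<ge> X" for x
    proof (rule DERIV_nonneg_imp_nondecreasing[OF that])
      fix y assume y: "X \<le> y" "y \<le> x"
      have "((\<lambda>x. g x - x) has_real_derivative Re (inverse ((v y)\<^sup>2)) - 1) (at y)"
        using dg[OF y(1)] by (auto intro!: derivative_eq_intros)
      thus "\<exists>z. ((\<lambda>x. g x - x) has_real_derivative z) (at y) \<and> 0 \<le> z" using ge1[OF y(1)] by auto
    qed
    have "(g \<longlongrightarrow> Re (0 / C)) at_top" unfolding g_def by (intro tendsto_intros limh \<open>C \<noteq> 0\<close>)
    hence "\<forall>\<^sub>F x in at_top. g x < 1" by (intro order_tendstoD(2)) auto
    moreover have "\<forall>\<^sub>F x in at_top. x \<ge> X" "\<forall>\<^sub>F x in at_top. x > 1 + X - g X"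
      by (rule eventually_ge_at_top eventually_gt_at_top)+
    ultimately have "\<forall>\<^sub>F x in at_top. g x < 1 \<and> x \<ge> X \<and> x > 1 + X - g X"
      by eventually_elim simp
    then obtain x where "g x < 1" "x \<ge> X" "x > 1 + X - g X"
      unfolding eventually_at_top_linorder by blast
    thus False using lin[of x] by simp
  qed
  have "\<exists>k. \<forall>x\<in>{X..}. d x / v x = k"
  proof (rule has_vector_derivative_zero_constant)
    show "((\<lambda>x. d x / v x) has_vector_derivative 0) (at x within {X..})" if "x \<in> {X..}" for x
      using dh[of x] that C0 by (simp add: has_vector_derivative_at_within)
  qed auto
  then obtain k where k: "\<And>x. x \<ge> X \<Longrightarrow> d x / v x = k" by auto
  have "((\<lambda>x. k) \<longlongrightarrow> 0) (at_top :: real filter)"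
    by (rule Lim_transform_eventually[OF limh]) (use eventually_ge_at_top[of X] in eventually_elim, use k in simp)
  hence "k = 0" by (simp add: tendsto_const_iff)
  hence d0: "d x = 0" if "x \<ge> X" for x using k[OF that] vnz[OF that] by simp
  \<comment> \<open>A point at or beyond both \<open>x0\<close> and the start of the range where d
    vanishes; there the zero Wronskian gives d' = 0 as well, because v is nonzero.\<close>
  define b where "b = max x0 X"
  have b: "b > 0" "b \<ge> X" "b \<ge> x0" using X0 by (auto simp: b_def)
  have d0': "d' b = 0" using C[OF b(1)] C0 d0[OF b(2)] vnz[OF b(2)] by simp
  have "d x0 = 0"
  proof (rule linear_ode_zero[where b = b and d' = d' and c = c])
    show "norm (c x) \<le> 1/4 + \<bar>r\<bar> / x0 + norm (1/4 - \<mu>\<^sup>2) / x0\<^sup>2" if "x \<ge> x0" for x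
    proof -
      have x: "x > 0" using assms that by simp
      have "norm (c x) \<le> norm (- 1/4 :: complex) + norm (of_real r / of_real x :: complex) + norm ((1/4 - \<mu>\<^sup>2) / (of_real x)\<^sup>2)"
        unfolding c_def by (intro order_trans[OF norm_triangle_ineq] add_mono order_refl)
      also have "\<dots> = 1/4 + \<bar>r\<bar> / x + norm (1/4 - \<mu>\<^sup>2) / x\<^sup>2"
        using x by (simp add: norm_divide norm_power)
      also have "\<dots> \<le> 1/4 + \<bar>r\<bar> / x0 + norm (1/4 - \<mu>\<^sup>2) / x0\<^sup>2"
        using that assms by (intro add_mono order_refl divide_left_mono power_mono mult_pos_pos zero_less_power x) auto
      finally show ?thesis .
    qed
  qed (use dd dd' assms(3) b d0 d0' in simp_all)
  thus ?thesis by (simp add: d_def)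
qed

lemma whittaker_W_eq:
  assumes "is_whittaker_W (of_real r) \<mu> w" "x > 0"
  shows "whittaker_W (of_real r) \<mu> x = w x"
  unfolding whittaker_W_def
proof (rule the_equality)
  show "\<exists>w'. is_whittaker_W (of_real r) \<mu> w' \<and> w x = w' x" using assms by blast
qed (use assms whittaker_unique in metis)

text \<open>At the poles of Gamma(a) both sides are zero by \<open>kft_vanish\<close>; elsewhere the
  normalisation of \<open>is_whittaker_W_kft\<close> is inverted.\<close>

lemma kft_eq_whittaker_W:
  assumes q: "2 < Re (a + b)" and ab: "a - b = of_real r" and x: "x > 0"
  shows "kft a b (x / 2) 1 = 2 * of_real pi * rGamma a * of_real x powr (- (a + b) / 2) *
           whittaker_W ((a - b) / 2) ((a + b - 1) / 2) x"
proof (cases "rGamma a = 0")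
  case True
  then obtain n where "a = - of_nat n" by (auto simp: rGamma_eq_zero_iff elim!: nonpos_Ints_cases')
  thus ?thesis using kft_vanish[of "x / 2" n b] x q True by simp
next
  case False
  have W: "whittaker_W ((a - b) / 2) ((a + b - 1) / 2) x =
       Gamma a / (2 * of_real pi) * (of_real x powr ((a + b) / 2) * kft a b (x / 2) 1)"
    using whittaker_W_eq[of "r / 2" "(a + b - 1) / 2"] is_whittaker_W_kft[OF q False] x by (simp add: ab)
  have 1: "rGamma a * Gamma a = 1" using False by (simp add: rGamma_inverse_Gamma)
  have 2: "of_real x powr (- (a + b) / 2) * of_real x powr ((a + b) / 2) = (1 :: complex)"
    using x by (simp add: powr_add[symmetric] add_divide_distrib[symmetric])
  have "2 * of_real pi * rGamma a * of_real x powr (- (a + b) / 2) *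
     (Gamma a / (2 * of_real pi) * (of_real x powr ((a + b) / 2) * kft a b (x / 2) 1)) =
     (rGamma a * Gamma a) * (of_real x powr (- (a + b) / 2) * of_real x powr ((a + b) / 2)) * kft a b (x / 2) 1"
    by simp
  also have "\<dots> = kft a b (x / 2) 1" unfolding 1 2 by simp
  finally show ?thesis unfolding W by simp
qed

section \<open>Poisson summation\<close>

text \<open>Since sin x - x cos x increases, sin (t/2) \<ge> (t/2) cos (t/2); doubling the angle and
  cos^2 (t/2) \<ge> 1/2 finish the estimate.\<close>

lemma sin_ge_half:
  assumes "0 \<le> t" "t \<le> pi / 2"
  shows "t / 2 \<le> sin t"
proof -
  have "sin 0 - 0 * cos 0 \<le> sin (t / 2) - t / 2 * cos (t / 2)"
  proof (rule DERIV_nonneg_imp_nondecreasing[where f = "\<lambda>x. sin x - x * cos x"])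
    fix x assume x: "0 \<le> x" "x \<le> t / 2"
    have "((\<lambda>x. sin x - x * cos x) has_real_derivative x * sin x) (at x)"
      by (auto intro!: derivative_eq_intros)
    moreover have "0 \<le> x * sin x"
      using x assms by (intro mult_nonneg_nonneg sin_ge_zero) auto
    ultimately show "\<exists>y. ((\<lambda>x. sin x - x * cos x) has_real_derivative y) (at x) \<and> 0 \<le> y" by blast
  qed (use assms in auto)
  hence 1: "t / 2 * cos (t / 2) \<le> sin (t / 2)" by simp
  have c: "cos (t / 2) \<ge> 0" "cos t \<ge> 0" using assms by (auto intro!: cos_ge_zero)
  have "cos t = 2 * (cos (t / 2))\<^sup>2 - 1" using cos_double_cos[of "t / 2"] by simp
  hence c2: "(cos (t / 2))\<^sup>2 \<ge> 1/2" using c by simp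
  have "t / 2 \<le> t * (cos (t / 2))\<^sup>2" using mult_left_mono[OF c2 assms(1)] by simp
  also have "\<dots> = 2 * (t / 2 * cos (t / 2)) * cos (t / 2)" by (simp add: power2_eq_square)
  also have "\<dots> \<le> 2 * sin (t / 2) * cos (t / 2)" using 1 c by (intro mult_right_mono) auto
  also have "\<dots> = sin t" using sin_double[of "t / 2"] by simp
  finally show ?thesis .
qed

lemma norm_cis_minus_one: "norm (cis (2 * t) - 1) = 2 * \<bar>sin t\<bar>"
proof -
  have "cis (2 * t) - 1 = cis t * (cis t - cis (- t))"
    by (simp add: right_diff_distrib cis_mult)
  also have "cis t - cis (- t) = 2 * \<i> * of_real (sin t)" by (simp add: complex_eq_iff)
  finally show ?thesis by (simp add: norm_mult)
qed

text \<open>A linear lower bound at both ends of the period, to be set against the Lipschitz bound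
  of a periodic function.\<close>

lemma norm_cis_minus_one_ge:
  assumes "0 \<le> x" "x \<le> 1"
  shows "norm (cis (2 * pi * x) - 1) \<ge> pi * min x (1 - x)"
proof (cases "x \<le> 1 / 2")
  case True
  have "pi * x / 2 \<le> sin (pi * x)" using True assms by (intro sin_ge_half) auto
  hence "pi * x \<le> 2 * \<bar>sin (pi * x)\<bar>" by simp
  thus ?thesis using norm_cis_minus_one[of "pi * x"] True by (simp add: min_def mult.assoc)
next
  case False
  have "pi * (1 - x) / 2 \<le> sin (pi * (1 - x))"
    using False assms by (intro sin_ge_half) (auto simp: algebra_simps)
  also have "pi * (1 - x) = pi - pi * x" by (simp add: algebra_simps)
  hence "sin (pi * (1 - x)) = sin (pi * x)" by (simp add: sin_diff)
  finally have "pi * (1 - x) \<le> 2 * \<bar>sin (pi * x)\<bar>" by simp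
  thus ?thesis using norm_cis_minus_one[of "pi * x"] False by (simp add: min_def mult.assoc)
qed

lemma summable_on_int_if_nat:
  fixes g :: "int \<Rightarrow> real"
  assumes "(\<lambda>n. g (int n)) summable_on UNIV" "(\<lambda>n. g (- int n)) summable_on UNIV"
  shows "g summable_on UNIV"
proof -
  have "g summable_on (range int)"
    by (subst summable_on_reindex) (use assms(1) in \<open>auto simp: o_def\<close>)
  moreover have "g summable_on (range (\<lambda>n. - int n))"
    by (subst summable_on_reindex) (use assms(2) in \<open>auto simp: o_def inj_on_def\<close>)
  ultimately have "g summable_on (range int \<union> range (\<lambda>n. - int n))"
    by (rule summable_on_union)
  also have "range int \<union> range (\<lambda>n. - int n) = UNIV"
    by (auto simp: image_iff) (metis int_cases2)
  finally show ?thesis .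
qed

lemma summable_on_int_inv_square:
  "(\<lambda>l::int. C / (1 + (of_int l)\<^sup>2) :: real) summable_on UNIV"
proof -
  have "summable (\<lambda>n. 1 / (1 + (real n)\<^sup>2))"
  proof (rule summable_comparison_test')
    show "summable (\<lambda>n. inverse ((real n)\<^sup>2))" by (rule inverse_power_summable) simp
    show "norm (1 / (1 + (real n)\<^sup>2)) \<le> inverse ((real n)\<^sup>2)" if "n \<ge> 1" for n
    proof -
      have "norm (1 / (1 + (real n)\<^sup>2)) = 1 / (1 + (real n)\<^sup>2)" by simp
      also have "\<dots> \<le> 1 / (real n)\<^sup>2" using that
        by (intro divide_left_mono mult_pos_pos add_pos_nonneg) auto
      finally show ?thesis by (simp add: inverse_eq_divide)
    qed
  qed
  hence 1: "(\<lambda>n::nat. 1 / (1 + (real n)\<^sup>2)) summable_on UNIV"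
    by (intro summable_nonneg_imp_summable_on) auto
  have "(\<lambda>l::int. 1 / (1 + (of_int l)\<^sup>2) :: real) summable_on UNIV"
    by (rule summable_on_int_if_nat) (use 1 in simp_all)
  hence "(\<lambda>l::int. C * (1 / (1 + (of_int l)\<^sup>2)) :: real) summable_on UNIV"
    by (rule summable_on_cmult_right)
  thus ?thesis by simp
qed

text \<open>The half-open blocks match a tiling of the line by unit intervals, the closed ones the
  symmetric partial sums of a Fourier series.\<close>

lemma has_sum_int_symmetric:
  fixes f :: "int \<Rightarrow> 'a :: {comm_monoid_add, topological_space}"
  assumes "(f has_sum S) UNIV"
  shows "(\<lambda>M. \<Sum>l\<in>{- int M..<int M}. f l) \<longlonglongrightarrow> S" "(\<lambda>M. \<Sum>l\<in>{- int M..int M}. f l) \<longlonglongrightarrow> S"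
proof -
  have "filterlim (\<lambda>M. {- int M..<int M}) (finite_subsets_at_top UNIV) sequentially"
    "filterlim (\<lambda>M. {- int M..int M}) (finite_subsets_at_top UNIV) sequentially"
  proof -
    have ev: "\<forall>\<^sub>F M in sequentially. X \<subseteq> {- int M..<int M}" if "finite X" for X :: "int set"
    proof -
      define K where "K = nat (Max (insert 0 (abs ` X))) + 1"
      have "X \<subseteq> {- int M..<int M}" if "M \<ge> K" for M
      proof
        fix x assume "x \<in> X"
        hence "\<bar>x\<bar> \<le> Max (insert 0 (abs ` X))" using \<open>finite X\<close> by (intro Max_ge) auto
        thus "x \<in> {- int M..<int M}" using that unfolding K_def by auto
      qed
      thus ?thesis unfolding eventually_sequentially by blast
    qed
    show "filterlim (\<lambda>M. {- int M..<int M}) (finite_subsets_at_top UNIV) sequentially"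
      unfolding filterlim_finite_subsets_at_top using ev by auto
    show "filterlim (\<lambda>M. {- int M..int M}) (finite_subsets_at_top UNIV) sequentially"
      unfolding filterlim_finite_subsets_at_top
    proof (intro allI impI)
      fix X :: "int set" assume "finite X \<and> X \<subseteq> UNIV"
      with ev[of X] show "\<forall>\<^sub>F M in sequentially. finite {- int M..int M} \<and> X \<subseteq> {- int M..int M} \<and> {- int M..int M} \<subseteq> UNIV"
        by (auto elim!: eventually_mono)
    qed
  qed
  thus "(\<lambda>M. \<Sum>l\<in>{- int M..<int M}. f l) \<longlonglongrightarrow> S" "(\<lambda>M. \<Sum>l\<in>{- int M..int M}. f l) \<longlonglongrightarrow> S"
    using assms unfolding has_sum_def by (auto elim: filterlim_compose)
qed

text \<open>The average runs over the block from K to 2K - 1, so that all its indices tend to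
  infinity and early terms need no separate treatment.\<close>

lemma tendsto_shifted_average:
  fixes X :: "nat \<Rightarrow> complex"
  assumes "X \<longlonglongrightarrow> L"
  shows "(\<lambda>K. (\<Sum>j<K. X (K + j)) / of_nat K) \<longlonglongrightarrow> L"
proof (rule LIMSEQ_I)
  fix e :: real assume "e > 0"
  then obtain n0 where n0: "\<And>n. n \<ge> n0 \<Longrightarrow> norm (X n - L) < e / 2"
    using LIMSEQ_D[OF assms, of "e / 2"] by auto
  have "norm ((\<Sum>j<K. X (K + j)) / of_nat K - L) < e" if K: "K \<ge> max 1 n0" for K
  proof -
    have "(\<Sum>j<K. X (K + j)) / of_nat K - L = (\<Sum>j<K. X (K + j) - L) / of_nat K"
      using K by (simp add: sum_subtractf diff_divide_distrib)
    also have "norm \<dots> \<le> (\<Sum>j<K. e / 2) / of_nat K"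
      unfolding norm_divide using K n0 \<open>e > 0\<close> by (intro frac_le sum_norm_le sum_nonneg) (auto intro: less_imp_le)
    also have "\<dots> = e / 2" using K by simp
    finally show ?thesis using \<open>e > 0\<close> by simp
  qed
  thus "\<exists>no. \<forall>n\<ge>no. norm ((\<Sum>j<n. X (n + j)) / of_nat n - L) < e" by blast
qed

lemma integral_cis_unit_interval:
  fixes n :: int
  shows "(LBINT x. indicator {0..<1} x *\<^sub>R cis (2 * pi * of_int n * x)) = (if n = 0 then 1 else 0)"
proof -
  have e: "(LBINT x. indicator {0..<1} x *\<^sub>R cis (2 * pi * of_int n * x)) = (LBINT x. indicator {0..1} x *\<^sub>R cis (2 * pi * of_int n * x))"
  proof (rule integral_cong_AE)
    show "AE x in lborel. indicat_real {0..<1} x *\<^sub>R cis (2 * pi * of_int n * x) = indicat_real {0..1} x *\<^sub>R cis (2 * pi * of_int n * x)"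
      using AE_lborel_singleton[of "1::real"] by eventually_elim (auto simp: indicator_def)
  qed (auto simp: cis_conv_exp)
  show ?thesis
  proof (cases "n = 0")
    case False
    define c where "c = 2 * pi * of_int n"
    have c: "c \<noteq> 0" using False by (simp add: c_def)
    have "has_bochner_integral lborel (\<lambda>x. indicator {0..1} x *\<^sub>R cis (c * x)) (cis (c * 1) / (\<i> * of_real c) - cis (c * 0) / (\<i> * of_real c))"
    proof (rule has_bochner_integral_FTC_Icc)
      fix x :: real
      show "((\<lambda>x. cis (c * x) / (\<i> * of_real c)) has_vector_derivative cis (c * x)) (at x within {0..1})"
        using has_vector_derivative_divide[OF cis_has_vector_derivative[of c x "{0..1}"], of "\<i> * of_real c"] c by simp
    qed (auto simp: cis_conv_exp intro!: continuous_intros)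
    moreover have "cis (c * 1) = 1" by (simp add: c_def)
    ultimately show ?thesis using False e by (simp add: has_bochner_integral_iff c_def)
  qed (use e in simp)
qed

text \<open>The periodisation \<open>G\<close> of \<open>F\<close> is Lipschitz because
  \<open>F'\<close> decays like \<open>F\<close>, and unfolding identifies its Fourier coefficients
  with \<open>c\<close>. As \<open>c\<close> is summable, it is enough to find the sum of the
  Fourier series at the single point 0.\<close>

lemma poisson_summation:
  fixes F F' :: "real \<Rightarrow> complex" and c :: "int \<Rightarrow> complex"
  assumes der: "\<And>x. (F has_vector_derivative F' x) (at x)"
    and F: "\<And>x. norm (F x) \<le> C / (1 + x\<^sup>2)" and F': "\<And>x. norm (F' x) \<le> C / (1 + x\<^sup>2)"
    and c_def: "\<And>n. c n = (LBINT x. F x * cis (- (2 * pi * of_int n * x)))"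
    and c_summable: "c summable_on UNIV"
  shows "(\<lambda>l. F (of_int l)) summable_on UNIV" "(\<Sum>\<^sub>\<infinity>l\<in>UNIV. F (of_int l)) = (\<Sum>\<^sub>\<infinity>n\<in>UNIV. c n)"
proof -
  have contF: "continuous_on UNIV F"
    using der has_vector_derivative_continuous by (intro continuous_at_imp_continuous_on) blast
  hence [measurable]: "F \<in> borel_measurable borel" by (rule borel_measurable_continuous_onI)
  have C0: "C \<ge> 0" using order_trans[OF norm_ge_zero F[of 0]] by simp
  have intF: "integrable lborel (\<lambda>x. F x * cis (- (2 * pi * of_int n * x)))" for n
    by (rule Bochner_Integration.integrable_bound[OF integrable_inv_1_plus_sq[of C]])
       (use F C0 in \<open>auto simp: norm_mult intro!: AE_I2 order_trans[OF _ abs_ge_self]\<close>)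
  \<comment> \<open>For |x| \<le> 1 all translates are dominated by one summable series, since l^2
    \<le> 2 (x + l)^2 + 2 x^2.\<close>
  have sq: "C / (1 + (x + of_int l)\<^sup>2) \<le> 3 * C / (1 + (of_int l)\<^sup>2)" if "\<bar>x\<bar> \<le> 1" for x :: real and l :: int
  proof -
    have "(of_int l)\<^sup>2 = (x + of_int l - x)\<^sup>2" by simp
    also have "\<dots> \<le> 2 * (x + of_int l)\<^sup>2 + 2 * x\<^sup>2"
      using sum_squares_ge_zero[of "x + of_int l + x" 0] by (simp add: power2_eq_square algebra_simps)
    finally have "(of_int l)\<^sup>2 \<le> 2 * (x + of_int l)\<^sup>2 + 2 * x\<^sup>2" .
    have "x\<^sup>2 \<le> 1" using that by (simp add: abs_square_le_1)
    have "1 + (of_int l)\<^sup>2 \<le> 3 * (1 + (x + of_int l)\<^sup>2)"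
    proof -
      have "1 + a \<le> 3 * (1 + b)" if "a \<le> 2 * b + 2 * c" "c \<le> 1" "0 \<le> b" for a b c :: real
        using that by simp
      thus ?thesis using \<open>x\<^sup>2 \<le> 1\<close> \<open>(of_int l)\<^sup>2 \<le> 2 * (x + of_int l)\<^sup>2 + 2 * x\<^sup>2\<close> zero_le_power2 by blast
    qed
    from mult_left_mono[OF this C0]
    have 1: "C * (1 + (of_int l)\<^sup>2) \<le> 3 * C * (1 + (x + of_int l)\<^sup>2)" by (simp only: mult_ac)
    have p: "1 + (x + of_int l)\<^sup>2 > 0" "1 + (real_of_int l)\<^sup>2 > 0" by (simp_all add: add_pos_nonneg)
    have "C \<le> 3 * C * (1 + (x + of_int l)\<^sup>2) / (1 + (of_int l)\<^sup>2)"
      by (subst pos_le_divide_eq[OF p(2)]) (rule 1)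
    from divide_right_mono[OF this less_imp_le[OF p(1)]] p(1) show ?thesis by simp
  qed
  define B where "B = (\<Sum>\<^sub>\<infinity>l::int. 3 * C / (1 + (of_int l)\<^sup>2) :: real)"
  have sB: "(\<lambda>l::int. 3 * C / (1 + (of_int l)\<^sup>2) :: real) summable_on UNIV"
    by (rule summable_on_int_inv_square)
  have B0: "B \<ge> 0" unfolding B_def using C0 by (intro infsum_nonneg) auto
  have Fl: "norm (F (x + of_int l)) \<le> 3 * C / (1 + (of_int l)\<^sup>2)" if "\<bar>x\<bar> \<le> 1" for x l
    using order_trans[OF F sq[OF that]] .
  have sF: "(\<lambda>l. norm (F (x + of_int l))) summable_on UNIV" if "\<bar>x\<bar> \<le> 1" for x
    by (rule summable_on_comparison_test[OF sB]) (use Fl[OF that] in auto)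
  show "(\<lambda>l. F (of_int l)) summable_on UNIV" using abs_summable_summable[OF sF[of 0]] by simp
  define G where "G = (\<lambda>x. \<Sum>\<^sub>\<infinity>l::int. F (x + of_int l))"
  have hsG: "((\<lambda>l. F (x + of_int l)) has_sum G x) UNIV" if "\<bar>x\<bar> \<le> 1" for x
    unfolding G_def using abs_summable_summable[OF sF[OF that]] by simp
  \<comment> \<open>The one instance of periodicity that is needed: near the right end of the
    period, G x is compared with G 1 in place of G 0.\<close>
  have G1: "G 1 = G 0"
  proof -
    have "bij_betw (\<lambda>l::int. l + 1) UNIV UNIV" by (rule bij_betwI[of _ _ _ "\<lambda>l. l - 1"]) auto
    from infsum_reindex_bij_betw[OF this, of "\<lambda>l. F (of_int l)"] show ?thesis
      by (simp add: G_def add.commute)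
  qed
  have Glip: "norm (G x - G y) \<le> B * \<bar>x - y\<bar>" if xy: "x \<in> {0..1}" "y \<in> {0..1}" for x y
  proof -
    have d: "norm (F (x + of_int l) - F (y + of_int l)) \<le> 3 * C / (1 + (of_int l)\<^sup>2) * \<bar>x - y\<bar>" for l :: int
    proof -
      have "norm (F (x + of_int l) - F (y + of_int l)) \<le> 3 * C / (1 + (of_int l)\<^sup>2) * norm (x - y)"
      proof (rule differentiable_bound[of "{0..1::real}" "\<lambda>x. F (x + of_int l)" "\<lambda>x h. h *\<^sub>R F' (x + of_int l)"])
        fix z :: real assume z: "z \<in> {0..1}"
        have "((\<lambda>x. F (x + of_int l)) has_vector_derivative F' (z + of_int l)) (at z)"
        proof -
          have "((\<lambda>x. x + of_int l) has_vector_derivative 1) (at z)"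
            unfolding has_real_derivative_iff_has_vector_derivative[symmetric] by (auto intro!: derivative_eq_intros)
          from vector_diff_chain_at[OF this der] show ?thesis by (simp add: o_def)
        qed
        thus "((\<lambda>x. F (x + of_int l)) has_derivative (\<lambda>h. h *\<^sub>R F' (z + of_int l))) (at z within {0..1})"
          using has_derivative_at_withinI unfolding has_vector_derivative_def by blast
        show "onorm (\<lambda>h. h *\<^sub>R F' (z + of_int l)) \<le> 3 * C / (1 + (of_int l)\<^sup>2)"
        proof (rule onorm_bound)
          have "norm (F' (z + of_int l)) \<le> 3 * C / (1 + (of_int l)\<^sup>2)"
            using order_trans[OF F' sq[of z]] z by simp
          from mult_left_mono[OF this abs_ge_zero]
          show "norm (h *\<^sub>R F' (z + of_int l)) \<le> 3 * C / (1 + (of_int l)\<^sup>2) * norm h" for h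
            by (simp add: mult.commute)
        qed (use C0 in auto)
      qed (use xy in auto)
      thus ?thesis by simp
    qed
    have "((\<lambda>l. F (x + of_int l) - F (y + of_int l)) has_sum (G x - G y)) UNIV"
      using has_sum_add[OF hsG[of x] has_sum_uminusI[OF hsG[of y]]] xy by simp
    moreover have "((\<lambda>l::int. 3 * C / (1 + (of_int l)\<^sup>2) * \<bar>x - y\<bar>) has_sum (B * \<bar>x - y\<bar>)) UNIV"
      unfolding B_def by (rule has_sum_cmult_left[OF has_sum_infsum[OF sB]])
    ultimately show ?thesis by (rule norm_infsum_le) (rule d)
  qed
  define I where "I = (indicator {0..<1} :: real \<Rightarrow> real)"
  define GM where "GM = (\<lambda>M x. \<Sum>l\<in>{- int M..<int M}. F (x + of_int l))"
  have GMB: "norm (GM M x) \<le> B" if "\<bar>x\<bar> \<le> 1" for M x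
  proof -
    have "norm (GM M x) \<le> (\<Sum>l\<in>{- int M..<int M}. 3 * C / (1 + (of_int l)\<^sup>2))"
      unfolding GM_def by (rule sum_norm_le) (use Fl[OF that] in auto)
    also have "\<dots> \<le> B" unfolding B_def by (rule finite_sum_le_infsum[OF sB]) (use C0 in auto)
    finally show ?thesis .
  qed
  have GMlim: "(\<lambda>M. GM M x) \<longlonglongrightarrow> G x" if "\<bar>x\<bar> \<le> 1" for x
    unfolding GM_def by (rule has_sum_int_symmetric(1)[OF hsG[OF that]])
  have [measurable]: "GM M \<in> borel_measurable borel" for M unfolding GM_def by measurable
  have [measurable]: "I \<in> borel_measurable borel" unfolding I_def by measurable
  have IGlim: "(\<lambda>M. I x *\<^sub>R GM M x) \<longlonglongrightarrow> I x *\<^sub>R G x" for x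
    using GMlim[of x] by (cases "x \<in> {0..<1}") (auto simp: I_def)
  have [measurable]: "(\<lambda>x. I x *\<^sub>R G x) \<in> borel_measurable borel"
    by (rule borel_measurable_LIMSEQ_metric[OF _ IGlim]) measurable
  have IGc: "(\<lambda>x. I x *\<^sub>R G x * cis (- (2 * pi * of_int n * x))) \<in> borel_measurable lborel" for n
    by measurable
  have intI: "integrable lborel I" unfolding I_def by simp
  have IGMB: "norm (I x *\<^sub>R GM M x * cis t) \<le> B * I x" for M x t
    using GMB[of x M] by (auto simp: I_def indicator_def norm_mult)
  have IGB: "norm (I x *\<^sub>R G x) \<le> B * I x" for x
    by (rule tendsto_upperbound[OF tendsto_norm[OF IGlim]])
       (use IGMB[of x _ 0] in \<open>auto intro!: always_eventually\<close>)
  have c_eq: "c n = (LBINT x. I x *\<^sub>R G x * cis (- (2 * pi * of_int n * x)))" for n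
  proof (rule LIMSEQ_unique)
    define f where "f = (\<lambda>x. F x * cis (- (2 * pi * of_int n * x)))"
    have [measurable]: "f \<in> borel_measurable borel" unfolding f_def by measurable
    have intf: "integrable lborel f" unfolding f_def by (rule intF)
    show "(\<lambda>M. LBINT x. I x *\<^sub>R GM M x * cis (- (2 * pi * of_int n * x))) \<longlonglongrightarrow>
       (LBINT x. I x *\<^sub>R G x * cis (- (2 * pi * of_int n * x)))"
    proof (rule integral_dominated_convergence[where w = "\<lambda>x. B * I x"])
      show "AE x in lborel. (\<lambda>M. I x *\<^sub>R GM M x * cis (- (2 * pi * of_int n * x))) \<longlonglongrightarrow> I x *\<^sub>R G x * cis (- (2 * pi * of_int n * x))"
        by (intro AE_I2 tendsto_mult IGlim tendsto_const)
      show "AE x in lborel. norm (I x *\<^sub>R GM M x * cis (- (2 * pi * of_int n * x))) \<le> B * I x" for M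
        by (intro AE_I2 IGMB)
      show "(\<lambda>x. I x *\<^sub>R G x * cis (- (2 * pi * of_int n * x))) \<in> borel_measurable lborel"
        by (rule IGc)
      show "(\<lambda>x. I x *\<^sub>R GM M x * cis (- (2 * pi * of_int n * x))) \<in> borel_measurable lborel" for M
        by measurable
    qed (use intI in simp_all)
    have per: "cis (- (2 * pi * of_int n * (x + of_int l))) = cis (- (2 * pi * of_int n * x))" for x :: real and l :: int
    proof -
      have "cis (- (2 * pi * of_int n * (x + of_int l))) = cis (- (2 * pi * of_int n * x)) * cis (2 * pi * of_int (- n * l))"
        unfolding cis_mult by (rule arg_cong[where f = cis]) (simp add: algebra_simps)
      thus ?thesis by (simp only: cis_multiple_2pi[OF Ints_of_int] mult_1_right)
    qed
    have intl: "integrable lborel (\<lambda>x. I (x - of_int l) *\<^sub>R f x)" for l :: int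
      by (rule Bochner_Integration.integrable_bound[OF intf]) (auto simp: I_def indicator_def)
    \<comment> \<open>Unfolding: the translates tile the interval from -M to M, and the half-open
      indicator assigns each x to exactly one block, that of its floor.\<close>
    have "(LBINT x. I x *\<^sub>R GM M x * cis (- (2 * pi * of_int n * x))) =
        (LBINT x. (if \<lfloor>x\<rfloor> \<in> {- int M..<int M} then f x else 0))" for M
    proof -
      have i1: "integrable lborel (\<lambda>x. I x *\<^sub>R f (x + of_int l))" for l :: int
        using lborel_integrable_real_affine[OF intl[of l], of 1 "of_int l"] by (simp add: add.commute)
      have "(LBINT x. I x *\<^sub>R GM M x * cis (- (2 * pi * of_int n * x))) =
         (LBINT x. \<Sum>l\<in>{- int M..<int M}. I x *\<^sub>R f (x + of_int l))"
        unfolding GM_def f_def per by (simp add: sum_distrib_right scaleR_sum_right)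
      also have "\<dots> = (\<Sum>l\<in>{- int M..<int M}. LBINT x. I x *\<^sub>R f (x + of_int l))"
        by (rule Bochner_Integration.integral_sum) (rule i1)
      also have "\<dots> = (\<Sum>l\<in>{- int M..<int M}. LBINT x. I (x - of_int l) *\<^sub>R f x)"
      proof (rule sum.cong[OF refl])
        fix l :: int
        show "(LBINT x. I x *\<^sub>R f (x + of_int l)) = (LBINT x. I (x - of_int l) *\<^sub>R f x)"
          by (subst (2) lborel_integral_real_affine[of 1 _ "of_int l"]) (auto simp: add.commute)
      qed
      also have "\<dots> = (LBINT x. \<Sum>l\<in>{- int M..<int M}. I (x - of_int l) *\<^sub>R f x)"
        by (rule Bochner_Integration.integral_sum[symmetric]) (rule intl)
      also have "\<dots> = (LBINT x. (if \<lfloor>x\<rfloor> \<in> {- int M..<int M} then f x else 0))"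
      proof (rule Bochner_Integration.integral_cong[OF refl])
        fix x
        have "I (x - of_int l) = (if l = \<lfloor>x\<rfloor> then 1 else 0)" for l
          unfolding I_def indicator_def by (auto simp: floor_eq_iff) linarith+
        hence "(\<Sum>l\<in>{- int M..<int M}. I (x - of_int l) *\<^sub>R f x) = (\<Sum>l\<in>{- int M..<int M}. if l = \<lfloor>x\<rfloor> then f x else 0)"
          by (intro sum.cong) auto
        thus "(\<Sum>l\<in>{- int M..<int M}. I (x - of_int l) *\<^sub>R f x) = (if \<lfloor>x\<rfloor> \<in> {- int M..<int M} then f x else 0)"
          by (simp add: sum.delta)
      qed
      finally show ?thesis .
    qed
    moreover have "(\<lambda>M. LBINT x. (if \<lfloor>x\<rfloor> \<in> {- int M..<int M} then f x else 0)) \<longlonglongrightarrow> (LBINT x. f x)"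
    proof (rule integral_dominated_convergence[where w = "\<lambda>x. norm (f x)"])
      show "AE x in lborel. (\<lambda>M. if \<lfloor>x\<rfloor> \<in> {- int M..<int M} then f x else 0) \<longlonglongrightarrow> f x"
      proof (intro AE_I2 tendsto_eventually)
        fix x :: real
        show "\<forall>\<^sub>F M in sequentially. (if \<lfloor>x\<rfloor> \<in> {- int M..<int M} then f x else 0) = f x"
          using eventually_ge_at_top[of "nat \<bar>\<lfloor>x\<rfloor>\<bar> + 1"] by eventually_elim auto
      qed
    qed (use intf in auto)
    ultimately show "(\<lambda>M. LBINT x. I x *\<^sub>R GM M x * cis (- (2 * pi * of_int n * x))) \<longlonglongrightarrow> c n"
      unfolding c_def f_def by simp
  qed
  (* Chernoff's argument: D is bounded because G is Lipschitz, and multiplying the Dirichlet kernel by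
     cis (2 pi x) - 1 telescopes. Instead of the Riemann-Lebesgue lemma it then suffices to average the
     partial sums, since the averaged exponentials tend to 0 pointwise. *)
  define D where "D = (\<lambda>x. I x *\<^sub>R (G x - G 0) / (cis (2 * pi * x) - 1))"
  have [measurable]: "D \<in> borel_measurable borel"
  proof -
    have "D = (\<lambda>x. (I x *\<^sub>R G x - I x *\<^sub>R G 0) / (cis (2 * pi * x) - 1))" by (simp add: D_def scaleR_diff_right)
    thus ?thesis by simp
  qed
  have Dmul: "D x * (cis (2 * pi * x) - 1) = I x *\<^sub>R (G x - G 0)" for x
  proof (cases "x \<in> {0<..<1}")
    case True
    have "pi * min x (1 - x) > 0" using True by simp
    moreover have "pi * min x (1 - x) \<le> norm (cis (2 * pi * x) - 1)"
      using True by (intro norm_cis_minus_one_ge) auto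
    ultimately have "norm (cis (2 * pi * x) - 1) > 0" by linarith
    hence "cis (2 * pi * x) - 1 \<noteq> 0" by simp
    from nonzero_eq_divide_eq[THEN iffD1, OF this refl] show ?thesis unfolding D_def .
  next
    case False
    thus ?thesis by (cases "x = 0") (auto simp: D_def I_def indicator_def)
  qed
  have DB: "norm (D x) \<le> B / pi * I x" for x
  proof (cases "x \<in> {0<..<1}")
    case True
    \<comment> \<open>The distance to the nearer end of the period: the numerator of
      \<open>D\<close> is at most B m and its denominator at least pi m.\<close>
    define m where "m = min x (1 - x)"
    have m: "m > 0" using True by (simp add: m_def)
    have "norm (G x - G 0) \<le> B * m"
      using Glip[of x 0] Glip[of x 1] True G1 by (auto simp: m_def min_def abs_if)
    moreover have "norm (cis (2 * pi * x) - 1) \<ge> pi * m"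
      unfolding m_def using True by (intro norm_cis_minus_one_ge) auto
    ultimately have "norm (G x - G 0) / norm (cis (2 * pi * x) - 1) \<le> (B * m) / (pi * m)"
      using m B0 by (intro frac_le) auto
    thus ?thesis using True m by (simp add: D_def I_def norm_divide)
  next
    case False
    thus ?thesis using B0 by (cases "x = 0") (auto simp: D_def I_def indicator_def)
  qed
  have partial: "(\<Sum>n\<in>{- int M..int M}. c n) - G 0 =
      (LBINT x. D x * (cis (2 * pi * (of_nat M + 1) * x) - cis (- (2 * pi * of_nat M * x))))" for M
  proof -
    have i1: "integrable lborel (\<lambda>x. I x *\<^sub>R G x * cis (- (2 * pi * of_int n * x)))" for n :: int
    proof (rule Bochner_Integration.integrable_bound[where f = "\<lambda>x. B * I x"])
      show "AE x in lborel. norm (I x *\<^sub>R G x * cis (- (2 * pi * of_int n * x))) \<le> norm (B * I x)"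
        using order_trans[OF IGB abs_ge_self] by (intro AE_I2) (simp only: norm_mult norm_cis mult_1_right real_norm_def)
    qed (use intI IGc in simp_all)
    have i2: "integrable lborel (\<lambda>x. I x *\<^sub>R G 0 * cis (- (2 * pi * of_int n * x)))" for n :: int
      by (rule Bochner_Integration.integrable_bound[where f = "\<lambda>x. norm (G 0) * I x"])
         (use intI in \<open>auto simp: norm_mult I_def intro!: AE_I2\<close>)
    have g0: "(LBINT x. I x *\<^sub>R G 0 * cis (- (2 * pi * of_int n * x))) = (if n = 0 then G 0 else 0)" for n :: int
    proof -
      have "(LBINT x. I x *\<^sub>R G 0 * cis (- (2 * pi * of_int n * x))) =
         (LBINT x. G 0 * (indicator {0..<1} x *\<^sub>R cis (2 * pi * of_int (- n) * x)))"
        by (intro Bochner_Integration.integral_cong) (auto simp: I_def)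
      also have "\<dots> = G 0 * (LBINT x. indicator {0..<1} x *\<^sub>R cis (2 * pi * of_int (- n) * x))"
        by (rule integral_mult_right_zero)
      finally show ?thesis unfolding integral_cis_unit_interval by simp
    qed
    have "(\<Sum>n\<in>{- int M..int M}. c n) - G 0 = (\<Sum>n\<in>{- int M..int M}. c n - (if n = 0 then G 0 else 0))"
      by (simp add: sum_subtractf sum.delta)
    also have "\<dots> = (\<Sum>n\<in>{- int M..int M}. LBINT x. I x *\<^sub>R G x * cis (- (2 * pi * of_int n * x)) - I x *\<^sub>R G 0 * cis (- (2 * pi * of_int n * x)))"
      unfolding c_eq g0[symmetric] using i1 i2 by simp
    also have "\<dots> = (LBINT x. \<Sum>n\<in>{- int M..int M}. I x *\<^sub>R G x * cis (- (2 * pi * of_int n * x)) - I x *\<^sub>R G 0 * cis (- (2 * pi * of_int n * x)))"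
      using i1 i2 by (intro Bochner_Integration.integral_sum[symmetric] Bochner_Integration.integrable_diff)
    also have "\<dots> = (LBINT x. D x * (cis (2 * pi * (of_nat M + 1) * x) - cis (- (2 * pi * of_nat M * x))))"
    proof (rule Bochner_Integration.integral_cong[OF refl])
      fix x :: real
      define v where "v = (\<lambda>n::int. cis (- (2 * pi * of_int n * x)))"
      have tel: "(\<Sum>n\<in>{- int M..int M}. v (n - 1) - v n) = v (- int M - 1) - v (int M)" for M :: nat
      proof (induction M)
        case (Suc M)
        have s: "{- int (Suc M)..int (Suc M)} = insert (- int (Suc M)) (insert (int (Suc M)) {- int M..int M})" by auto
        have "(\<Sum>n\<in>{- int (Suc M)..int (Suc M)}. v (n - 1) - v n) =
           (v (- int (Suc M) - 1) - v (- int (Suc M))) + ((v (int (Suc M) - 1) - v (int (Suc M))) + (v (- int M - 1) - v (int M)))"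
          unfolding s Suc.IH[symmetric] by (subst sum.insert, simp, simp, subst sum.insert) simp_all
        moreover have "v (- int (Suc M)) = v (- int M - 1)" "v (int (Suc M) - 1) = v (int M)"
          by (rule arg_cong[where f = v], simp)+
        moreover have "(a - b) + ((c - d) + (b - c)) = a - d" for a b c d :: complex by simp
        ultimately show ?case by (simp only:)
      qed simp
      have vs: "(cis (2 * pi * x) - 1) * v n = v (n - 1) - v n" for n
      proof -
        have "cis (2 * pi * x) * v n = v (n - 1)"
          unfolding v_def cis_mult by (rule arg_cong[where f = cis]) (simp add: algebra_simps)
        thus ?thesis by (simp add: left_diff_distrib)
      qed
      have "v (- int M - 1) = cis (2 * pi * (of_nat M + 1) * x)"
        unfolding v_def by (rule arg_cong[where f = cis]) (simp add: algebra_simps)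
      hence tele: "(\<Sum>n\<in>{- int M..int M}. (cis (2 * pi * x) - 1) * cis (- (2 * pi * of_int n * x))) =
           cis (2 * pi * (of_nat M + 1) * x) - cis (- (2 * pi * of_nat M * x))"
        using tel[of M] unfolding vs[symmetric] by (simp add: v_def)
      have "(\<Sum>n\<in>{- int M..int M}. I x *\<^sub>R G x * cis (- (2 * pi * of_int n * x)) - I x *\<^sub>R G 0 * cis (- (2 * pi * of_int n * x))) =
          (\<Sum>n\<in>{- int M..int M}. D x * ((cis (2 * pi * x) - 1) * cis (- (2 * pi * of_int n * x))))"
      proof (rule sum.cong[OF refl])
        fix n :: int
        have "I x *\<^sub>R G x * cis (- (2 * pi * of_int n * x)) - I x *\<^sub>R G 0 * cis (- (2 * pi * of_int n * x)) =
            (I x *\<^sub>R (G x - G 0)) * cis (- (2 * pi * of_int n * x))"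
          by (simp only: scaleR_diff_right left_diff_distrib)
        also have "\<dots> = D x * ((cis (2 * pi * x) - 1) * cis (- (2 * pi * of_int n * x)))"
          unfolding Dmul[symmetric] by (simp only: mult.assoc)
        finally show "I x *\<^sub>R G x * cis (- (2 * pi * of_int n * x)) - I x *\<^sub>R G 0 * cis (- (2 * pi * of_int n * x)) = \<dots>" .
      qed
      also have "\<dots> = D x * (cis (2 * pi * (of_nat M + 1) * x) - cis (- (2 * pi * of_nat M * x)))"
        unfolding tele[symmetric] by (rule sum_distrib_left[symmetric])
      finally show "(\<Sum>n\<in>{- int M..int M}. I x *\<^sub>R G x * cis (- (2 * pi * of_int n * x)) - I x *\<^sub>R G 0 * cis (- (2 * pi * of_int n * x))) = \<dots>" .
    qed
    finally show ?thesis .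
  qed
  define S where "S = (\<Sum>\<^sub>\<infinity>n. c n)"
  have "(c has_sum S) UNIV" unfolding S_def using c_summable by simp
  from has_sum_int_symmetric(2)[OF this]
  have "(\<lambda>M. (\<Sum>n\<in>{- int M..int M}. c n) - G 0) \<longlonglongrightarrow> S - G 0" by (intro tendsto_intros)
  note lim1 = tendsto_shifted_average[OF this]
  define A where "A = (\<lambda>K x. (\<Sum>j<K. cis (2 * pi * (of_nat (K + j) + 1) * x) - cis (- (2 * pi * of_nat (K + j) * x))) / of_nat K)"
  have iD: "integrable lborel (\<lambda>x. D x * (cis (s * x) - cis (t * x)))" for s t
  proof (rule Bochner_Integration.integrable_bound[where f = "\<lambda>x. 2 * (B / pi * I x)"])
    show "AE x in lborel. norm (D x * (cis (s * x) - cis (t * x))) \<le> norm (2 * (B / pi * I x))"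
    proof (rule AE_I2)
      fix x
      have "norm (D x) * norm (cis (s * x) - cis (t * x)) \<le> (B / pi * I x) * 2"
        by (intro mult_mono DB order_trans[OF norm_triangle_ineq4]) (use B0 in \<open>auto simp: I_def\<close>)
      thus "norm (D x * (cis (s * x) - cis (t * x))) \<le> norm (2 * (B / pi * I x))"
        unfolding norm_mult[of "D x"] real_norm_def by (intro order_trans[OF _ abs_ge_self]) (simp add: mult_ac)
    qed
  qed (use intI in \<open>auto\<close>)
  have avg: "(\<Sum>j<K. (\<Sum>n\<in>{- int (K + j)..int (K + j)}. c n) - G 0) / of_nat K = (LBINT x. D x * A K x)" for K
  proof -
    have "(\<Sum>j<K. (\<Sum>n\<in>{- int (K + j)..int (K + j)}. c n) - G 0) / of_nat K =
      (\<Sum>j<K. LBINT x. D x * (cis (2 * pi * (of_nat (K + j) + 1) * x) - cis (- (2 * pi * of_nat (K + j)) * x))) / of_nat K"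
      unfolding partial by simp
    also have "\<dots> = (LBINT x. (\<Sum>j<K. D x * (cis (2 * pi * (of_nat (K + j) + 1) * x) - cis (- (2 * pi * of_nat (K + j)) * x))) / of_nat K)"
      by (subst Bochner_Integration.integral_sum[symmetric]) (rule iD, simp)
    also have "\<dots> = (LBINT x. D x * A K x)"
      unfolding A_def by (intro Bochner_Integration.integral_cong refl) (simp add: sum_distrib_left)
    finally show ?thesis .
  qed
  have AB: "norm (A K x) \<le> 2" for K x
  proof (cases "K = 0")
    case False
    have "norm (\<Sum>j<K. cis (2 * pi * (of_nat (K + j) + 1) * x) - cis (- (2 * pi * of_nat (K + j) * x))) \<le> (\<Sum>j<K. 2)"
      by (intro sum_norm_le order_trans[OF norm_triangle_ineq4]) simp
    thus ?thesis using False by (simp add: A_def norm_divide divide_le_eq mult.commute)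
  qed (simp add: A_def)
  \<comment> \<open>Inside the period both exponential sums are geometric with ratio different from
    1, hence bounded independently of K, while the average divides by K.\<close>
  have Alim: "(\<lambda>K. A K x) \<longlonglongrightarrow> 0" if x: "x \<in> {0<..<1}" for x
  proof -
    define w where "w = cis (2 * pi * x)"
    have m: "pi * min x (1 - x) > 0" using x by simp
    moreover have "pi * min x (1 - x) \<le> norm (w - 1)"
      unfolding w_def using x by (intro norm_cis_minus_one_ge) auto
    ultimately have "norm (w - 1) > 0" by linarith
    hence w1: "w \<noteq> 1" by auto
    have nw: "norm w = 1" "norm (inverse w) = 1" by (auto simp: w_def)
    have w2: "inverse w \<noteq> 1" using w1 by (metis inverse_1 inverse_inverse_eq)
    define R where "R = 2 / norm (1 - w) + 2 / norm (1 - inverse w)"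
    have geo: "norm (\<Sum>j<K. v ^ j) \<le> 2 / norm (1 - v)" if "v \<noteq> 1" "norm v = 1" for v :: complex and K
    proof -
      have "(\<Sum>j<K. v ^ j) = (1 - v ^ K) / (1 - v)" using that sum_gp_strict[of v K] by simp
      moreover have "norm (1 - v ^ K) \<le> 2"
        using norm_triangle_ineq4[of 1 "v ^ K"] that by (simp add: norm_power)
      ultimately show ?thesis by (simp add: norm_divide divide_right_mono)
    qed
    have bd: "norm (A K x) \<le> R / of_nat K" for K
    proof -
      have e1: "cis (2 * pi * (of_nat (K + j) + 1) * x) = w ^ (K + 1) * w ^ j" for j
        unfolding w_def Complex.DeMoivre cis_mult by (rule arg_cong[where f = cis]) (simp add: algebra_simps)
      have e2: "cis (- (2 * pi * of_nat (K + j) * x)) = inverse w ^ K * inverse w ^ j" for j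
        unfolding w_def cis_inverse Complex.DeMoivre cis_mult
        by (rule arg_cong[where f = cis]) (simp add: algebra_simps)
      have "(\<Sum>j<K. cis (2 * pi * (of_nat (K + j) + 1) * x) - cis (- (2 * pi * of_nat (K + j) * x))) =
         w ^ (K + 1) * (\<Sum>j<K. w ^ j) - inverse w ^ K * (\<Sum>j<K. inverse w ^ j)"
        unfolding e1 e2 sum_subtractf sum_distrib_left ..
      also have "norm \<dots> \<le> 1 * (2 / norm (1 - w)) + 1 * (2 / norm (1 - inverse w))"
        unfolding norm_mult[symmetric]
        by (rule order_trans[OF norm_triangle_ineq4])
           (unfold norm_mult norm_power nw power_one, intro add_mono mult_left_mono geo w1 w2 nw, simp_all)
      finally show ?thesis unfolding A_def norm_divide R_def by (simp add: divide_right_mono)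
    qed
    have "(\<lambda>K. R / of_nat K) \<longlonglongrightarrow> 0" by (rule lim_const_over_n)
    thus ?thesis by (rule Lim_null_comparison[rotated]) (use bd in auto)
  qed
  have "(\<lambda>K. LBINT x. D x * A K x) \<longlonglongrightarrow> (LBINT x::real. 0)"
  proof (rule integral_dominated_convergence[where w = "\<lambda>x. B / pi * I x * 2"])
    show "AE x in lborel. (\<lambda>K. D x * A K x) \<longlonglongrightarrow> 0"
    proof (rule AE_I2)
      fix x
      show "(\<lambda>K. D x * A K x) \<longlonglongrightarrow> 0"
      proof (cases "x \<in> {0<..<1}")
        case True
        from tendsto_mult[OF tendsto_const Alim[OF this]] show ?thesis by simp
      next
        case False
        hence "D x = 0" by (cases "x = 0") (auto simp: D_def I_def indicator_def)
        thus ?thesis by simp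
      qed
    qed
    show "AE x in lborel. norm (D x * A K x) \<le> B / pi * I x * 2" for K
      unfolding norm_mult by (intro AE_I2 mult_mono DB AB) (use B0 in \<open>auto simp: I_def\<close>)
    show "(\<lambda>x. D x * A K x) \<in> borel_measurable lborel" for K
      unfolding A_def by measurable
  qed (use intI in auto)
  hence "(\<lambda>K. (\<Sum>j<K. (\<Sum>n\<in>{- int (K + j)..int (K + j)}. c n) - G 0) / of_nat K) \<longlonglongrightarrow> 0"
    unfolding avg by simp
  from LIMSEQ_unique[OF lim1 this] have "S = G 0" by simp
  thus "(\<Sum>\<^sub>\<infinity>l. F (of_int l)) = (\<Sum>\<^sub>\<infinity>n. c n)" by (simp add: S_def G_def)
qed

section \<open>Ramanujan sums\<close>

lemma ramanujan_sum_eq_cis: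
  "ramanujan_sum b n = (\<Sum>a\<in>totatives n. cis (2 * pi * of_int b * (of_nat a / of_nat n)))"
  unfolding ramanujan_sum_def cis_conv_exp by (intro sum.cong refl arg_cong[where f = exp]) simp

lemma norm_ramanujan_sum_le: "norm (ramanujan_sum b n) \<le> of_nat n"
proof -
  have "norm (ramanujan_sum b n) \<le> (\<Sum>a\<in>totatives n. 1)"
    unfolding ramanujan_sum_eq_cis by (rule sum_norm_le) simp
  also have "\<dots> = of_nat (totient n)" by (simp add: totient_def)
  also have "\<dots> \<le> of_nat n" by (simp add: totient_le)
  finally show ?thesis .
qed

lemma cis_2pi_int_cong:
  assumes "x - y \<in> \<int>"
  shows "cis (2 * pi * x) = cis (2 * pi * y)"
proof -
  have "cis (2 * pi * x) = cis (2 * pi * y) * cis (2 * pi * (x - y))"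
    unfolding cis_mult by (rule arg_cong[where f = cis]) (simp add: algebra_simps)
  thus ?thesis using assms by simp
qed

lemma ramanujan_sum_1 [simp]: "ramanujan_sum b (Suc 0) = 1"
proof -
  have "cis (2 * pi * of_int b) = 1" by (rule cis_multiple_2pi) auto
  thus ?thesis by (simp add: ramanujan_sum_eq_cis)
qed

text \<open>The Chinese remainder theorem in the form (u, v) -> u n + v m, for which the fraction
  with denominator m n splits as u / m + v / n modulo 1. Surjectivity follows by counting, from the
  multiplicativity of the totient.\<close>

lemma ramanujan_sum_mult:
  assumes mn: "coprime m n" "m > 0" "n > 0"
  shows "ramanujan_sum b (m * n) = ramanujan_sum b m * ramanujan_sum b n"
\<comment> \<open>\<open>totatives 1\<close> is {1}, whose representative is not below the modulus;
  modulus 1 is therefore treated separately.\<close>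
proof (cases "m = 1 \<or> n = 1")
  case False
  hence mn1: "m > 1" "n > 1" using mn by auto
  define f where "f = (\<lambda>(u, v). (u * n + v * m) mod (m * n))"
  have inj: "inj_on f (totatives m \<times> totatives n)"
  proof (rule inj_onI, clarify)
    fix u v u' v' assume uv: "u \<in> totatives m" "v \<in> totatives n" "u' \<in> totatives m" "v' \<in> totatives n"
      and eq: "f (u, v) = f (u', v')"
    have c: "[u * n + v * m = u' * n + v' * m] (mod (m * n))" using eq by (simp add: f_def cong_def)
    have "[u * n = u' * n] (mod m)"
      using cong_dvd_modulus_nat[OF c, of m] by (simp add: cong_def)
    hence "[u = u'] (mod m)" using mn(1) by (simp add: cong_mult_rcancel_nat coprime_commute)
    moreover have "[v * m = v' * m] (mod n)"
      using cong_dvd_modulus_nat[OF c, of n] by (simp add: cong_def)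
    hence "[v = v'] (mod n)" using mn(1) by (simp add: cong_mult_rcancel_nat coprime_commute)
    moreover have "u < m" "u' < m" "v < n" "v' < n"
      using uv mn1 totatives_less by blast+
    ultimately show "u = u' \<and> v = v'" by (simp add: cong_def)
  qed
  have sub: "f ` (totatives m \<times> totatives n) \<subseteq> totatives (m * n)"
  proof clarify
    fix u v assume uv: "u \<in> totatives m" "v \<in> totatives n"
    have "coprime (u * n + v * m) m"
    proof (rule coprimeI)
      fix c assume c: "c dvd u * n + v * m" "c dvd m"
      hence "c dvd u * n" by (simp add: dvd_add_left_iff)
      moreover have "coprime (u * n) m" using uv mn(1) by (simp add: totatives_def coprime_commute)
      ultimately show "is_unit c" using c(2) coprime_common_divisor by blast
    qed
    moreover have "coprime (u * n + v * m) n"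
    proof (rule coprimeI)
      fix c assume c: "c dvd u * n + v * m" "c dvd n"
      hence "c dvd v * m" by (simp add: dvd_add_right_iff)
      moreover have "coprime (v * m) n" using uv mn(1) by (simp add: totatives_def)
      ultimately show "is_unit c" using c(2) coprime_common_divisor by blast
    qed
    ultimately have "coprime (u * n + v * m) (m * n)" by simp
    hence cop: "coprime (f (u, v)) (m * n)" unfolding f_def prod.case by (rule iffD2[OF coprime_mod_left_iff, rotated]) (use mn in auto)
    have "f (u, v) \<noteq> 0"
    proof
      assume "f (u, v) = 0"
      with cop have "m * n = 1" by simp
      thus False using mn1 by simp
    qed
    moreover note cop
    moreover have "f (u, v) < m * n" using mn by (simp add: f_def)
    ultimately show "f (u, v) \<in> totatives (m * n)" by (simp add: totatives_def)
  qed
  have "card (f ` (totatives m \<times> totatives n)) = card (totatives (m * n))"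
    using card_image[OF inj] totient_mult_coprime[OF mn(1)] by (simp add: card_cartesian_product totient_def)
  hence img: "f ` (totatives m \<times> totatives n) = totatives (m * n)"
    using card_subset_eq[OF _ sub] by simp
  have "ramanujan_sum b (m * n) = (\<Sum>x\<in>totatives m \<times> totatives n. cis (2 * pi * (of_int b * (of_nat (f x) / of_nat (m * n)))))"
    unfolding ramanujan_sum_eq_cis img[symmetric] by (subst sum.reindex[OF inj]) (simp add: mult.assoc)
  also have "\<dots> = (\<Sum>(u, v)\<in>totatives m \<times> totatives n.
       cis (2 * pi * of_int b * (of_nat u / of_nat m)) * cis (2 * pi * of_int b * (of_nat v / of_nat n)))"
  proof (rule sum.cong[OF refl], clarify)
    fix u v
    define w where "w = u * n + v * m"
    have "real w = real (m * n) * real (w div (m * n)) + real (f (u, v))"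
      unfolding f_def w_def[symmetric] prod.case by (metis mult.commute div_mult_mod_eq of_nat_add of_nat_mult)
    hence "real (f (u, v)) / real (m * n) = real w / real (m * n) - real (w div (m * n))"
      using mn by (simp add: field_simps)
    hence F: "real (f (u, v)) / real (m * n) - real w / real (m * n) = - real (w div (m * n))" by simp
    have "of_int b * (real (f (u, v)) / real (m * n)) - of_int b * (real w / real (m * n)) = of_int (- b * int (w div (m * n)))"
      unfolding right_diff_distrib[symmetric] F by simp
    hence "of_int b * (real (f (u, v)) / real (m * n)) - of_int b * (real w / real (m * n)) \<in> \<int>" by (simp only: Ints_of_int)
    from cis_2pi_int_cong[OF this]
    have "cis (2 * pi * (of_int b * (of_nat (f (u, v)) / of_nat (m * n)))) = cis (2 * pi * (of_int b * (real w / real (m * n))))" .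
    also have "real w / real (m * n) = of_nat u / of_nat m + of_nat v / of_nat n"
      using mn by (simp add: w_def field_simps)
    also have "cis (2 * pi * (of_int b * (of_nat u / of_nat m + of_nat v / of_nat n))) =
       cis (2 * pi * of_int b * (of_nat u / of_nat m)) * cis (2 * pi * of_int b * (of_nat v / of_nat n))"
      by (simp add: cis_mult algebra_simps)
    finally show "cis (2 * pi * (of_int b * (of_nat (f (u, v)) / of_nat (m * n)))) = \<dots>" .
  qed
  also have "\<dots> = ramanujan_sum b m * ramanujan_sum b n"
    unfolding ramanujan_sum_eq_cis sum_product sum.cartesian_product ..
  finally show ?thesis .
qed auto

section \<open>Dirichlet series of Ramanujan sums and their Euler factors\<close>

definition ramanujan_term :: "int \<Rightarrow> complex \<Rightarrow> nat \<Rightarrow> complex" where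
  "ramanujan_term b s m = ramanujan_sum b m * of_nat m powr (- s)"

lemma of_nat_mult_powr: "of_nat (m * n) powr s = (of_nat m powr s * of_nat n powr s :: complex)"
  using powr_times_real_left[of "of_nat m" "of_nat n" s] by simp

lemma ramanujan_term_mult:
  assumes "coprime m n" "m > 0" "n > 0"
  shows "ramanujan_term b s (m * n) = ramanujan_term b s m * ramanujan_term b s n"
  unfolding ramanujan_term_def ramanujan_sum_mult[OF assms] of_nat_mult_powr by simp

lemma norm_ramanujan_term_le: "m > 0 \<Longrightarrow> norm (ramanujan_term b s m) \<le> of_nat m powr (1 - Re s)"
proof -
  assume m: "m > 0"
  have "norm (ramanujan_term b s m) \<le> of_nat m * of_nat m powr (- Re s)"
    unfolding ramanujan_term_def norm_mult using norm_ramanujan_sum_le m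
    by (intro mult_mono) (auto simp: norm_powr_real_powr)
  thus ?thesis using m by (simp add: powr_diff powr_minus divide_inverse)
qed

lemma summable_on_nat_powr:
  assumes "r < -1"
  shows "(\<lambda>m::nat. of_nat m powr r :: real) summable_on A"
proof -
  have "(\<lambda>m::nat. of_nat m powr r :: real) summable_on UNIV"
    using assms by (intro summable_nonneg_imp_summable_on) (auto simp: summable_real_powr_iff)
  thus ?thesis by (rule summable_on_subset) simp
qed

lemma summable_ramanujan_term:
  assumes "2 < Re s" "A \<subseteq> {1..}"
  shows "(\<lambda>m. norm (ramanujan_term b s m)) summable_on A"
  by (rule summable_on_comparison_test[OF summable_on_nat_powr[of "1 - Re s"]])
     (use assms norm_ramanujan_term_le in \<open>auto simp: subset_iff Suc_le_eq\<close>)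

lemma ramanujan_term_prime_power:
  assumes "p > 0"
  shows "ramanujan_term b s (p ^ j) = ramanujan_sum b (p ^ j) * of_nat p powr (- (of_nat j * s))"
proof -
  have "of_nat (p ^ j) powr (- s) = (of_nat p powr (- (of_nat j * s)) :: complex)"
  proof (induction j)
    case (Suc j)
    have "of_nat (p ^ Suc j) powr (- s) = (of_nat p powr (- s) * of_nat (p ^ j) powr (- s) :: complex)"
      unfolding power_Suc by (rule of_nat_mult_powr)
    also have "\<dots> = of_nat p powr (- s + - (of_nat j * s))" unfolding Suc powr_add ..
    finally show ?case by (simp add: algebra_simps)
  qed (use assms in auto)
  thus ?thesis by (simp add: ramanujan_term_def)
qed

definition local_factor :: "int \<Rightarrow> complex \<Rightarrow> nat \<Rightarrow> complex" where
  "local_factor b s p = (\<Sum>\<^sub>\<infinity>j. ramanujan_term b s (p ^ j))"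

text \<open>The trivial bound on Ramanujan sums suffices, as \<open>p powr (1 - Re s) < 1/2\<close>. This guarantees that the
  quotient by \<open>ramanujan_L_local\<close> is not a division by zero.\<close>
lemma local_factor_nonzero:
  assumes "2 < Re s" "p \<ge> 2"
  shows "local_factor b s p \<noteq> 0"
proof -
  define x where "x = of_nat p powr (1 - Re s)"
  have "x \<le> 2 powr (1 - Re s)" unfolding x_def using assms by (intro powr_mono2') auto
  also have "\<dots> < 2 powr (-1)" using assms by (intro powr_less_mono) auto
  finally have x: "x < 1/2" by (simp add: powr_minus)
  have x0: "x > 0" using assms by (simp add: x_def)
  have pj: "of_nat (p ^ j) powr (1 - Re s) = x ^ j" for j
    unfolding x_def using assms by (simp add: powr_powr powr_realpow[symmetric] mult.commute)
  have hs: "((\<lambda>j. x ^ j) has_sum (x / (1 - x))) {1..}"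
    using has_sum_geometric_from_1[of x] x x0 by simp
  have bd: "norm (ramanujan_term b s (p ^ j)) \<le> x ^ j" for j
    using norm_ramanujan_term_le[of "p ^ j" b s] assms unfolding pj by simp
  have sn: "(\<lambda>j. norm (ramanujan_term b s (p ^ j))) summable_on {1..}"
    by (rule summable_on_comparison_test[OF has_sum_imp_summable[OF hs]]) (use bd in auto)
  have s: "(\<lambda>j. ramanujan_term b s (p ^ j)) summable_on {1..}"
    by (rule abs_summable_summable[OF sn])
  have U: "UNIV = insert 0 {1::nat..}" by auto
  have "local_factor b s p = ramanujan_term b s (p ^ 0) + (\<Sum>\<^sub>\<infinity>j\<in>{1..}. ramanujan_term b s (p ^ j))"
    unfolding local_factor_def U by (rule infsum_insert[OF s]) auto
  also have "ramanujan_term b s (p ^ 0) = 1" by (simp add: ramanujan_term_def)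
  finally have eq: "local_factor b s p = 1 + (\<Sum>\<^sub>\<infinity>j\<in>{1..}. ramanujan_term b s (p ^ j))" .
  have "norm (\<Sum>\<^sub>\<infinity>j\<in>{1..}. ramanujan_term b s (p ^ j)) \<le> x / (1 - x)"
    by (rule norm_infsum_le[OF has_sum_infsum[OF s] hs bd])
  also have "\<dots> < 1" using x x0 by (simp add: divide_less_eq)
  finally have "norm (\<Sum>\<^sub>\<infinity>j\<in>{1..}. ramanujan_term b s (p ^ j)) < 1" .
  thus ?thesis unfolding eq by (metis add.inverse_inverse add_eq_0_iff norm_minus_cancel norm_one less_irrefl)
qed

definition prime_to :: "nat set \<Rightarrow> nat set" where
  "prime_to P = {m. m \<ge> 1 \<and> (\<forall>p\<in>P. \<not> p dvd m)}"

lemma not_dvd_multiplicity_quotient: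
  fixes n p :: nat
  assumes "n \<noteq> 0" "\<not> is_unit p" "p \<noteq> 0"
  shows "\<not> p dvd n div p ^ multiplicity p n"
proof -
  obtain y where y: "n = p ^ multiplicity p n * y" "\<not> p dvd y"
    using multiplicity_decompose'[OF assms(1,2)] by blast
  have "n div p ^ multiplicity p n = y"
    using nonzero_mult_div_cancel_left[of "p ^ multiplicity p n" y] assms(3) unfolding y(1)[symmetric] by simp
  thus ?thesis using y(2) by simp
qed

text \<open>Every n splits uniquely into its p-part and a cofactor prime to p; the primes in
  \<open>P\<close> differ from p and so do not see the p-part.\<close>

lemma bij_betw_prime_to:
  assumes "prime p" "p \<notin> P" "\<And>r. r \<in> P \<Longrightarrow> prime r"
  shows "bij_betw (\<lambda>(j, m). p ^ j * m) (UNIV \<times> prime_to (insert p P)) (prime_to P)"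
proof (rule bij_betwI[where g = "\<lambda>n. (multiplicity p n, n div p ^ multiplicity p n)"])
  have p0: "p \<noteq> 0" "\<not> is_unit p" using assms(1) by auto
  show "(\<lambda>(j, m). p ^ j * m) \<in> UNIV \<times> prime_to (insert p P) \<rightarrow> prime_to P"
  proof safe
    fix j m assume m: "m \<in> prime_to (insert p P)"
    show "p ^ j * m \<in> prime_to P"
      unfolding prime_to_def
    proof (intro CollectI conjI ballI)
      show "1 \<le> p ^ j * m" using m p0 by (simp add: prime_to_def Suc_le_eq)
      fix r assume r: "r \<in> P"
      have "\<not> r dvd p ^ j" using assms r by (metis prime_dvd_power primes_dvd_imp_eq)
      thus "\<not> r dvd p ^ j * m" using m r assms(3) by (auto simp: prime_to_def prime_dvd_mult_iff)
    qed
  qed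
  show "(\<lambda>n. (multiplicity p n, n div p ^ multiplicity p n)) \<in> prime_to P \<rightarrow> UNIV \<times> prime_to (insert p P)"
  proof safe
    fix n assume n: "n \<in> prime_to P"
    hence n0: "n \<noteq> 0" by (auto simp: prime_to_def)
    have d: "n = p ^ multiplicity p n * (n div p ^ multiplicity p n)"
      by (rule dvd_mult_div_cancel[OF multiplicity_dvd, symmetric])
    show "n div p ^ multiplicity p n \<in> prime_to (insert p P)"
      unfolding prime_to_def
    proof (intro CollectI conjI ballI)
      have "n div p ^ multiplicity p n \<noteq> 0"
      proof
        assume z: "n div p ^ multiplicity p n = 0"
        show False using d[unfolded z] n0 by simp
      qed
      thus "1 \<le> n div p ^ multiplicity p n" by simp
      fix r assume "r \<in> insert p P"
      thus "\<not> r dvd n div p ^ multiplicity p n"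
      proof
        assume "r = p" thus ?thesis using not_dvd_multiplicity_quotient[OF n0 p0(2,1)] by simp
      next
        assume "r \<in> P"
        hence "\<not> r dvd n" using n by (auto simp: prime_to_def)
        moreover have "n div p ^ multiplicity p n dvd n"
          by (rule dvdI[where k = "p ^ multiplicity p n"]) (subst mult.commute, rule d)
        ultimately show ?thesis using dvd_trans by blast
      qed
    qed
  qed auto
  show "(\<lambda>n. (multiplicity p n, n div p ^ multiplicity p n)) ((\<lambda>(j, m). p ^ j * m) x) = x"
    if x: "x \<in> UNIV \<times> prime_to (insert p P)" for x
  proof -
    obtain j m where [simp]: "x = (j, m)" by (cases x)
    have "m \<noteq> 0" "\<not> p dvd m" using x by (auto simp: prime_to_def)
    hence "multiplicity p (p ^ j * m) = j"
      using assms(1) p0 by (subst prime_elem_multiplicity_mult_distrib) (auto simp: not_dvd_imp_multiplicity_0)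
    thus ?thesis using p0 by simp
  qed
  show "(\<lambda>(j, m). p ^ j * m) ((\<lambda>n. (multiplicity p n, n div p ^ multiplicity p n)) n) = n" for n
    unfolding prod.case by (rule dvd_mult_div_cancel[OF multiplicity_dvd])
qed

text \<open>Multiplicativity turns the sum over pairs of a power of p and a cofactor into a product;
  absolute convergence justifies the rearrangement.\<close>

lemma infsum_prime_to_insert:
  assumes "2 < Re s" "prime p" "p \<notin> P" "\<And>r. r \<in> P \<Longrightarrow> prime r"
  shows "(\<Sum>\<^sub>\<infinity>m\<in>prime_to P. ramanujan_term b s m) =
           local_factor b s p * (\<Sum>\<^sub>\<infinity>m\<in>prime_to (insert p P). ramanujan_term b s m)"
proof -
  have sub: "prime_to Q \<subseteq> {1..}" for Q by (auto simp: prime_to_def)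
  have bij: "bij_betw (\<lambda>(j, m). p ^ j * m) (UNIV \<times> prime_to (insert p P)) (prime_to P)"
    by (rule bij_betw_prime_to) (use assms in auto)
  have m: "ramanujan_term b s (p ^ j * m) = ramanujan_term b s (p ^ j) * ramanujan_term b s m" if "m \<in> prime_to (insert p P)" for j m
  proof (rule ramanujan_term_mult)
    have "\<not> p dvd m" using that by (simp add: prime_to_def)
    hence "coprime p m" using assms(2) by (simp add: prime_imp_coprime)
    thus "coprime (p ^ j) m" by simp
  qed (use that assms(2) in \<open>auto simp: prime_to_def prime_gt_0_nat\<close>)
  have "(\<lambda>x. ramanujan_term b s ((\<lambda>(j, m). p ^ j * m) x)) summable_on (UNIV \<times> prime_to (insert p P))"
    by (rule summable_on_reindex_bij_betw[OF bij, THEN iffD2,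
          OF abs_summable_summable[OF summable_ramanujan_term[OF assms(1) sub]]])
  hence sum: "(\<lambda>(j, m). ramanujan_term b s (p ^ j) * ramanujan_term b s m) summable_on (UNIV \<times> prime_to (insert p P))"
    by (subst summable_on_cong[where g = "\<lambda>x. ramanujan_term b s ((\<lambda>(j, m). p ^ j * m) x)"]) (auto simp: m)
  have "(\<Sum>\<^sub>\<infinity>m\<in>prime_to P. ramanujan_term b s m) =
     (\<Sum>\<^sub>\<infinity>x\<in>UNIV \<times> prime_to (insert p P). ramanujan_term b s ((\<lambda>(j, m). p ^ j * m) x))"
    by (rule infsum_reindex_bij_betw[OF bij, symmetric])
  also have "\<dots> = (\<Sum>\<^sub>\<infinity>(j, m)\<in>UNIV \<times> prime_to (insert p P). ramanujan_term b s (p ^ j) * ramanujan_term b s m)"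
    by (rule infsum_cong) (auto simp: m)
  also have "\<dots> = (\<Sum>\<^sub>\<infinity>j\<in>UNIV. \<Sum>\<^sub>\<infinity>m\<in>prime_to (insert p P). ramanujan_term b s (p ^ j) * ramanujan_term b s m)"
    by (rule infsum_Sigma'_banach[OF sum, symmetric])
  also have "\<dots> = local_factor b s p * (\<Sum>\<^sub>\<infinity>m\<in>prime_to (insert p P). ramanujan_term b s m)"
    unfolding infsum_cmult_right' local_factor_def infsum_cmult_left' ..
  finally show ?thesis .
qed

text \<open>Only the Euler factors at the finite set \<open>P\<close> are split off, one prime at a
  time, so that no infinite product has to converge.\<close>

lemma ramanujan_euler:
  assumes "2 < Re s" "finite P" "\<And>r. r \<in> P \<Longrightarrow> prime r"
  shows "(\<Sum>\<^sub>\<infinity>m\<in>{1..}. ramanujan_term b s m) =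
           (\<Prod>p\<in>P. local_factor b s p) * (\<Sum>\<^sub>\<infinity>m\<in>prime_to P. ramanujan_term b s m)"
  using assms(2,3)
proof (induction P rule: finite_induct)
  case empty
  have "prime_to {} = {1..}" by (auto simp: prime_to_def)
  thus ?case by simp
next
  case (insert p P)
  have "(\<Sum>\<^sub>\<infinity>m\<in>{1..}. ramanujan_term b s m) = (\<Prod>p\<in>P. local_factor b s p) * (\<Sum>\<^sub>\<infinity>m\<in>prime_to P. ramanujan_term b s m)"
    using insert by blast
  also have "(\<Sum>\<^sub>\<infinity>m\<in>prime_to P. ramanujan_term b s m) =
     local_factor b s p * (\<Sum>\<^sub>\<infinity>m\<in>prime_to (insert p P). ramanujan_term b s m)"
    using insert by (intro infsum_prime_to_insert assms(1)) auto
  finally show ?case using insert by (simp add: mult_ac)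
qed

lemma ramanujan_L_quotient:
  assumes "2 < Re s" "N > 0"
  shows "ramanujan_L 1 b s / ramanujan_L_local N b s = (\<Sum>\<^sub>\<infinity>m\<in>{m. m \<ge> 1 \<and> coprime m N}. ramanujan_term b s m)"
proof -
  have A: "{m. m \<ge> 1 \<and> coprime m N} = prime_to (prime_factors N)"
  proof (rule Set.set_eqI)
    fix m
    have "coprime m N \<longleftrightarrow> (\<forall>p\<in>prime_factors N. \<not> p dvd m)" if "m \<ge> 1"
    proof
      assume "coprime m N"
      thus "\<forall>p\<in>prime_factors N. \<not> p dvd m"
        by (metis coprime_common_divisor in_prime_factors_iff not_prime_unit)
    next
      assume *: "\<forall>p\<in>prime_factors N. \<not> p dvd m"
      show "coprime m N"
      proof (rule ccontr)
        assume "\<not> coprime m N"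
        then obtain p where "prime p" "p dvd m" "p dvd N"
          by (metis coprime_iff_gcd_eq_1 gcd_dvd1 gcd_dvd2 dvd_trans prime_factor_nat)
        thus False using * assms(2) by (auto simp: in_prime_factors_iff)
      qed
    qed
    thus "m \<in> {m. m \<ge> 1 \<and> coprime m N} \<longleftrightarrow> m \<in> prime_to (prime_factors N)" by (auto simp: prime_to_def)
  qed
  have loc: "ramanujan_L_local N b s = (\<Prod>p\<in>prime_factors N. local_factor b s p)"
    unfolding ramanujan_L_local_def local_factor_def
    by (intro prod.cong refl infsum_cong ramanujan_term_prime_power[symmetric]) (auto simp: in_prime_factors_iff prime_gt_0_nat)
  have nz: "(\<Prod>p\<in>prime_factors N. local_factor b s p) \<noteq> 0"
    using local_factor_nonzero[OF assms(1)] by (auto simp: in_prime_factors_iff prime_ge_2_nat)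
  have L: "ramanujan_L 1 b s = (\<Sum>\<^sub>\<infinity>m\<in>{1..}. ramanujan_term b s m)"
    by (simp add: ramanujan_L_def ramanujan_term_def)
  have E: "ramanujan_L 1 b s = (\<Prod>p\<in>prime_factors N. local_factor b s p) * (\<Sum>\<^sub>\<infinity>m\<in>prime_to (prime_factors N). ramanujan_term b s m)"
    unfolding L by (rule ramanujan_euler[OF assms(1)]) (auto simp: in_prime_factors_iff)
  show ?thesis unfolding loc A E using nz by simp
qed

text \<open>The series over moduli divisible by N is the one that arises on the L side; the
  reindexing m -> N m costs the power of N.\<close>

lemma ramanujan_L_multiples:
  assumes "N > 0"
  shows "of_nat N powr (- s) * ramanujan_L N b s = (\<Sum>\<^sub>\<infinity>m\<in>(\<lambda>m. N * m) ` {1..}. ramanujan_term b s m)"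
proof -
  have "(\<Sum>\<^sub>\<infinity>m\<in>(\<lambda>m. N * m) ` {1..}. ramanujan_term b s m) = (\<Sum>\<^sub>\<infinity>m\<in>{1..}. ramanujan_term b s (N * m))"
    by (subst infsum_reindex) (use assms in \<open>auto simp: inj_on_def o_def\<close>)
  also have "\<dots> = (\<Sum>\<^sub>\<infinity>m\<in>{1..}. of_nat N powr (- s) * (ramanujan_sum b (N * m) * of_nat m powr (- s)))"
    unfolding ramanujan_term_def of_nat_mult_powr by (simp add: mult_ac)
  finally show ?thesis unfolding ramanujan_L_def infsum_cmult_right' ..
qed

section \<open>Lattice sums\<close>

lemma mixed_power_scale:
  assumes "r > 0"
  shows "mixed_power a b (of_real r * w) = of_real r powr (- (a + b)) * mixed_power a b w"
proof -
  have 1: "(of_real r * w) powr c = of_real r powr c * w powr c" for c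
    using assms by (intro powr_times_real_left) auto
  have 2: "of_real (cmod (of_real r * w)) powr c = of_real r powr c * of_real (cmod w) powr c" for c :: complex
    unfolding norm_mult using assms by (simp add: powr_times_real_left)
  have 3: "(of_real r :: complex) powr (- (a + b)) = of_real r powr (- (a - b)) * of_real r powr (- 2 * b)"
    unfolding powr_add[symmetric] by (rule arg_cong[where f = "\<lambda>t. of_real r powr t"]) simp
  show ?thesis unfolding mixed_power_def 1 2 3 by (simp only: mult_ac)
qed

lemma mixed_power_minus:
  assumes "a - b = of_int k" "even k"
  shows "mixed_power a b (- w) = mixed_power a b w"
proof (cases "w = 0")
  case False
  have "- (a - b) = of_int (- k)" using assms by simp
  moreover have "(- w) powr of_int (- k) = w powr of_int (- k)"
    using False assms(2) by (subst (1 2) complex_powr_of_int) (auto simp: power_int_minus_left)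
  ultimately show ?thesis by (simp add: mixed_power_def)
qed simp

lemma norm_mixed_power:
  assumes "a - b = of_int k" "w \<noteq> 0"
  shows "norm (mixed_power a b w) = norm w powr (- Re (a + b))"
proof -
  have "- (a - b) = complex_of_real (of_int (- k))" using assms by simp
  hence "norm (w powr (- (a - b))) = norm w powr (- of_int k)"
    using norm_powr_real_powr'[of "of_real (of_int (- k))" w] by simp
  moreover have "norm (of_real (cmod w) powr (- 2 * b)) = norm w powr (- 2 * Re b)"
    using assms by (subst norm_powr_real_powr) auto
  moreover have kk: "of_int k = Re a - Re b" using arg_cong[OF assms(1), of Re] by simp
  moreover have "norm w powr (- of_int k) * norm w powr (- 2 * Re b) = norm w powr (- of_int k + - 2 * Re b)"
    by (rule powr_add[symmetric])
  moreover have "- of_int k + - 2 * Re b = - Re (a + b)" using kk by simp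
  ultimately show ?thesis unfolding mixed_power_def norm_mult by (simp only:)
qed

text \<open>Write x + iy = i (y - ix). The integer power contributes i^(-k), and the modulus splits
  by |w|^2 = (y - ix) (y + ix). The logarithms of these two factors add without a branch correction
  because the factors are conjugate in the right half-plane.\<close>

lemma mixed_power_eq_kern:
  assumes "a - b = of_int k" "even k" "y > 0"
  shows "mixed_power a b (Complex x y) = (-1) powi (k div 2) * kern a b y x"
proof -
  define u where "u = Complex y (- x)"
  have u0: "u \<noteq> 0" "Complex y x \<noteq> 0" using assms(3) by (auto simp: u_def complex_eq_iff)
  have w: "Complex x y = \<i> * u" by (simp add: u_def complex_eq_iff)
  have k: "- (a - b) = of_int (- k)" using assms by simp
  obtain j where j: "k = 2 * j" using assms(2) by (elim evenE)
  have "\<i> powi (- k) = (\<i> powi 2) powi (- j)" unfolding j power_int_mult[symmetric] by simp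
  also have "\<dots> = (-1) powi (k div 2)" by (simp add: j power_int_minus flip: power_int_inverse)
  finally have ik: "\<i> powi (- k) = (-1) powi (k div 2)" .
  have p1: "Complex x y powr (- (a - b)) = (-1) powi (k div 2) * u powr (- (a - b))"
    unfolding w k using u0 by (subst (1 2) complex_powr_of_int) (auto simp: power_int_mult_distrib ik[symmetric])
  have "u = cnj (Complex y x)" by (simp add: u_def complex_eq_iff)
  hence "Ln u = cnj (Ln (Complex y x))"
    using assms(3) by (simp only:) (rule cnj_Ln[symmetric], auto simp: complex_nonpos_Reals_iff)
  hence "Ln u + Ln (Complex y x) = of_real (2 * Re (Ln (Complex y x)))"
    by (simp add: complex_eq_iff)
  also have "Re (Ln (Complex y x)) = ln (cmod (Complex y x))" using u0 by simp
  also have "cmod (Complex y x) = cmod (Complex x y)" by (simp add: cmod_def add.commute)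
  finally have L: "Ln u + Ln (Complex y x) = 2 * of_real (ln (cmod (Complex x y)))" by simp
  have c0: "cmod (Complex x y) > 0" using assms(3) by (simp add: complex_eq_iff)
  hence "Ln (of_real (cmod (Complex x y))) = of_real (ln (cmod (Complex x y)))" by (rule Ln_of_real)
  hence "of_real (cmod (Complex x y)) powr (- 2 * b) = exp (- b * (Ln u + Ln (Complex y x)))"
    unfolding L using c0 by (simp add: powr_def mult_ac)
  also have "\<dots> = u powr (- b) * Complex y x powr (- b)"
    using u0 by (simp add: powr_def exp_add[symmetric] algebra_simps)
  finally have p2: "of_real (cmod (Complex x y)) powr (- 2 * b) = u powr (- b) * Complex y x powr (- b)" .
  have "u powr (- (a - b)) * u powr (- b) = u powr (- a)" by (simp add: powr_add[symmetric])
  thus ?thesis unfolding mixed_power_def p1 p2 kern_def u_def[symmetric] by (simp add: mult.assoc[symmetric])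
qed

section \<open>Poisson summation along a row of the lattice\<close>

lemma kft_lattice_bound:
  assumes "y > 0" "2 \<le> Re (a + b)"
  obtains K where "\<And>n::int. norm (kft a b y (2 * pi * of_int n)) \<le> K / (1 + (of_int n)\<^sup>2)"
proof -
  have y: "0 < min 1 y" "min 1 y \<le> 1" "min 1 y \<le> y" using assms by auto
  obtain C1 where C1: "\<And>y' \<xi>. min 1 y \<le> y' \<Longrightarrow> norm (kft a b y' \<xi>) \<le> C1"
    using kft_bound[OF y(1,2) assms(2)] by metis
  obtain C2 where C2: "\<And>\<xi>. norm (of_real \<xi> ^ 2 * kft a b y \<xi>) \<le> C2" using kft_square_decay[OF assms] by metis
  show ?thesis
  proof (rule that)
    fix n :: int
    define \<xi> where "\<xi> = 2 * pi * of_int n"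
    have "1 * \<bar>real_of_int n\<bar> \<le> (2 * pi) * \<bar>real_of_int n\<bar>" using pi_gt3 by (intro mult_right_mono) auto
    hence "\<bar>real_of_int n\<bar> \<le> \<bar>\<xi>\<bar>" by (simp add: \<xi>_def abs_mult)
    hence "(of_int n)\<^sup>2 \<le> \<xi>\<^sup>2" by (simp add: abs_le_square_iff)
    hence "(1 + (of_int n)\<^sup>2) * norm (kft a b y \<xi>) \<le> (1 + \<xi>\<^sup>2) * norm (kft a b y \<xi>)"
      by (intro mult_right_mono) auto
    also have "\<dots> \<le> C1 + C2" using C1[OF y(3), of \<xi>] C2[of \<xi>] by (simp add: norm_mult norm_power distrib_right)
    finally have "norm (kft a b y \<xi>) * (1 + (of_int n)\<^sup>2) \<le> C1 + C2" by (simp add: mult.commute)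
    moreover have "1 + (real_of_int n)\<^sup>2 > 0" by (simp add: add_pos_nonneg)
    ultimately show "norm (kft a b y (2 * pi * of_int n)) \<le> (C1 + C2) / (1 + (of_int n)\<^sup>2)"
      unfolding \<xi>_def[symmetric] by (subst pos_le_divide_eq)
  qed
qed

lemma summable_kft_lattice:
  assumes "y > 0" "2 \<le> Re (a + b)"
  shows "(\<lambda>n::int. norm (kft a b y (2 * pi * of_int n))) summable_on A"
proof -
  obtain K where K: "\<And>n::int. norm (kft a b y (2 * pi * of_int n)) \<le> K / (1 + (of_int n)\<^sup>2)"
    using kft_lattice_bound[OF assms] by metis
  have "(\<lambda>n::int. norm (kft a b y (2 * pi * of_int n))) summable_on UNIV"
    by (rule summable_on_comparison_test[OF summable_on_int_inv_square[of K]]) (use K in auto)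
  thus ?thesis by (rule summable_on_subset) simp
qed

text \<open>The decay of the translated kernel is centred at -X; this moves it to the origin at the
  cost of a constant depending only on X. The difference of the two sides is a sum of
  squares.\<close>

lemma one_plus_square_shift: "1 + x\<^sup>2 \<le> (2 + 2 * X\<^sup>2) * (1 + (X + x)\<^sup>2)" for x X :: real
proof -
  have "(2 + 2 * X\<^sup>2) * (1 + (X + x)\<^sup>2) - (1 + x\<^sup>2) = 1 + (x + 2 * X)\<^sup>2 + 2 * (X * (X + x))\<^sup>2"
    by (simp add: power2_eq_square algebra_simps)
  also have "\<dots> \<ge> 0" by simp
  finally show ?thesis by simp
qed

lemma kern_poisson:
  assumes "y > 0" "2 \<le> Re (a + b)"
  shows "(\<lambda>l::int. kern a b y (X + of_int l)) summable_on UNIV"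
    and "(\<Sum>\<^sub>\<infinity>l::int. kern a b y (X + of_int l)) = (\<Sum>\<^sub>\<infinity>n::int. kft a b y (2 * pi * of_int n) * cis (2 * pi * of_int n * X))"
proof -
  define F where "F = (\<lambda>x. kern a b y (X + x))"
  define F' where "F' = (\<lambda>x. \<i> * a * kern (a+1) b y (X + x) - \<i> * b * kern a (b+1) y (X + x))"
  define c where "c = (\<lambda>n::int. kft a b y (2 * pi * of_int n) * cis (2 * pi * of_int n * X))"
  define m where "m = min 1 y"
  have m: "0 < m" "m \<le> 1" "m \<le> y" using assms by (auto simp: m_def)
  define B where "B = (\<lambda>a b. exp (pi * (\<bar>Im a\<bar> + \<bar>Im b\<bar>)) * m powr (- Re (a + b)))"
  have B: "norm (kern a' b' y x) \<le> B a' b' / (1 + x\<^sup>2)" if "2 \<le> Re (a' + b')" for a' b' x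
    unfolding B_def by (rule norm_kern_le[OF m that])
  have B0: "B a' b' \<ge> 0" for a' b' by (simp add: B_def)
  \<comment> \<open>One constant for the kernel and for its derivative, since
    \<open>poisson_summation\<close> asks for the same majorant of both.\<close>
  define C0 where "C0 = B a b + norm a * B (a+1) b + norm b * B a (b+1)"
  have C0: "C0 \<ge> 0" "B a b \<le> C0" "norm a * B (a+1) b + norm b * B a (b+1) \<le> C0" using B0 by (auto simp: C0_def)
  have shift: "t / (1 + (X + x)\<^sup>2) \<le> C0 * (2 + 2 * X\<^sup>2) / (1 + x\<^sup>2)" if "t \<le> C0" for t x
  proof -
    have p: "1 + (X + x)\<^sup>2 > 0" "1 + x\<^sup>2 > 0" by (simp_all add: add_pos_nonneg)
    have "t / (1 + (X + x)\<^sup>2) \<le> C0 / (1 + (X + x)\<^sup>2)" using that p by (intro divide_right_mono) auto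
    also have "\<dots> \<le> C0 * ((2 + 2 * X\<^sup>2) / (1 + x\<^sup>2))"
    proof -
      have "1 / (1 + (X + x)\<^sup>2) \<le> (2 + 2 * X\<^sup>2) / (1 + x\<^sup>2)"
        using one_plus_square_shift[of x X] p by (simp add: divide_le_eq pos_le_divide_eq)
      from mult_left_mono[OF this C0(1)] show ?thesis by simp
    qed
    finally show ?thesis by simp
  qed
  have der: "(F has_vector_derivative F' x) (at x)" for x
  proof -
    have "((\<lambda>x. X + x) has_vector_derivative 1) (at x)"
      unfolding has_real_derivative_iff_has_vector_derivative[symmetric] by (auto intro!: derivative_eq_intros)
    from vector_diff_chain_at[OF this kern_has_vector_derivative_snd[OF assms(1)]]
    show ?thesis unfolding F_def F'_def by (simp add: o_def)
  qed
  have bF: "norm (F x) \<le> C0 * (2 + 2 * X\<^sup>2) / (1 + x\<^sup>2)" for x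
    unfolding F_def by (rule order_trans[OF B[OF assms(2)] shift[OF C0(2)]])
  have bF': "norm (F' x) \<le> C0 * (2 + 2 * X\<^sup>2) / (1 + x\<^sup>2)" for x
  proof -
    have "norm (F' x) \<le> norm a * norm (kern (a+1) b y (X + x)) + norm b * norm (kern a (b+1) y (X + x))"
      unfolding F'_def by (rule order_trans[OF norm_triangle_ineq4]) (simp add: norm_mult)
    also have "\<dots> \<le> norm a * (B (a+1) b / (1 + (X + x)\<^sup>2)) + norm b * (B a (b+1) / (1 + (X + x)\<^sup>2))"
      using assms(2) by (intro add_mono mult_left_mono B) auto
    also have "\<dots> = (norm a * B (a+1) b + norm b * B a (b+1)) / (1 + (X + x)\<^sup>2)" by (simp add: add_divide_distrib)
    also have "\<dots> \<le> C0 * (2 + 2 * X\<^sup>2) / (1 + x\<^sup>2)" by (rule shift[OF C0(3)])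
    finally show ?thesis .
  qed
  have c: "c n = (LBINT x. F x * cis (- (2 * pi * of_int n * x)))" for n
  proof -
    have "kft a b y (2 * pi * of_int n) = (LBINT x. kern a b y (X + x) * cis (- (2 * pi * of_int n * (X + x))))"
      unfolding kft_def by (subst lborel_integral_real_affine[of 1 _ X]) auto
    also have "\<dots> = (LBINT x. cis (- (2 * pi * of_int n * X)) * (F x * cis (- (2 * pi * of_int n * x))))"
    proof (rule Bochner_Integration.integral_cong[OF refl])
      fix x
      have "cis (- (2 * pi * of_int n * (X + x))) = cis (- (2 * pi * of_int n * X)) * cis (- (2 * pi * of_int n * x))"
        unfolding cis_mult by (rule arg_cong[where f = cis]) (simp add: algebra_simps)
      thus "kern a b y (X + x) * cis (- (2 * pi * of_int n * (X + x))) = cis (- (2 * pi * of_int n * X)) * (F x * cis (- (2 * pi * of_int n * x)))"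
        by (simp add: F_def)
    qed
    also have "\<dots> = cis (- (2 * pi * of_int n * X)) * (LBINT x. F x * cis (- (2 * pi * of_int n * x)))"
      by (rule integral_mult_right_zero)
    finally show ?thesis by (simp add: c_def cis_mult)
  qed
  have "c summable_on UNIV"
    by (rule abs_summable_summable) (use summable_kft_lattice[OF assms] in \<open>simp add: c_def norm_mult\<close>)
  note * = poisson_summation[of F F' "C0 * (2 + 2 * X\<^sup>2)" c, OF der bF bF' c this]
  show "(\<lambda>l::int. kern a b y (X + of_int l)) summable_on UNIV" using *(1) by (simp add: F_def)
  show "(\<Sum>\<^sub>\<infinity>l::int. kern a b y (X + of_int l)) = (\<Sum>\<^sub>\<infinity>n::int. kft a b y (2 * pi * of_int n) * cis (2 * pi * of_int n * X))"
    using *(2) by (simp add: F_def c_def)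
qed

lemma mixed_power_poisson:
  assumes "a - b = of_int k" "even k" "2 \<le> Re (a + b)" "Im \<tau> > 0"
  shows "(\<lambda>l::int. mixed_power a b (\<tau> + of_int l)) summable_on UNIV"
    and "(\<Sum>\<^sub>\<infinity>l::int. mixed_power a b (\<tau> + of_int l)) =
       (-1) powi (k div 2) * (\<Sum>\<^sub>\<infinity>n::int. kft a b (Im \<tau>) (2 * pi * of_int n) * cis (2 * pi * of_int n * Re \<tau>))"
proof -
  have e: "mixed_power a b (\<tau> + of_int l) = (-1) powi (k div 2) * kern a b (Im \<tau>) (Re \<tau> + of_int l)" for l :: int
  proof -
    have "\<tau> + of_int l = Complex (Re \<tau> + of_int l) (Im \<tau>)" by (simp add: complex_eq_iff)
    thus ?thesis using mixed_power_eq_kern[OF assms(1,2,4)] by simp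
  qed
  show "(\<lambda>l::int. mixed_power a b (\<tau> + of_int l)) summable_on UNIV"
    unfolding e by (intro summable_on_cmult_right kern_poisson assms)
  show "(\<Sum>\<^sub>\<infinity>l::int. mixed_power a b (\<tau> + of_int l)) =
       (-1) powi (k div 2) * (\<Sum>\<^sub>\<infinity>n::int. kft a b (Im \<tau>) (2 * pi * of_int n) * cis (2 * pi * of_int n * Re \<tau>))"
    unfolding e infsum_cmult_right' kern_poisson(2)[OF assms(4,3)] ..
qed

section \<open>Absolute convergence over the lattice\<close>

text \<open>The imaginary part of m \<tau> + n controls m. As for n, either |n| is at least 2 |m
  \<tau>| and survives the subtraction, or it is bounded by a multiple of |m|.\<close>

lemma lattice_norm_lower_bound:
  assumes "Im \<tau> > 0"
  obtains c where "c > 0" "\<And>m n :: int. c * max \<bar>of_int m\<bar> \<bar>of_int n\<bar> \<le> norm (of_int m * \<tau> + of_int n)"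
proof -
  define c where "c = min (1/2) (min (Im \<tau>) (Im \<tau> / (2 * norm \<tau>)))"
  have t: "norm \<tau> > 0" using assms by auto
  have c: "c > 0" "c \<le> 1/2" "c \<le> Im \<tau>" "c \<le> Im \<tau> / (2 * norm \<tau>)" using assms t by (auto simp: c_def)
  have "c * max \<bar>of_int m\<bar> \<bar>of_int n\<bar> \<le> norm (of_int m * \<tau> + of_int n)" for m n :: int
  proof -
    define w where "w = of_int m * \<tau> + of_int n"
    have im: "\<bar>of_int m\<bar> * Im \<tau> \<le> norm w"
      using abs_Im_le_cmod[of w] assms by (simp add: w_def abs_mult)
    have 1: "c * \<bar>of_int m\<bar> \<le> norm w"
      using mult_right_mono[OF c(3), of "\<bar>of_int m\<bar>"] im by (simp add: mult.commute)
    have 2: "c * \<bar>of_int n\<bar> \<le> norm w"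
    proof (cases "\<bar>of_int n\<bar> \<ge> 2 * (\<bar>of_int m\<bar> * norm \<tau>)")
      case True
      have "\<bar>of_int n\<bar> = norm (w - of_int m * \<tau>)" by (simp add: w_def)
      also have "\<dots> \<le> norm w + \<bar>of_int m\<bar> * norm \<tau>" using norm_triangle_ineq4[of w "of_int m * \<tau>"] by (simp add: norm_mult)
      finally have "1/2 * \<bar>of_int n\<bar> \<le> norm w" using True by simp
      moreover have "c * \<bar>of_int n\<bar> \<le> 1/2 * \<bar>of_int n\<bar>" using c(2) by (rule mult_right_mono) simp
      ultimately show ?thesis by linarith
    next
      case False
      have "c * \<bar>of_int n\<bar> \<le> Im \<tau> / (2 * norm \<tau>) * (2 * (\<bar>of_int m\<bar> * norm \<tau>))"
        using False c assms t by (intro mult_mono) auto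
      also have "\<dots> = \<bar>of_int m\<bar> * Im \<tau>" using t by simp
      finally show ?thesis using im by linarith
    qed
    show ?thesis using 1 2 c(1) unfolding w_def by (simp add: max_def)
  qed
  with c(1) show ?thesis by (rule that)
qed

lemma summable_on_int_powr:
  assumes "s < -1"
  shows "(\<lambda>m::int. (1 + \<bar>of_int m\<bar>) powr s :: real) summable_on UNIV"
proof -
  have "summable (\<lambda>n. real (Suc n) powr s)"
    using assms by (subst summable_Suc_iff) (simp add: summable_real_powr_iff)
  hence 1: "(\<lambda>n::nat. (1 + real n) powr s) summable_on UNIV"
    by (intro summable_nonneg_imp_summable_on) (auto simp: add.commute)
  show ?thesis
    by (rule summable_on_int_if_nat) (use 1 in simp_all)
qed

lemma summable_on_product_nonneg:
  fixes f :: "'a \<Rightarrow> real" and g :: "'b \<Rightarrow> real"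
  assumes "f summable_on A" "g summable_on B" "\<And>x. x \<in> A \<Longrightarrow> f x \<ge> 0" "\<And>y. y \<in> B \<Longrightarrow> g y \<ge> 0"
  shows "(\<lambda>(x, y). f x * g y) summable_on (A \<times> B)"
proof (rule summable_on_SigmaI)
  show "((\<lambda>y. (\<lambda>(x, y). f x * g y) (x, y)) has_sum (f x * infsum g B)) B" for x
    using has_sum_cmult_right[OF has_sum_infsum[OF assms(2)]] by simp
  show "(\<lambda>x. f x * infsum g B) summable_on A" by (rule summable_on_cmult_left[OF assms(1)])
qed (use assms in auto)

text \<open>Off the origin, 2 max (|m|, |n|) is at least 1 + |m| and at least 1 + |n|. Giving half
  of the exponent to each variable yields a product of two series with exponent Re (a + b) / 2 >
  1.\<close>

lemma summable_mixed_power_lattice: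
  assumes "a - b = of_int k" "2 < Re (a + b)" "Im \<tau> > 0" "S \<subseteq> UNIV - {(0, 0)}"
  shows "(\<lambda>(m, n). norm (mixed_power a b (of_int m * \<tau> + of_int n))) summable_on (S :: (int \<times> int) set)"
proof -
  obtain c where c: "c > 0" "\<And>m n :: int. c * max \<bar>of_int m\<bar> \<bar>of_int n\<bar> \<le> norm (of_int m * \<tau> + of_int n)"
    using lattice_norm_lower_bound[OF assms(3)] by metis
  define r where "r = Re (a + b)"
  have r: "r > 2" using assms by (simp add: r_def)
  define g where "g = (\<lambda>m::int. (1 + \<bar>of_int m\<bar>) powr (- r / 2) :: real)"
  have g: "g summable_on UNIV" unfolding g_def using r by (intro summable_on_int_powr) simp
  have "(\<lambda>(m, n). g m * g n) summable_on (UNIV \<times> UNIV)"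
    by (rule summable_on_product_nonneg[OF g g]) (auto simp: g_def)
  hence "(\<lambda>x. (c / 2) powr (- r) * (\<lambda>(m, n). g m * g n) x) summable_on (UNIV \<times> UNIV)"
    by (rule summable_on_cmult_right)
  hence "(\<lambda>x. (c / 2) powr (- r) * (\<lambda>(m, n). g m * g n) x) summable_on S"
    by (rule summable_on_subset) simp
  thus ?thesis
  proof (rule summable_on_comparison_test)
    fix x assume "x \<in> S"
    moreover obtain m n where x: "x = (m, n)" by (cases x)
    ultimately have mn: "(m, n) \<noteq> (0, 0)" using assms(4) by auto
    define M where "M = max \<bar>real_of_int m\<bar> \<bar>real_of_int n\<bar>"
    have M: "M \<ge> 1" using mn by (auto simp: M_def max_def)
    define w where "w = of_int m * \<tau> + of_int n"
    have cM: "c * M > 0" using c M by simp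
    hence w: "norm w \<ge> c * M" "w \<noteq> 0" using c(2)[of m n] by (auto simp: w_def M_def)
    have "norm (mixed_power a b w) = norm w powr (- r)" unfolding r_def by (rule norm_mixed_power[OF assms(1) w(2)])
    also have "\<dots> \<le> (c * M) powr (- r)" using w cM r by (intro powr_mono2') auto
    also have "c * M = (c / 2) * (2 * M)" by simp
    also have "\<dots> powr (- r) = (c / 2) powr (- r) * (2 * M) powr (- r)" by (rule powr_mult)
    also have "(2 * M) powr (- r) = (2 * M) powr (- r / 2) * (2 * M) powr (- r / 2)" by (simp add: powr_add[symmetric])
    also have "\<dots> \<le> g m * g n"
      unfolding g_def using M r by (intro mult_mono powr_mono2') (auto simp: M_def)
    finally have "norm (mixed_power a b w) \<le> (c / 2) powr (- r) * (g m * g n)" by (simp add: mult_left_mono)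
    thus "(\<lambda>(m, n). norm (mixed_power a b (of_int m * \<tau> + of_int n))) x \<le> (c / 2) powr (- r) * (\<lambda>(m, n). g m * g n) x"
      by (simp add: x w_def)
  qed auto
qed

section \<open>Primitive rows and Ramanujan sums\<close>

lemma infsum_finite_sum:
  fixes f :: "'a \<Rightarrow> 'b \<Rightarrow> complex"
  assumes "finite A" "\<And>a. a \<in> A \<Longrightarrow> f a summable_on B"
  shows "(\<Sum>\<^sub>\<infinity>x\<in>B. \<Sum>a\<in>A. f a x) = (\<Sum>a\<in>A. infsum (f a) B)"
proof -
  have "((\<lambda>x. \<Sum>a\<in>A. f a x) has_sum (\<Sum>a\<in>A. infsum (f a) B)) B"
    using assms by (induction A rule: finite_induct) (auto intro!: has_sum_add)
  thus ?thesis by (rule infsumI)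
qed

lemma bij_betw_coprime_residues:
  assumes "m \<ge> 1"
  shows "bij_betw (\<lambda>(a, l). int a + int m * l) (totatives m \<times> UNIV) {n. coprime (int m) n}"
proof (rule bij_betwI')
  fix x y assume xy: "x \<in> totatives m \<times> (UNIV :: int set)" "y \<in> totatives m \<times> (UNIV :: int set)"
  obtain a l a' l' where [simp]: "x = (a, l)" "y = (a', l')" by (cases x, cases y)
  have a: "0 < a" "a \<le> m" "0 < a'" "a' \<le> m" using xy by (auto simp: totatives_def)
  show "((\<lambda>(a, l). int a + int m * l) x = (\<lambda>(a, l). int a + int m * l) y) = (x = y)"
  proof
    assume eq: "(\<lambda>(a, l). int a + int m * l) x = (\<lambda>(a, l). int a + int m * l) y"
    hence "int a - int a' = int m * (l' - l)" by (simp add: algebra_simps)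
    hence "int m dvd int a - int a'" by simp
    moreover have "\<bar>int a - int a'\<bar> < int m" using a by linarith
    ultimately have "int a - int a' = 0" using dvd_imp_le_int[of "int a - int a'" "int m"] by linarith
    thus "x = y" using eq assms by simp
  qed auto
next
  fix x assume "x \<in> totatives m \<times> (UNIV :: int set)"
  then obtain a l where x: "x = (a, l)" "coprime a m" by (cases x) (auto simp: totatives_def)
  have "coprime (int m) (int a + int m * l)"
  proof (rule coprimeI)
    fix c assume c: "c dvd int m" "c dvd int a + int m * l"
    hence "c dvd int a" by (simp add: dvd_add_left_iff)
    moreover have "coprime (int a) (int m)" using x(2) by simp
    ultimately show "is_unit c" using c(1) coprime_common_divisor by blast
  qed
  thus "(\<lambda>(a, l). int a + int m * l) x \<in> {n. coprime (int m) n}" by (simp add: x(1))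
next
  fix n assume n: "n \<in> {n. coprime (int m) n}"
  show "\<exists>x\<in>totatives m \<times> UNIV. n = (\<lambda>(a, l). int a + int m * l) x"
  proof (cases "m = 1")
    case True
    \<comment> \<open>For m = 1 the only representative is 1 and not 0, hence the shift to n -
      1.\<close>
    thus ?thesis by (intro bexI[of _ "(1, n - 1)"]) auto
  next
    case False
    define a where "a = nat (n mod int m)"
    have ia: "int a = n mod int m" using assms by (simp add: a_def)
    have "coprime (int a) (int m)" unfolding ia using n assms by (simp add: coprime_commute)
    hence c: "coprime a m" by simp
    moreover have "a \<noteq> 0" using c False by (intro notI) simp
    moreover have "int a < int m" unfolding ia using assms by simp
    ultimately have "a \<in> totatives m" by (simp add: totatives_def)
    moreover have "n = int a + int m * (n div int m)" unfolding ia by simp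
    ultimately show ?thesis by (intro bexI[of _ "(a, n div int m)"]) auto
  qed
qed

text \<open>Each residue class of \<open>n\<close> modulo \<open>m\<close> is a translate of \<open>m\<close> times the integers, and the
  classes recombine to a Ramanujan sum.\<close>
lemma mixed_power_row:
  assumes "a - b = of_int k" "even k" "2 < Re (a + b)" "Im \<tau> > 0" "m \<ge> 1"
  shows "(\<Sum>\<^sub>\<infinity>n\<in>{n. coprime (int m) n}. mixed_power a b (of_nat m * \<tau> + of_int n)) =
     (-1) powi (k div 2) * (\<Sum>\<^sub>\<infinity>n::int. kft a b (Im \<tau>) (2 * pi * of_int n) * cis (2 * pi * of_int n * Re \<tau>) * ramanujan_term n (a + b) m)"
proof -
  define K where "K = (\<lambda>n::int. kft a b (Im \<tau>) (2 * pi * of_int n))"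
  define f where "f = (\<lambda>n. mixed_power a b (of_nat m * \<tau> + of_int n))"
  define M where "M = (of_nat m powr (- (a + b)) :: complex)"
  have q: "2 \<le> Re (a + b)" using assms by simp
  have m: "m > 0" using assms by simp
  \<comment> \<open>Homogeneity turns the step m into a step 1 and moves the residue class into the
    translation of \<tau> by u / m.\<close>
  have fe: "f (int u + int m * l) = M * mixed_power a b (\<tau> + of_real (of_nat u / of_nat m) + of_int l)" for u l
  proof -
    have "of_nat m * \<tau> + of_int (int u + int m * l) = of_real (of_nat m) * (\<tau> + of_real (of_nat u / of_nat m) + of_int l)"
      using m by (simp add: field_simps)
    thus ?thesis unfolding f_def M_def using mixed_power_scale[of "of_nat m" a b] m by simp
  qed
  have hs: "((\<lambda>l. f (int u + int m * l)) has_sum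
       M * ((-1) powi (k div 2) * (\<Sum>\<^sub>\<infinity>n::int. K n * cis (2 * pi * of_int n * (Re \<tau> + of_nat u / of_nat m))))) UNIV" for u
    unfolding fe using mixed_power_poisson[OF assms(1,2) q, of "\<tau> + of_real (of_nat u / of_nat m)"] assms(4)
    by (intro has_sum_cmult_right) (simp add: has_sum_iff K_def)
  have inner: "(\<Sum>\<^sub>\<infinity>n::int. K n * cis (2 * pi * of_int n * (Re \<tau> + of_nat u / of_nat m))) =
     (\<Sum>\<^sub>\<infinity>n::int. K n * cis (2 * pi * of_int n * Re \<tau>) * cis (2 * pi * of_int n * (of_nat u / of_nat m)))" for u
  proof (rule infsum_cong)
    fix n :: int
    have "cis (2 * pi * of_int n * (Re \<tau> + of_nat u / of_nat m)) = cis (2 * pi * of_int n * Re \<tau>) * cis (2 * pi * of_int n * (of_nat u / of_nat m))"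
      unfolding cis_mult by (rule arg_cong[where f = cis]) (simp add: algebra_simps)
    thus "K n * cis (2 * pi * of_int n * (Re \<tau> + of_nat u / of_nat m)) = K n * cis (2 * pi * of_int n * Re \<tau>) * cis (2 * pi * of_int n * (of_nat u / of_nat m))"
      by simp
  qed
  have sK: "(\<lambda>n. K n * cis (2 * pi * of_int n * Re \<tau>) * cis (2 * pi * of_int n * t)) summable_on UNIV" for t
    by (rule abs_summable_summable) (use summable_kft_lattice[OF assms(4) q] in \<open>simp add: K_def norm_mult\<close>)
  have sf: "f summable_on {n. coprime (int m) n}"
  proof -
    have "(\<lambda>(m, n). norm (mixed_power a b (of_int m * \<tau> + of_int n))) summable_on (Pair (int m) ` {n. coprime (int m) n})"
      using m by (intro summable_mixed_power_lattice[OF assms(1,3,4)]) auto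
    hence "(\<lambda>n. norm (f n)) summable_on {n. coprime (int m) n}"
      by (subst (asm) summable_on_reindex) (auto simp: o_def f_def inj_on_def)
    thus ?thesis by (rule abs_summable_summable)
  qed
  note bij = bij_betw_coprime_residues[OF assms(5)]
  have "(\<lambda>x. f ((\<lambda>(a, l). int a + int m * l) x)) summable_on (totatives m \<times> UNIV)"
    by (rule summable_on_reindex_bij_betw[OF bij, THEN iffD2, OF sf])
  hence s2: "(\<lambda>(u, l). f (int u + int m * l)) summable_on (totatives m \<times> UNIV)"
    by (simp add: case_prod_unfold)
  have "infsum f {n. coprime (int m) n} = (\<Sum>\<^sub>\<infinity>x\<in>totatives m \<times> UNIV. f ((\<lambda>(a, l). int a + int m * l) x))"
    by (rule infsum_reindex_bij_betw[OF bij, symmetric])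
  also have "\<dots> = (\<Sum>\<^sub>\<infinity>(u, l)\<in>totatives m \<times> UNIV. f (int u + int m * l))" by (simp add: case_prod_unfold)
  also have "\<dots> = (\<Sum>\<^sub>\<infinity>u\<in>totatives m. \<Sum>\<^sub>\<infinity>l. f (int u + int m * l))"
    by (rule infsum_Sigma'_banach[OF s2, symmetric])
  also have "\<dots> = (\<Sum>u\<in>totatives m. M * ((-1) powi (k div 2) *
       (\<Sum>\<^sub>\<infinity>n::int. K n * cis (2 * pi * of_int n * Re \<tau>) * cis (2 * pi * of_int n * (of_nat u / of_nat m)))))"
    unfolding infsumI[OF hs] inner by simp
  also have "\<dots> = M * ((-1) powi (k div 2) * (\<Sum>u\<in>totatives m.
       (\<Sum>\<^sub>\<infinity>n::int. K n * cis (2 * pi * of_int n * Re \<tau>) * cis (2 * pi * of_int n * (of_nat u / of_nat m)))))"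
    by (simp only: sum_distrib_left)
  also have "(\<Sum>u\<in>totatives m. (\<Sum>\<^sub>\<infinity>n::int. K n * cis (2 * pi * of_int n * Re \<tau>) * cis (2 * pi * of_int n * (of_nat u / of_nat m)))) =
     (\<Sum>\<^sub>\<infinity>n::int. \<Sum>u\<in>totatives m. K n * cis (2 * pi * of_int n * Re \<tau>) * cis (2 * pi * of_int n * (of_nat u / of_nat m)))"
    by (rule infsum_finite_sum[symmetric]) (rule finite_totatives, rule sK)
  also have "\<dots> = (\<Sum>\<^sub>\<infinity>n::int. K n * cis (2 * pi * of_int n * Re \<tau>) * ramanujan_sum n m)"
    unfolding ramanujan_sum_eq_cis sum_distrib_left ..
  also have "M * ((-1) powi (k div 2) * \<dots>) = (-1) powi (k div 2) * (\<Sum>\<^sub>\<infinity>n::int. M * (K n * cis (2 * pi * of_int n * Re \<tau>) * ramanujan_sum n m))"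
    unfolding infsum_cmult_right' by (simp only: mult_ac)
  finally show ?thesis unfolding f_def K_def M_def ramanujan_term_def by (simp only: mult_ac)
qed

text \<open>The bound m for the Ramanujan sum is uniform in the frequency, so the majorant separates
  into a power of m and the summable values of the transform.\<close>

lemma summable_kft_ramanujan:
  assumes "2 < Re (a + b)" "y > 0" "A \<subseteq> {1..}" "\<And>n. norm (e n) \<le> 1"
  shows "(\<lambda>(m, n). kft a b y (2 * pi * of_int n) * e n * ramanujan_term n (a + b) m) summable_on (A \<times> (UNIV :: int set))"
proof (rule abs_summable_summable)
  have q: "2 \<le> Re (a + b)" using assms by simp
  have "(\<lambda>(m, n). (of_nat m powr (1 - Re (a + b))) * norm (kft a b y (2 * pi * of_int n))) summable_on (A \<times> (UNIV :: int set))"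
    by (rule summable_on_product_nonneg[OF summable_on_nat_powr summable_kft_lattice[OF assms(2) q]]) (use assms in auto)
  thus "(\<lambda>x. norm ((\<lambda>(m, n). kft a b y (2 * pi * of_int n) * e n * ramanujan_term n (a + b) m) x)) summable_on (A \<times> (UNIV :: int set))"
  proof (rule summable_on_comparison_test)
    fix x assume "x \<in> A \<times> (UNIV :: int set)"
    then obtain m n where x: "x = (m, n)" "m \<ge> 1" using assms(3) by (cases x) auto
    have "norm (kft a b y (2 * pi * of_int n)) * norm (e n) * norm (ramanujan_term n (a + b) m) \<le>
       norm (kft a b y (2 * pi * of_int n)) * 1 * (of_nat m powr (1 - Re (a + b)))"
      using norm_ramanujan_term_le[of m n "a + b"] x(2) assms(4) by (intro mult_mono) auto
    thus "norm ((\<lambda>(m, n). kft a b y (2 * pi * of_int n) * e n * ramanujan_term n (a + b) m) x) \<le>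
      (\<lambda>(m, n). (of_nat m powr (1 - Re (a + b))) * norm (kft a b y (2 * pi * of_int n))) x"
      by (simp add: x(1) norm_mult mult.commute)
  qed simp
qed

text \<open>The set \<open>A\<close> of row indices stays arbitrary: the multiples of N and the
  integers prime to N are the two instances. Exchanging rows and frequencies collects the Ramanujan
  sums into a Dirichlet series.\<close>

lemma mixed_power_coprime_sum:
  assumes "a - b = of_int k" "even k" "2 < Re (a + b)" "Im \<tau> > 0" "A \<subseteq> {1..}"
  defines "R \<equiv> \<lambda>n. \<Sum>\<^sub>\<infinity>m\<in>A. ramanujan_term n (a + b) m"
  shows "(\<lambda>n::int. kft a b (Im \<tau>) (2 * pi * of_int n) * cis (2 * pi * of_int n * Re \<tau>) * R n) summable_on UNIV"
    and "(\<Sum>\<^sub>\<infinity>(m, n)\<in>(SIGMA m:A. {n. coprime (int m) n}). mixed_power a b (of_nat m * \<tau> + of_int n)) =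
       (-1) powi (k div 2) * (\<Sum>\<^sub>\<infinity>n::int. kft a b (Im \<tau>) (2 * pi * of_int n) * cis (2 * pi * of_int n * Re \<tau>) * R n)"
proof -
  define K where "K = (\<lambda>n::int. kft a b (Im \<tau>) (2 * pi * of_int n) * cis (2 * pi * of_int n * Re \<tau>))"
  have sum: "(\<lambda>(m, n). K n * ramanujan_term n (a + b) m) summable_on (A \<times> UNIV)"
    unfolding K_def by (rule summable_kft_ramanujan[OF assms(3,4,5)]) simp
  hence sum': "(\<lambda>(n, m). K n * ramanujan_term n (a + b) m) summable_on (UNIV \<times> A)"
    by (subst (asm) summable_on_swap) (simp add: case_prod_unfold)
  have KR: "(\<Sum>\<^sub>\<infinity>m\<in>A. K n * ramanujan_term n (a + b) m) = K n * R n" for n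
    unfolding R_def by (rule infsum_cmult_right')
  show "(\<lambda>n::int. kft a b (Im \<tau>) (2 * pi * of_int n) * cis (2 * pi * of_int n * Re \<tau>) * R n) summable_on UNIV"
    using summable_on_Sigma_banach[OF sum'] unfolding KR by (simp add: K_def)
  have s1: "(\<lambda>(m, n). mixed_power a b (of_nat m * \<tau> + of_int n)) summable_on (SIGMA m:A. {n. coprime (int m) n})"
  proof (rule abs_summable_summable)
    have "(\<lambda>(m, n). norm (mixed_power a b (of_int m * \<tau> + of_int n))) summable_on (map_prod int id ` (SIGMA m:A. {n. coprime (int m) n}))"
      using assms(5) by (intro summable_mixed_power_lattice[OF assms(1,3,4)]) auto
    thus "(\<lambda>x. norm ((\<lambda>(m, n). mixed_power a b (of_nat m * \<tau> + of_int n)) x)) summable_on (SIGMA m:A. {n. coprime (int m) n})"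
      by (subst (asm) summable_on_reindex) (auto simp: o_def case_prod_unfold inj_on_def)
  qed
  have "(\<Sum>\<^sub>\<infinity>(m, n)\<in>(SIGMA m:A. {n. coprime (int m) n}). mixed_power a b (of_nat m * \<tau> + of_int n)) =
     (\<Sum>\<^sub>\<infinity>m\<in>A. \<Sum>\<^sub>\<infinity>n\<in>{n. coprime (int m) n}. mixed_power a b (of_nat m * \<tau> + of_int n))"
    by (rule infsum_Sigma'_banach[OF s1, symmetric])
  also have "\<dots> = (\<Sum>\<^sub>\<infinity>m\<in>A. (-1) powi (k div 2) * (\<Sum>\<^sub>\<infinity>n::int. K n * ramanujan_term n (a + b) m))"
    unfolding K_def by (rule infsum_cong, rule mixed_power_row[OF assms(1-4)]) (use assms(5) in auto)
  also have "\<dots> = (-1) powi (k div 2) * (\<Sum>\<^sub>\<infinity>m\<in>A. \<Sum>\<^sub>\<infinity>n::int. K n * ramanujan_term n (a + b) m)"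
    by (rule infsum_cmult_right')
  also have "(\<Sum>\<^sub>\<infinity>m\<in>A. \<Sum>\<^sub>\<infinity>n::int. K n * ramanujan_term n (a + b) m) = (\<Sum>\<^sub>\<infinity>n. \<Sum>\<^sub>\<infinity>m\<in>A. K n * ramanujan_term n (a + b) m)"
    by (rule infsum_swap_banach[OF sum])
  finally show "(\<Sum>\<^sub>\<infinity>(m, n)\<in>(SIGMA m:A. {n. coprime (int m) n}). mixed_power a b (of_nat m * \<tau> + of_int n)) =
       (-1) powi (k div 2) * (\<Sum>\<^sub>\<infinity>n::int. kft a b (Im \<tau>) (2 * pi * of_int n) * cis (2 * pi * of_int n * Re \<tau>) * R n)"
    unfolding KR by (simp add: K_def)
qed

text \<open>Splitting off the greatest common divisor \<open>t\<close>; the sum over \<open>t\<close> is the zeta factor.\<close>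
lemma infsum_homogeneous_cone:
  fixes f :: "int \<times> int \<Rightarrow> complex"
  assumes bij: "bij_betw (\<lambda>(t, m, n). (int t * m, int t * n)) ({1..} \<times> S) I"
    and hom: "\<And>t m n. t \<ge> 1 \<Longrightarrow> f (int t * m, int t * n) = of_nat t powr (- q) * f (m, n)"
    and sum: "f summable_on I"
  shows "infsum f I = zeta q * infsum f S"
proof -
  have "(\<lambda>x. f ((\<lambda>(t, m, n). (int t * m, int t * n)) x)) summable_on ({1..} \<times> S)"
    by (rule summable_on_reindex_bij_betw[OF bij, THEN iffD2, OF sum])
  hence s: "(\<lambda>(t, x). of_nat t powr (- q) * f x) summable_on ({1..} \<times> S)"
    by (subst summable_on_cong[where g = "\<lambda>x. f ((\<lambda>(t, m, n). (int t * m, int t * n)) x)"]) (auto simp: hom)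
  have "infsum f I = (\<Sum>\<^sub>\<infinity>x\<in>{1..} \<times> S. f ((\<lambda>(t, m, n). (int t * m, int t * n)) x))"
    by (rule infsum_reindex_bij_betw[OF bij, symmetric])
  also have "\<dots> = (\<Sum>\<^sub>\<infinity>(t, x)\<in>{1..} \<times> S. of_nat t powr (- q) * f x)"
    by (rule infsum_cong) (auto simp: hom)
  also have "\<dots> = (\<Sum>\<^sub>\<infinity>t\<in>{1..}. \<Sum>\<^sub>\<infinity>x\<in>S. of_nat t powr (- q) * f x)"
    by (rule infsum_Sigma'_banach[OF s, symmetric])
  also have "\<dots> = zeta q * infsum f S"
    unfolding infsum_cmult_right' infsum_cmult_left' zeta_def ..
  finally show ?thesis .
qed

text \<open>The two multipliers \<open>c\<close> and \<open>d\<close> cover both index sets at once.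
  Since the gcd scales with t, the image pair recovers t as its gcd and thereby the primitive
  part.\<close>

lemma bij_betw_gcd_cone:
  fixes c d :: int
  shows "bij_betw (\<lambda>(t, m, n). (int t * m, int t * n)) ({1..} \<times> {(m, n). gcd (c * m) (d * n) = 1})
           (\<Union>t\<in>{1..}. {(m, n). t dvd m \<and> t dvd n \<and> gcd (c * m) (d * n) = t})"
proof -
  have g: "gcd (c * (t * m)) (d * (t * n)) = \<bar>t\<bar> * gcd (c * m) (d * n)" for t m n
    using gcd_mult_distrib_int[of t "c * m" "d * n"] by (simp add: mult_ac)
  show ?thesis
  proof (rule bij_betwI')
    fix x y assume "x \<in> {1::nat..} \<times> {(m, n). gcd (c * m) (d * n) = 1}" "y \<in> {1::nat..} \<times> {(m, n). gcd (c * m) (d * n) = 1}"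
    then obtain t m n t' m' n' where [simp]: "x = (t, m, n)" "y = (t', m', n')"
      and h: "t \<ge> 1" "t' \<ge> 1" "gcd (c * m) (d * n) = 1" "gcd (c * m') (d * n') = 1"
      by (cases x, cases y) auto
    show "((\<lambda>(t, m, n). (int t * m, int t * n)) x = (\<lambda>(t, m, n). (int t * m, int t * n)) y) = (x = y)"
    proof
      assume "(\<lambda>(t, m, n). (int t * m, int t * n)) x = (\<lambda>(t, m, n). (int t * m, int t * n)) y"
      hence e: "int t * m = int t' * m'" "int t * n = int t' * n'" by simp_all
      have "int t = gcd (c * (int t * m)) (d * (int t * n))" unfolding g h by simp
      also have "\<dots> = int t'" unfolding e g h by simp
      finally have "t = t'" by simp
      thus "x = y" using e h by simp
    qed simp
  next
    fix x assume "x \<in> {1::nat..} \<times> {(m, n). gcd (c * m) (d * n) = 1}"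
    then obtain t m n where [simp]: "x = (t, m, n)" and h: "t \<ge> 1" "gcd (c * m) (d * n) = 1" by (cases x) auto
    have "gcd (c * (int t * m)) (d * (int t * n)) = int t" unfolding g h by simp
    thus "(\<lambda>(t, m, n). (int t * m, int t * n)) x \<in> (\<Union>t\<in>{1..}. {(m, n). t dvd m \<and> t dvd n \<and> gcd (c * m) (d * n) = t})"
      using h by (auto intro!: bexI[of _ "int t"])
  next
    fix y assume "y \<in> (\<Union>t\<in>{1..}. {(m, n). t dvd m \<and> t dvd n \<and> gcd (c * m) (d * n) = t})"
    then obtain t m n where y: "y = (m, n)" and t: "t \<ge> 1" "t dvd m" "t dvd n" "gcd (c * m) (d * n) = t" by auto
    from t obtain m' n' where mn: "m = t * m'" "n = t * n'" by (auto elim!: dvdE)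
    have "gcd (c * m') (d * n') = 1" using t(1) t(4) unfolding mn g by simp
    thus "\<exists>x\<in>{1::nat..} \<times> {(m, n). gcd (c * m) (d * n) = 1}. y = (\<lambda>(t, m, n). (int t * m, int t * n)) x"
      using t(1) by (intro bexI[of _ "(nat t, m', n')"]) (auto simp: y mn)
  qed
qed

lemma infsum_even_half:
  fixes f :: "int \<times> int \<Rightarrow> complex"
  assumes sum: "f summable_on S" and S: "\<And>m n. (m, n) \<in> S \<longleftrightarrow> (- m, - n) \<in> S" "\<And>n. (0, n) \<notin> S"
    and f: "\<And>m n. f (- m, - n) = f (m, n)"
  shows "infsum f S = 2 * infsum f {(m, n) \<in> S. m > 0}"
proof -
  have bij: "bij_betw (\<lambda>(m, n). (- m, - n)) {(m, n) \<in> S. m > 0} {(m, n) \<in> S. m < 0}"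
    by (rule bij_betwI[where g = "\<lambda>(m, n). (- m, - n)"]) (auto simp: S(1)[symmetric])
  have U: "S = {(m, n) \<in> S. m > 0} \<union> {(m, n) \<in> S. m < 0}"
    using S(2) by (auto) (metis linorder_neqE)
  have s: "f summable_on {(m, n) \<in> S. m > 0}" "f summable_on {(m, n) \<in> S. m < 0}"
    by (rule summable_on_subset_banach[OF sum], force)+
  have "infsum f S = infsum f {(m, n) \<in> S. m > 0} + infsum f {(m, n) \<in> S. m < 0}"
    by (subst U, rule infsum_Un_disjoint[OF s]) auto
  also have "infsum f {(m, n) \<in> S. m < 0} = (\<Sum>\<^sub>\<infinity>x\<in>{(m, n) \<in> S. m > 0}. f ((\<lambda>(m, n). (- m, - n)) x))"
    by (rule infsum_reindex_bij_betw[OF bij, symmetric])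
  also have "\<dots> = infsum f {(m, n) \<in> S. m > 0}"
    by (rule infsum_cong) (auto simp: f)
  finally show ?thesis by simp
qed

section \<open>Reduction of the two sums to primitive pairs with positive first entry\<close>

lemma of_real_sqrt_powr: "x > 0 \<Longrightarrow> of_real (sqrt x) powr c = (of_real x powr (c / 2) :: complex)"
  by (simp add: powr_def Ln_of_real ln_sqrt)

text \<open>The primitive pairs with m = 0 are (0, 1) and (0, -1); each contributes 1, and together
  they give the term 2 zeta(q) of \<open>phi\<close>. For m > 0 the row index becomes N m because
  sqrt(N) z = N \<tau>, and the gcd condition is then plain coprimality of n with the row
  index.\<close>

lemma g_L_eq:
  assumes "N > 1" "\<alpha> - \<beta> = of_int k" "even k" "2 < Re (\<alpha> + \<beta>)" "Im z > 0"
  defines "q \<equiv> \<alpha> + \<beta>" and "\<tau> \<equiv> z / of_real (sqrt (real N))"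
  shows "g_L N z \<alpha> \<beta> = zeta q * (2 + 2 * (\<Sum>\<^sub>\<infinity>(m, n)\<in>(SIGMA m:(\<lambda>m. N * m) ` {1..}. {n. coprime (int m) n}).
            mixed_power \<alpha> \<beta> (of_nat m * \<tau> + of_int n)))"
proof -
  define f where "f = (\<lambda>(m::int, n::int). mixed_power \<alpha> \<beta> (of_real (sqrt (real N)) * of_int m * z + of_int n))"
  define S where "S = {(m, n). gcd (int N * m) (1 * n) = 1}"
  define I where "I = (\<Union>t\<in>{1..}. {(m, n). t dvd m \<and> t dvd n \<and> gcd (int N * m) (1 * n) = t})"
  have sN: "sqrt (real N) > 0" using assms by simp
  have fe: "f (m, n) = mixed_power \<alpha> \<beta> (of_int m * (of_real (sqrt (real N)) * z) + of_int n)" for m n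
    by (simp add: f_def mult_ac)
  have sum: "f summable_on A" if "A \<subseteq> UNIV - {(0, 0)}" for A
  proof (rule abs_summable_summable)
    have "(\<lambda>(m, n). norm (mixed_power \<alpha> \<beta> (of_int m * (of_real (sqrt (real N)) * z) + of_int n))) summable_on A"
      by (rule summable_mixed_power_lattice[OF assms(2,4) _ that]) (use sN assms(5) in simp)
    moreover have "norm (f x) = (\<lambda>(m, n). norm (mixed_power \<alpha> \<beta> (of_int m * (of_real (sqrt (real N)) * z) + of_int n))) x" for x
      by (cases x) (simp only: fe prod.case)
    ultimately show "(\<lambda>x. norm (f x)) summable_on A" by (simp only:)
  qed
  have I0: "I \<subseteq> UNIV - {(0, 0)}" by (auto simp: I_def)
  have S0: "S \<subseteq> UNIV - {(0, 0)}" by (auto simp: S_def)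
  have hom: "f (int t * m, int t * n) = of_nat t powr (- q) * f (m, n)" if "t \<ge> 1" for t m n
    using mixed_power_scale[of "of_nat t" \<alpha> \<beta> "of_real (sqrt (real N)) * of_int m * z + of_int n"] that
    by (simp add: f_def q_def algebra_simps)
  have "g_L N z \<alpha> \<beta> = infsum f I" by (simp add: g_L_def index_L_def I_def f_def)
  also have "\<dots> = zeta q * infsum f S"
    unfolding I_def S_def by (rule infsum_homogeneous_cone[OF bij_betw_gcd_cone hom sum[OF I0[unfolded I_def]]])
  also have "infsum f S = 2 + infsum f (S - {(0, 1), (0, -1)})"
  proof -
    have S01: "S = insert (0, 1) (insert (0, -1) (S - {(0, 1), (0, -1)}))" by (auto simp: S_def)
    have s: "f summable_on (S - {(0, 1), (0, -1)})" "f summable_on insert (0, -1) (S - {(0, 1), (0, -1)})"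
      using S0 by (auto intro!: sum)
    have "f (0, 1) = 1" by (simp add: f_def mixed_power_def)
    moreover have "f (0, -1) = 1" using mixed_power_minus[OF assms(2,3), of 1] by (simp add: f_def mixed_power_def)
    moreover have "infsum f S = infsum f (insert (0, 1) (insert (0, -1) (S - {(0, 1), (0, -1)})))"
      by (rule arg_cong[OF S01])
    moreover have "\<dots> = f (0, 1) + infsum f (insert (0, -1) (S - {(0, 1), (0, -1)}))"
      by (rule infsum_insert[OF s(2)]) simp
    moreover have "infsum f (insert (0, -1) (S - {(0, 1), (0, -1)})) = f (0, -1) + infsum f (S - {(0, 1), (0, -1)})"
      by (rule infsum_insert[OF s(1)]) simp
    ultimately show ?thesis by (simp only:) simp
  qed
  also have "infsum f (S - {(0, 1), (0, -1)}) = 2 * infsum f {(m, n) \<in> S - {(0, 1), (0, -1)}. m > 0}"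
  proof (rule infsum_even_half)
    show "f (- m, - n) = f (m, n)" for m n
      using mixed_power_minus[OF assms(2,3), of "of_real (sqrt (real N)) * of_int m * z + of_int n"]
      by (simp add: f_def algebra_simps)
  qed (use S0 in \<open>auto intro!: sum simp: S_def zmult_eq_1_iff\<close>)
  also have "infsum f {(m, n) \<in> S - {(0, 1), (0, -1)}. m > 0} =
      (\<Sum>\<^sub>\<infinity>(m, n)\<in>(SIGMA m:(\<lambda>m. N * m) ` {1..}. {n. coprime (int m) n}). mixed_power \<alpha> \<beta> (of_nat m * \<tau> + of_int n))"
  proof -
    have N0: "N \<noteq> 0" using assms by simp
    have bij: "bij_betw (\<lambda>(M, n). (int (M div N), n)) (SIGMA m:(\<lambda>m. N * m) ` {1..}. {n. coprime (int m) n}) {(m, n) \<in> S - {(0, 1), (0, -1)}. m > 0}"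
      by (rule bij_betwI[where g = "\<lambda>(m, n). (N * nat m, n)"])
         (use N0 in \<open>auto simp: S_def coprime_iff_gcd_eq_1[symmetric] image_iff Suc_le_eq intro!: bexI[of _ "nat _"]\<close>)
    have "infsum f {(m, n) \<in> S - {(0, 1), (0, -1)}. m > 0} =
       (\<Sum>\<^sub>\<infinity>x\<in>(SIGMA m:(\<lambda>m. N * m) ` {1..}. {n. coprime (int m) n}). f ((\<lambda>(M, n). (int (M div N), n)) x))"
      by (rule infsum_reindex_bij_betw[OF bij, symmetric])
    also have "\<dots> = (\<Sum>\<^sub>\<infinity>(m, n)\<in>(SIGMA m:(\<lambda>m. N * m) ` {1..}. {n. coprime (int m) n}). mixed_power \<alpha> \<beta> (of_nat m * \<tau> + of_int n))"
    proof (rule infsum_cong, clarify)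
      fix j n :: "nat" and l :: int
      have "complex_of_nat N = of_real (sqrt (real N)) * of_real (sqrt (real N))"
        by (simp flip: of_real_mult)
      hence A: "of_real (sqrt (real N)) * of_int (int j) * z = of_nat (N * j) * \<tau>"
        using sN by (simp add: \<tau>_def field_simps)
      have d: "N * j div N = j" using N0 by simp
      show "f (int (N * j div N), l) = mixed_power \<alpha> \<beta> (of_nat (N * j) * \<tau> + of_int l)"
        unfolding f_def d prod.case A ..
    qed
    finally show ?thesis .
  qed
  finally show ?thesis .
qed

text \<open>Taking out sqrt(N) leaves the same \<tau> as on the L side and a factor N^(-q/2). No
  primitive pair has m = 0, since the gcd is then N |n| and N > 1; otherwise the condition says that
  m is prime to both N and n.\<close>

lemma g_R_eq:
  assumes "N > 1" "\<alpha> - \<beta> = of_int k" "even k" "2 < Re (\<alpha> + \<beta>)" "Im z > 0"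
  defines "q \<equiv> \<alpha> + \<beta>" and "\<tau> \<equiv> z / of_real (sqrt (real N))"
  shows "g_R N z \<alpha> \<beta> = zeta q * (2 * of_nat N powr (- q / 2) * (\<Sum>\<^sub>\<infinity>(m, n)\<in>(SIGMA m:{m. m \<ge> 1 \<and> coprime m N}. {n. coprime (int m) n}).
            mixed_power \<alpha> \<beta> (of_nat m * \<tau> + of_int n)))"
proof -
  define h where "h = (\<lambda>(m::int, n::int). mixed_power \<alpha> \<beta> (of_int m * \<tau> + of_int n))"
  define f where "f = (\<lambda>(m::int, n::int). mixed_power \<alpha> \<beta> (of_int m * z + of_real (sqrt (real N)) * of_int n))"
  define S where "S = {(m, n). gcd (1 * m) (int N * n) = 1}"
  define I where "I = (\<Union>t\<in>{1..}. {(m, n). t dvd m \<and> t dvd n \<and> gcd (1 * m) (int N * n) = t})"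
  have sN: "sqrt (real N) > 0" using assms by simp
  have fh: "f x = of_nat N powr (- q / 2) * h x" for x
  proof -
    obtain m n where x: "x = (m, n)" by (cases x)
    have "of_int m * z + of_real (sqrt (real N)) * of_int n = of_real (sqrt (real N)) * (of_int m * \<tau> + of_int n)"
      using sN by (simp add: \<tau>_def field_simps)
    moreover have "of_real (sqrt (real N)) powr (- (\<alpha> + \<beta>)) = (of_nat N powr (- q / 2) :: complex)"
      using of_real_sqrt_powr[of "real N" "- (\<alpha> + \<beta>)"] assms(1) by (simp add: q_def)
    ultimately show ?thesis using mixed_power_scale[OF sN, of \<alpha> \<beta> "of_int m * \<tau> + of_int n"]
      by (simp add: f_def h_def x)
  qed
  have sum: "h summable_on A" if "A \<subseteq> UNIV - {(0, 0)}" for A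
  proof (rule abs_summable_summable)
    have "(\<lambda>(m, n). norm (mixed_power \<alpha> \<beta> (of_int m * \<tau> + of_int n))) summable_on A"
      by (rule summable_mixed_power_lattice[OF assms(2,4) _ that]) (use sN assms(5) in \<open>simp add: \<tau>_def Im_divide_of_real\<close>)
    moreover have "norm (h x) = (\<lambda>(m, n). norm (mixed_power \<alpha> \<beta> (of_int m * \<tau> + of_int n))) x" for x
      by (cases x) (simp only: h_def prod.case)
    ultimately show "(\<lambda>x. norm (h x)) summable_on A" by (simp only:)
  qed
  have I0: "I \<subseteq> UNIV - {(0, 0)}" by (auto simp: I_def)
  have S0: "S \<subseteq> UNIV - {(0, 0)}" by (auto simp: S_def)
  have hom: "h (int t * m, int t * n) = of_nat t powr (- q) * h (m, n)" if "t \<ge> 1" for t m n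
    using mixed_power_scale[of "of_nat t" \<alpha> \<beta> "of_int m * \<tau> + of_int n"] that
    by (simp add: h_def q_def algebra_simps)
  have "g_R N z \<alpha> \<beta> = infsum f I" by (simp add: g_R_def index_R_def I_def f_def)
  also have "\<dots> = of_nat N powr (- q / 2) * infsum h I" unfolding fh by (rule infsum_cmult_right')
  also have "infsum h I = zeta q * infsum h S"
    unfolding I_def S_def by (rule infsum_homogeneous_cone[OF bij_betw_gcd_cone hom sum[OF I0[unfolded I_def]]])
  also have "infsum h S = 2 * infsum h {(m, n) \<in> S. m > 0}"
  proof (rule infsum_even_half)
    show "h (- m, - n) = h (m, n)" for m n
      using mixed_power_minus[OF assms(2,3), of "of_int m * \<tau> + of_int n"]
      by (simp add: h_def algebra_simps)
    show "(0, n) \<notin> S" for n using assms(1) by (auto simp: S_def abs_mult zmult_eq_1_iff)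
  qed (use S0 in \<open>auto intro!: sum simp: S_def\<close>)
  also have "infsum h {(m, n) \<in> S. m > 0} =
      (\<Sum>\<^sub>\<infinity>(m, n)\<in>(SIGMA m:{m. m \<ge> 1 \<and> coprime m N}. {n. coprime (int m) n}). mixed_power \<alpha> \<beta> (of_nat m * \<tau> + of_int n))"
  proof -
    have bij: "bij_betw (\<lambda>(M, n). (int M, n)) (SIGMA m:{m. m \<ge> 1 \<and> coprime m N}. {n. coprime (int m) n}) {(m, n) \<in> S. m > 0}"
    proof (rule bij_betwI[where g = "\<lambda>(m, n). (nat m, n)"])
      have c: "gcd (int m) (int N * n) = 1 \<longleftrightarrow> coprime m N \<and> coprime (int m) n" for m n
        unfolding coprime_iff_gcd_eq_1[symmetric] by simp
      show "(\<lambda>(M, n). (int M, n)) \<in> (SIGMA m:{m. m \<ge> 1 \<and> coprime m N}. {n. coprime (int m) n}) \<rightarrow> {(m, n) \<in> S. m > 0}"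
        by (auto simp: S_def c)
      show "(\<lambda>(m, n). (nat m, n)) \<in> {(m, n) \<in> S. m > 0} \<rightarrow> (SIGMA m:{m. m \<ge> 1 \<and> coprime m N}. {n. coprime (int m) n})"
      proof safe
        fix m n assume mn: "(m, n) \<in> S" "m > 0"
        hence "gcd (int (nat m)) (int N * n) = 1" by (simp add: S_def)
        thus "coprime (nat m) N" "coprime (int (nat m)) n" unfolding c by auto
        show "1 \<le> nat m" using mn by simp
      qed
    qed auto
    have "infsum h {(m, n) \<in> S. m > 0} =
       (\<Sum>\<^sub>\<infinity>x\<in>(SIGMA m:{m. m \<ge> 1 \<and> coprime m N}. {n. coprime (int m) n}). h ((\<lambda>(M, n). (int M, n)) x))"
      by (rule infsum_reindex_bij_betw[OF bij, symmetric])
    thus ?thesis by (simp add: h_def case_prod_unfold)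
  qed
  finally show ?thesis by (simp add: mult_ac)
qed

section \<open>The Fourier expansion\<close>

text \<open>Scaling the frequency to one puts the transform at y = |t|, which is the argument 2 |t|
  of W. The power of sqrt 2 pi collects (2 pi)^(q - 1) from the scaling, 2 pi from the normalisation
  and 2^(-q/2) from the power of 2 |t|. For n < 0 the exponents are swapped, which is the sign in
  front of k.\<close>

lemma kft_eq_modified_W:
  assumes q: "2 < Re (\<alpha> + \<beta>)" and k: "\<alpha> - \<beta> = of_int k" and Y: "Y > 0" and n: "n \<noteq> 0"
  shows "kft \<alpha> \<beta> Y (2 * pi * of_int n) =
     of_real (sqrt 2 * pi) powr (\<alpha> + \<beta>) *
     (of_int \<bar>n\<bar> powr (\<alpha> + \<beta> - 1) / Gamma ((\<alpha> + \<beta>) / 2 + of_int (sgn n) * (\<alpha> - \<beta>) / 2)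
        * modified_W (2 * pi * of_int n * Y) \<alpha> \<beta>)"
proof -
  have pos: "kft a b Y (2 * pi * of_int m) =
     of_real (sqrt 2 * pi) powr (a + b) * (of_int m powr (a + b - 1) / Gamma a
       * (of_real (2 * pi * of_int m * Y) powr (- (a + b) / 2) * whittaker_W ((a - b) / 2) ((a + b - 1) / 2) (2 * (2 * pi * of_int m * Y))))"
    if m: "m > 0" and ab: "2 < Re (a + b)" "a - b = of_int j" for a b and m j :: int
  proof -
    define q where "q = a + b"
    define t where "t = 2 * pi * of_int m * Y"
    define W where "W = whittaker_W ((a - b) / 2) ((a + b - 1) / 2) (2 * t)"
    have t: "t > 0" and xi: "2 * pi * of_int m > 0" using m Y by (auto simp: t_def)
    have "a - b = of_real (of_int j)" using ab(2) by simp
    hence h: "kft a b (2 * t / 2) 1 = 2 * of_real pi * rGamma a * of_real (2 * t) powr (- q / 2) * W"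
      unfolding q_def W_def by (rule kft_eq_whittaker_W[OF ab(1)]) (use t in simp)
    hence 1: "kft a b Y (2 * pi * of_int m) = of_real (2 * pi * of_int m) powr (q - 1) * (2 * of_real pi * rGamma a * of_real (2 * t) powr (- q / 2) * W)"
      using kft_scale'[OF Y xi, of a b, folded t_def q_def] h by (simp only: nonzero_mult_div_cancel_left[OF zero_neq_numeral[symmetric]])
    have mu: "of_real (x * y) powr c = of_real x powr c * (of_real y powr c :: complex)" if "x > 0" for x y c
      using that powr_times_real_left[of "of_real x" "of_real y" c] by simp
    have 2: "of_real (2 * pi * of_int m) powr (q - 1) = of_real (2 * pi) powr (q - 1) * (of_int m powr (q - 1) :: complex)"
      using mu[of "2 * pi" "of_int m" "q - 1"] by simp
    have 3: "of_real (2 * t) powr (- q / 2) = 2 powr (- q / 2) * (of_real t powr (- q / 2) :: complex)"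
      using mu[of 2 t "- q / 2"] by simp
    have 4: "of_real (2 * pi) powr (q - 1) * (2 * of_real pi) = (of_real (2 * pi) powr q :: complex)"
      by (simp add: powr_diff)
    have 5: "of_real (2 * pi) powr q * 2 powr (- q / 2) = (of_real (sqrt 2 * pi) powr q :: complex)"
    proof -
      have "of_real (2 * pi) powr q = 2 powr q * (of_real pi powr q :: complex)" using mu[of 2 pi q] by simp
      moreover have "of_real (sqrt 2 * pi) powr q = 2 powr (q / 2) * (of_real pi powr q :: complex)"
        using mu[of "sqrt 2" pi q] of_real_sqrt_powr[of 2 q] by simp
      moreover have "2 powr q * 2 powr (- q / 2) = (2 powr (q / 2) :: complex)"
        by (simp add: powr_add[symmetric])
      ultimately show ?thesis by simp
    qed
    have "kft a b Y (2 * pi * of_int m) = (of_real (2 * pi) powr (q - 1) * (2 * of_real pi)) * 2 powr (- q / 2) *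
        (of_int m powr (q - 1) * rGamma a * (of_real t powr (- q / 2) * W))"
      unfolding 1 2 3 by (simp only: mult_ac)
    also have "\<dots> = of_real (sqrt 2 * pi) powr q * (of_int m powr (q - 1) / Gamma a * (of_real t powr (- q / 2) * W))"
      unfolding 4 5 unfolding rGamma_inverse_Gamma divide_inverse by (simp only: mult.assoc)
    finally show ?thesis unfolding q_def t_def W_def .
  qed
  show ?thesis
  proof (cases "n > 0")
    case True
    have t: "2 * pi * of_int n * Y > 0" using True Y by simp
    have G: "(\<alpha> + \<beta>) / 2 + of_int (sgn n) * (\<alpha> - \<beta>) / 2 = \<alpha>"
      using True by (simp add: add_divide_distrib[symmetric])
    show ?thesis unfolding G modified_W_def Let_def
      using pos[OF True q k] True t by simp
  next
    case False
    hence n: "- n > 0" using n by simp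
    have t: "2 * pi * of_int n * Y < 0" using n Y by (simp add: mult_less_0_iff)
    have G: "(\<alpha> + \<beta>) / 2 + of_int (sgn n) * (\<alpha> - \<beta>) / 2 = \<beta>"
      using n by (simp add: add_divide_distrib[symmetric] diff_divide_distrib[symmetric])
    have "kft \<alpha> \<beta> Y (2 * pi * of_int n) = kft \<beta> \<alpha> Y (2 * pi * of_int (- n))"
      using kft_minus[of \<alpha> \<beta> Y "2 * pi * of_int (- n)"] by simp
    also have "\<dots> = of_real (sqrt 2 * pi) powr (\<beta> + \<alpha>) * (of_int (- n) powr (\<beta> + \<alpha> - 1) / Gamma \<beta>
       * (of_real (2 * pi * of_int (- n) * Y) powr (- (\<beta> + \<alpha>) / 2) * whittaker_W ((\<beta> - \<alpha>) / 2) ((\<beta> + \<alpha> - 1) / 2) (2 * (2 * pi * of_int (- n) * Y))))"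
    proof (rule pos[OF n])
      show "\<beta> - \<alpha> = of_int (- k)" using k by (simp add: algebra_simps)
    qed (use q in \<open>simp add: add.commute\<close>)
    finally have *: "kft \<alpha> \<beta> Y (2 * pi * of_int n) = \<dots>" .
    have abs: "\<bar>2 * pi * of_int n * Y\<bar> = 2 * pi * of_int (- n) * Y" using t by simp
    have sg: "sgn (2 * pi * of_int n * Y) = -1" using t by simp
    have ka: "of_real (- 1) * (\<alpha> - \<beta>) / 2 = (\<beta> - \<alpha>) / 2" by simp
    show ?thesis unfolding G modified_W_def Let_def abs sg ka *
      using n by (simp add: add.commute)
  qed
qed

theorem theorem1p3:
  fixes N :: nat and \<alpha> \<beta> q z :: complex and k :: int
  assumes "N > 1"
    and "q = \<alpha> + \<beta>" and "Re q > 2"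
    and "\<alpha> - \<beta> = of_int k" and "even k"
    and "Im z > 0"
  shows "fourier_term N z \<alpha> \<beta> summable_on {n. n \<noteq> 0} \<and>
    g_total N z \<alpha> \<beta> =
      phi N (Im z) q k +
      2 * (-1) powi (k div 2) * zeta q * of_real (sqrt 2 * pi / sqrt (real N)) powr q *
        (\<Sum>\<^sub>\<infinity>n\<in>{n. n \<noteq> 0}. fourier_term N z \<alpha> \<beta> n)"
proof -
  define \<tau> where "\<tau> = z / of_real (sqrt (real N))"
  define X where "X = Re z / sqrt (real N)"
  define Y where "Y = Im z / sqrt (real N)"
  define sg where "sg = ((-1) powi (k div 2) :: complex)"
  define Nq where "Nq = (of_nat N powr (- q / 2) :: complex)"
  define E where "E = (\<lambda>n::int. kft \<alpha> \<beta> Y (2 * pi * of_int n) * cis (2 * pi * of_int n * X))"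
  define C where "C = (of_real (sqrt 2 * pi / sqrt (real N)) powr q :: complex)"
  have q2: "2 < Re (\<alpha> + \<beta>)" using assms by simp
  have sN: "sqrt (real N) > 0" "N > 0" using assms by auto
  have \<tau>: "Re \<tau> = X" "Im \<tau> = Y" by (simp_all add: \<tau>_def X_def Y_def Re_divide_of_real Im_divide_of_real)
  have Y: "Y > 0" using assms sN by (simp add: Y_def)
  define AL where "AL = (\<lambda>m. N * m) ` {1..}"
  define AR where "AR = {m. m \<ge> 1 \<and> coprime m N}"
  have sub: "AL \<subseteq> {1..}" "AR \<subseteq> {1..}" using sN by (auto simp: AL_def AR_def Suc_le_eq)
  \<comment> \<open>N^(-q) is split evenly: one half belongs to \<open>L_factor\<close>, the other
    is the factor that the R side carries as well.\<close>
  have RL: "(\<Sum>\<^sub>\<infinity>m\<in>AL. ramanujan_term n q m) = Nq * (Nq * ramanujan_L N n q)" for n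
  proof -
    have "of_nat N powr (- q) = Nq * Nq" unfolding Nq_def powr_add[symmetric] by simp
    thus ?thesis using ramanujan_L_multiples[OF sN(2), of q n] by (simp add: AL_def mult.assoc)
  qed
  have RR: "(\<Sum>\<^sub>\<infinity>m\<in>AR. ramanujan_term n q m) = ramanujan_L 1 n q / ramanujan_L_local N n q" for n
    using ramanujan_L_quotient[OF _ sN(2), of q n] assms by (simp add: AR_def)
  have Yt: "Im \<tau> > 0" using Y \<tau> by simp
  note L = mixed_power_coprime_sum[OF assms(4,5) q2 Yt sub(1), folded assms(2), unfolded \<tau> RL, folded E_def[unfolded fun_eq_iff, rule_format]]
  note R = mixed_power_coprime_sum[OF assms(4,5) q2 Yt sub(2), folded assms(2), unfolded \<tau> RR, folded E_def[unfolded fun_eq_iff, rule_format]]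
  have LF: "Nq * (E n * L_factor N n q) = E n * (Nq * (Nq * ramanujan_L N n q)) + Nq * (E n * (ramanujan_L 1 n q / ramanujan_L_local N n q))" for n
    by (simp add: L_factor_def Nq_def algebra_simps)
  have sum1: "(\<lambda>n. Nq * (E n * L_factor N n q)) summable_on UNIV"
    unfolding LF by (intro summable_on_add L(1) summable_on_cmult_right R(1))
  have Nq0: "Nq \<noteq> 0" using sN by (simp add: Nq_def)
  have sum2: "(\<lambda>n. E n * L_factor N n q) summable_on UNIV"
    using sum1 Nq0 by (subst (asm) summable_on_cmult_right') auto
  have g: "g_total N z \<alpha> \<beta> = 2 * zeta q + 2 * zeta q * sg * (\<Sum>\<^sub>\<infinity>n. Nq * (E n * L_factor N n q))"
  proof -
    have "(\<Sum>\<^sub>\<infinity>n. Nq * (E n * L_factor N n q)) = (\<Sum>\<^sub>\<infinity>n. E n * (Nq * (Nq * ramanujan_L N n q))) +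
          Nq * (\<Sum>\<^sub>\<infinity>n. E n * (ramanujan_L 1 n q / ramanujan_L_local N n q))"
      unfolding LF infsum_cmult_right'[symmetric]
      by (intro infsum_add L(1) summable_on_cmult_right R(1))
    moreover have "g_L N z \<alpha> \<beta> = zeta q * (2 + 2 * (sg * (\<Sum>\<^sub>\<infinity>n. E n * (Nq * (Nq * ramanujan_L N n q)))))"
      using g_L_eq[OF assms(1,4,5) q2 assms(6), folded assms(2) \<tau>_def AL_def] unfolding L(2) sg_def .
    moreover have "g_R N z \<alpha> \<beta> = zeta q * (2 * Nq * (sg * (\<Sum>\<^sub>\<infinity>n. E n * (ramanujan_L 1 n q / ramanujan_L_local N n q))))"
      using g_R_eq[OF assms(1,4,5) q2 assms(6), folded assms(2) \<tau>_def AR_def] unfolding R(2) sg_def Nq_def .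
    ultimately show ?thesis unfolding g_total_def by (simp add: algebra_simps)
  qed
  \<comment> \<open>The factor N^(-q/2) common to both sides is absorbed into the base of the q-th
    power.\<close>
  have NC: "Nq * of_real (sqrt 2 * pi) powr q = C"
  proof -
    have "C = of_real (1 / sqrt (real N)) powr q * of_real (sqrt 2 * pi) powr q"
      unfolding C_def using powr_times_real_left[of "of_real (1 / sqrt (real N))" "of_real (sqrt 2 * pi)" q] by simp
    also have "of_real (1 / sqrt (real N)) powr q = Nq"
      unfolding powr_of_real_inverse[OF sN(1)] Nq_def using of_real_sqrt_powr[of "real N" "- q"] sN by simp
    finally show ?thesis ..
  qed
  have ft: "Nq * (E n * L_factor N n q) = C * fourier_term N z \<alpha> \<beta> n" if n: "n \<noteq> 0" for n
  proof -
    define W where "W = of_int \<bar>n\<bar> powr (q - 1) / Gamma (q / 2 + of_int (sgn n) * (\<alpha> - \<beta>) / 2) * modified_W (2 * pi * of_int n * Y) \<alpha> \<beta>"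
    have k: "kft \<alpha> \<beta> Y (2 * pi * of_int n) = of_real (sqrt 2 * pi) powr q * W"
      unfolding W_def assms(2) by (rule kft_eq_modified_W[OF q2 assms(4) Y n])
    have c: "cis (2 * pi * of_int n * X) = exp (2 * of_real pi * \<i> * of_int n * of_real (Re z) / of_real (sqrt (real N)))"
      unfolding cis_conv_exp X_def by (rule arg_cong[where f = exp]) simp
    have Yn: "2 * pi * of_int n * Y = 2 * pi * of_int n * Im z / sqrt (real N)" by (simp add: Y_def)
    have "fourier_term N z \<alpha> \<beta> n = W * L_factor N n q * cis (2 * pi * of_int n * X)"
      unfolding fourier_term_def Let_def W_def Yn c assms(2)[symmetric] ..
    thus ?thesis unfolding E_def k NC[symmetric] by (simp only: mult_ac)
  qed
  have C0: "C \<noteq> 0" using sN by (simp add: C_def)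
  have U: "(UNIV :: int set) = insert 0 {n. n \<noteq> 0}" by auto
  have s0: "(\<lambda>n. Nq * (E n * L_factor N n q)) summable_on {n. n \<noteq> 0}"
    by (rule summable_on_subset_banach[OF sum1]) simp
  hence "(\<lambda>n. C * fourier_term N z \<alpha> \<beta> n) summable_on {n. n \<noteq> 0}"
    by (subst summable_on_cong[where g = "\<lambda>n. Nq * (E n * L_factor N n q)"]) (auto simp: ft)
  hence sft: "fourier_term N z \<alpha> \<beta> summable_on {n. n \<noteq> 0}"
    using C0 by (subst (asm) summable_on_cmult_right') auto
  have "(\<Sum>\<^sub>\<infinity>n. Nq * (E n * L_factor N n q)) = Nq * (E 0 * L_factor N 0 q) + (\<Sum>\<^sub>\<infinity>n\<in>{n. n \<noteq> 0}. Nq * (E n * L_factor N n q))"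
    unfolding U by (rule infsum_insert[OF s0]) simp
  also have "(\<Sum>\<^sub>\<infinity>n\<in>{n. n \<noteq> 0}. Nq * (E n * L_factor N n q)) = (\<Sum>\<^sub>\<infinity>n\<in>{n. n \<noteq> 0}. C * fourier_term N z \<alpha> \<beta> n)"
    by (rule infsum_cong) (auto simp: ft)
  also have "\<dots> = C * (\<Sum>\<^sub>\<infinity>n\<in>{n. n \<noteq> 0}. fourier_term N z \<alpha> \<beta> n)"
    by (rule infsum_cmult_right')
  finally have total: "(\<Sum>\<^sub>\<infinity>n. Nq * (E n * L_factor N n q)) = Nq * (E 0 * L_factor N 0 q) + C * (\<Sum>\<^sub>\<infinity>n\<in>{n. n \<noteq> 0}. fourier_term N z \<alpha> \<beta> n)" .
  \<comment> \<open>At a pole of Gamma both \<open>rGamma\<close> and the quotient by Gamma are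
    zero, so the passage between the two forms needs no case distinction.\<close>
  have E0: "E 0 = of_real (2 * Im z / sqrt (real N)) powr (1 - q)
       * (2 * of_real pi * Gamma (q - 1) / (Gamma ((q + of_int k) / 2) * Gamma ((q - of_int k) / 2)))"
  proof -
    have ab: "(q + of_int k) / 2 = \<alpha>" "(q - of_int k) / 2 = \<beta>"
      unfolding assms(2) assms(4)[symmetric] by simp_all
    have "E 0 = 2 * of_real pi * of_real (2 * Y) powr (1 - q) * Gamma (q - 1) * rGamma \<alpha> * rGamma \<beta>"
      using kft_zero[OF q2 Y] by (simp add: E_def assms(2))
    also have "2 * Y = 2 * Im z / sqrt (real N)" by (simp add: Y_def)
    finally show ?thesis unfolding ab by (simp add: rGamma_inverse_Gamma divide_inverse mult_ac)
  qed
  have "phi N (Im z) q k = 2 * zeta q + 2 * sg * Nq * zeta q * E 0 * L_factor N 0 q"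
    unfolding phi_def E0 sg_def Nq_def by (simp only: mult.assoc)
  hence "g_total N z \<alpha> \<beta> = phi N (Im z) q k + 2 * sg * zeta q * C * (\<Sum>\<^sub>\<infinity>n\<in>{n. n \<noteq> 0}. fourier_term N z \<alpha> \<beta> n)"
    unfolding g total by (simp add: algebra_simps)
  thus ?thesis using sft unfolding sg_def C_def by blast
qed

end
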